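(* Let $a,b\in(1,\infty)$ and $C_0>0$ be constants that do not depend on the dimension $d\in\mathbb{N}$. Let $D\subset\mathbb{R}^d$ be a bounded convex domain, let $f$ be Hölder continuous and, additionally, Lipschitz continuous on $\overline{D}$, and let $g$ be extendable to $\overline{D}$ such that $g\in C^2(\overline{D})$, with $g$ Lipschitz continuous on $\overline{D}$. Let $u$ be the solution of $$-\Delta u=f\ \text{ in } D,\qquad u|_{\partial D}=g .$$ Suppose that for every $\delta,\delta_f,\delta_g\in(0,1)$ there exist ReLU DNNs $\phi_{\mathrm{dist},\delta}$, $\phi_{f,\delta_f}$, $\phi_{g,\delta_g}$ (with input dimension $d$ and output dimension $1$) such that $$\sup_{x\in D}|\mathrm{dist}(x,\partial D)-\phi_{\mathrm{dist},\delta}(x)|\le\delta,\qquad \|f-\phi_{f,\delta_f}\|_{L^\infty(D)}\le\delta_f,\qquad \|g-\phi_{g,\delta_g}\|_{L^\infty(D)}\le\delta_g,$$ and $$\mathrm{size}(\phi_{\mathrm{dist},\delta})\le C_0\,d^a\lceil\log(\delta^{-1})\rceil^b,\qquad \mathrm{size}(\phi_{f,\delta_f})\le C_0\,d^a\delta_f^{-b},\qquad \mathrm{size}(\phi_{g,\delta_g})\le C_0\,d^a\delta_g^{-b}.$$ Then for every $\bar\delta\in(0,1)$ there exists a ReLU DNN $\phi_{u,\bar\delta}$ such that $$\|u-\phi_{u,\bar\delta}\|_{L^2(D)}\le\bar\delta$$ and $$\mathrm{size}(\phi_{u,\bar\delta})\le C\,d^a\,\bar\delta^{-14-6b}\,\bigl(1+|D|^{14+6b}\bigr),$$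 where the constant $C>0$ depends only on $a$, $b$, $C_0$, $\|f\|_{L^\infty(D)}$, $\|\Delta g\|_{L^\infty(D)}$, $\|g\|_{L^\infty(D)}$, the Lipschitz constants of $f$ and $g$, and $\mathrm{diam}(D)$ (in particular, not otherwise on $d$ and not on $\bar\delta$).
   Context: ReLU DNNs: Let $\sigma(x)=\max\{0,x\}$ for $x\in\mathbb{R}$, applied coordinatewise to vectors. For a depth $L\in\mathbb{N}$, positive integers $N_0,\dots,N_L$, matrices $A^i\in\mathbb{R}^{N_i\times N_{i-1}}$ and vectors $b^i\in\mathbb{R}^{N_i}$ ($i=1,\dots,L$), the associated ReLU DNN is the function $\phi^L:\mathbb{R}^{N_0}\to\mathbb{R}^{N_L}$ given by $\phi^1(x)=A^1x+b^1$ and $\phi^i(x)=A^i\sigma(\phi^{i-1}(x))+b^i$ for $i=2,\dots,L$. Its weights are the entries of $(A^i,b^i)_{i=1,\dots,L}$, and its size, $\mathrm{size}(\phi^L)$, is the number of non-zero weights. A ReLU DNN is identified with the function it realizes (no notational distinction is made between network and realization). Notation: $\mathrm{dist}(x,\partial D)$ is the Euclidean distance from $x$ to $\partial D$; $|D|$ is the Lebesgue measure of $D$; $\mathrm{diam}(D)$ is its diameter; $C^2(\overline{D})$ denotes the twice continuously differentiable functions on $\overline{D}$; $L^2(D)$ is taken with respect to Lebesgue measure. The solution $u$ is the unique classical solution $u\in C^2(D)\cap C(\overline{D})$. *)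

theory Defs
  imports "HOL-Analysis.Analysis" "HOL-Probability.Essential_Supremum"
begin

section \<open>The space $R^d$ for a dimension $d$ that is an ordinary variable\<close>

text \<open>
  The constant of the theorem has to be uniform in \<open>d\<close>, so \<open>d\<close> must be quantified inside the
  statement and cannot be a type. A point of $R^d$ is an element of \<open>PiE {..<d} (\<lambda>_. UNIV)\<close>,
  which is both the carrier of \<open>powertop_real {..<d}\<close> and the space of
  \<open>Pi\<^sub>M {..<d} (\<lambda>_. lborel)\<close>. A function on a subset of $R^d$ is a total function whose values
  off that subset are irrelevant.

  The type-class \<open>dist\<close>, \<open>bounded\<close>, \<open>diameter\<close> and \<open>lipschitz_on\<close> at type \<open>nat \<Rightarrow> real\<close>
  refer to a metric for the product topology that is not the Euclidean one; hence the explicit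
  versions below.
\<close>

type_synonym point = "nat \<Rightarrow> real"

abbreviation rtop :: "nat \<Rightarrow> point topology" where
  "rtop d \<equiv> powertop_real {..<d}"

abbreviation rleb :: "nat \<Rightarrow> point measure" where
  "rleb d \<equiv> Pi\<^sub>M {..<d} (\<lambda>_. lborel)"

definition edist :: "nat \<Rightarrow> point \<Rightarrow> point \<Rightarrow> real" where
  "edist d x y = L2_set (\<lambda>i. x i - y i) {..<d}"

definition dist_bdry :: "nat \<Rightarrow> point set \<Rightarrow> point \<Rightarrow> real" where
  "dist_bdry d D x = (INF y\<in>rtop d frontier_of D. edist d x y)"

definition ediam :: "nat \<Rightarrow> point set \<Rightarrow> real" where
  "ediam d D = (SUP (x, y)\<in>D \<times> D. edist d x y)"

text \<open>Connectedness of a convex set is automatic, so a convex domain is a nonempty open convex set.\<close>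

definition bounded_convex_domain :: "nat \<Rightarrow> point set \<Rightarrow> bool" where
  "bounded_convex_domain d D \<longleftrightarrow>
     openin (rtop d) D \<and> D \<noteq> {} \<and>
     (\<forall>x\<in>D. \<forall>y\<in>D. \<forall>t\<in>{0..1}. (\<lambda>i\<in>{..<d}. (1 - t) * x i + t * y i) \<in> D) \<and>
     (\<exists>R. \<forall>x\<in>D. \<forall>y\<in>D. edist d x y \<le> R)"

section \<open>Regularity of functions\<close>

definition cont_on :: "nat \<Rightarrow> point set \<Rightarrow> (point \<Rightarrow> real) \<Rightarrow> bool" where
  "cont_on d S h \<longleftrightarrow> continuous_map (subtopology (rtop d) S) euclideanreal h"

definition holder_cont_on :: "nat \<Rightarrow> point set \<Rightarrow> (point \<Rightarrow> real) \<Rightarrow> bool" where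
  "holder_cont_on d S h \<longleftrightarrow>
     (\<exists>\<alpha> K. 0 < \<alpha> \<and> \<alpha> \<le> 1 \<and> (\<forall>x\<in>S. \<forall>y\<in>S. \<bar>h x - h y\<bar> \<le> K * edist d x y powr \<alpha>))"

definition lip_bounds :: "nat \<Rightarrow> point set \<Rightarrow> (point \<Rightarrow> real) \<Rightarrow> real set" where
  "lip_bounds d S h = {K. 0 \<le> K \<and> (\<forall>x\<in>S. \<forall>y\<in>S. \<bar>h x - h y\<bar> \<le> K * edist d x y)}"

definition lipschitz_cont_on :: "nat \<Rightarrow> point set \<Rightarrow> (point \<Rightarrow> real) \<Rightarrow> bool" where
  "lipschitz_cont_on d S h \<longleftrightarrow> lip_bounds d S h \<noteq> {}"

text \<open>The Lipschitz constant is the least admissible one.\<close>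

definition lip_const :: "nat \<Rightarrow> point set \<Rightarrow> (point \<Rightarrow> real) \<Rightarrow> real" where
  "lip_const d S h = Inf (lip_bounds d S h)"

definition partial :: "nat \<Rightarrow> (point \<Rightarrow> real) \<Rightarrow> point \<Rightarrow> real" where
  "partial i h x = deriv (\<lambda>t. h (x(i := t))) (x i)"

definition partial_exists :: "nat \<Rightarrow> (point \<Rightarrow> real) \<Rightarrow> point \<Rightarrow> bool" where
  "partial_exists i h x \<longleftrightarrow> (\<lambda>t. h (x(i := t))) field_differentiable at (x i)"

definition laplacian :: "nat \<Rightarrow> (point \<Rightarrow> real) \<Rightarrow> point \<Rightarrow> real" where
  "laplacian d h x = (\<Sum>i<d. partial i (partial i h) x)"

text \<open>$C^2(D)$ for open \<open>D\<close>: all partial derivatives of order at most 2 exist and are continuous.\<close>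

definition C2_on :: "nat \<Rightarrow> point set \<Rightarrow> (point \<Rightarrow> real) \<Rightarrow> bool" where
  "C2_on d D h \<longleftrightarrow>
     cont_on d D h \<and>
     (\<forall>i<d. (\<forall>x\<in>D. partial_exists i h x) \<and> cont_on d D (partial i h)) \<and>
     (\<forall>i<d. \<forall>j<d. (\<forall>x\<in>D. partial_exists j (partial i h) x) \<and>
                  cont_on d D (partial j (partial i h)))"

definition extends_cont :: "nat \<Rightarrow> point set \<Rightarrow> (point \<Rightarrow> real) \<Rightarrow> bool" where
  "extends_cont d D h \<longleftrightarrow> (\<exists>H. cont_on d (rtop d closure_of D) H \<and> (\<forall>x\<in>D. H x = h x))"

text \<open>
  $C^2$ on the closure of an open \<open>D\<close>: continuous on the closure, $C^2$ in \<open>D\<close>, and all partial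
  derivatives of order at most 2 extend continuously to the closure.
\<close>

definition C2_on_closure :: "nat \<Rightarrow> point set \<Rightarrow> (point \<Rightarrow> real) \<Rightarrow> bool" where
  "C2_on_closure d D h \<longleftrightarrow>
     cont_on d (rtop d closure_of D) h \<and> C2_on d D h \<and>
     (\<forall>i<d. extends_cont d D (partial i h)) \<and>
     (\<forall>i<d. \<forall>j<d. extends_cont d D (partial j (partial i h)))"

definition poisson_solution ::
  "nat \<Rightarrow> point set \<Rightarrow> (point \<Rightarrow> real) \<Rightarrow> (point \<Rightarrow> real) \<Rightarrow> (point \<Rightarrow> real) \<Rightarrow> bool" where
  "poisson_solution d D f g u \<longleftrightarrow>
     C2_on d D u \<and> cont_on d (rtop d closure_of D) u \<and>
     (\<forall>x\<in>D. - laplacian d u x = f x) \<and>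
     (\<forall>x\<in>rtop d frontier_of D. u x = g x)"

section \<open>Norms\<close>

definition Linf_norm :: "nat \<Rightarrow> point set \<Rightarrow> (point \<Rightarrow> real) \<Rightarrow> ereal" where
  "Linf_norm d D h = esssup (restrict_space (rleb d) D) (\<lambda>x. ereal \<bar>h x\<bar>)"

definition in_L2 :: "nat \<Rightarrow> point set \<Rightarrow> (point \<Rightarrow> real) \<Rightarrow> bool" where
  "in_L2 d D h \<longleftrightarrow>
     set_borel_measurable (rleb d) D h \<and> set_integrable (rleb d) D (\<lambda>x. (h x)\<^sup>2)"

definition L2_norm :: "nat \<Rightarrow> point set \<Rightarrow> (point \<Rightarrow> real) \<Rightarrow> real" where
  "L2_norm d D h = sqrt (LINT x:D|rleb d. (h x)\<^sup>2)"

section \<open>ReLU networks\<close>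

text \<open>
  Only the entries \<open>wmat \<Phi> l i j\<close> and \<open>bias \<Phi> l i\<close> with \<open>1 \<le> l \<le> depth \<Phi>\<close>,
  \<open>i < width \<Phi> l\<close>, \<open>j < width \<Phi> (l - 1)\<close> are weights of the network (matrix indices start at 0,
  layer numbers at 1).
\<close>

record relu_dnn =
  depth :: nat
  width :: "nat \<Rightarrow> nat"
  wmat :: "nat \<Rightarrow> nat \<Rightarrow> nat \<Rightarrow> real"
  bias :: "nat \<Rightarrow> nat \<Rightarrow> real"

definition is_dnn :: "nat \<Rightarrow> nat \<Rightarrow> relu_dnn \<Rightarrow> bool" where
  "is_dnn m n \<Phi> \<longleftrightarrow>
     1 \<le> depth \<Phi> \<and> (\<forall>l\<le>depth \<Phi>. 0 < width \<Phi> l) \<and> width \<Phi> 0 = m \<and> width \<Phi> (depth \<Phi>) = n"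

definition affine_layer :: "relu_dnn \<Rightarrow> nat \<Rightarrow> point \<Rightarrow> point" where
  "affine_layer \<Phi> l x =
     (\<lambda>i\<in>{..<width \<Phi> l}. (\<Sum>j<width \<Phi> (l - 1). wmat \<Phi> l i j * x j) + bias \<Phi> l i)"

text \<open>\<open>dnn_layer \<Phi> k\<close> is the function computed by the first \<open>k + 1\<close> layers.\<close>

primrec dnn_layer :: "relu_dnn \<Rightarrow> nat \<Rightarrow> point \<Rightarrow> point" where
  "dnn_layer \<Phi> 0 x = affine_layer \<Phi> 1 x"
| "dnn_layer \<Phi> (Suc k) x = affine_layer \<Phi> (Suc (Suc k)) (\<lambda>i. max 0 (dnn_layer \<Phi> k x i))"

text \<open>The realization of a network with output dimension 1, as a scalar function.\<close>

definition dnn_fun :: "relu_dnn \<Rightarrow> point \<Rightarrow> real" where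
  "dnn_fun \<Phi> x = dnn_layer \<Phi> (depth \<Phi> - 1) x 0"

definition dnn_size :: "relu_dnn \<Rightarrow> nat" where
  "dnn_size \<Phi> =
     (\<Sum>l=1..depth \<Phi>.
        card {(i, j). i < width \<Phi> l \<and> j < width \<Phi> (l - 1) \<and> wmat \<Phi> l i j \<noteq> 0} +
        card {i. i < width \<Phi> l \<and> bias \<Phi> l i \<noteq> 0})"

end

theory Submission
  imports Defs "HOL-Probability.Distributions"
begin

text \<open>
  The solution is approximated by an average of finitely many trajectories of a random walk in \<open>D\<close>.
  One step of the walk moves a point along a coordinate axis by a multiple of a ReLU function of the
  point, so the payoff at the end of a trajectory is a ReLU function of the starting point.

  \<^bold>\<open>The walk.\<close> Let \<open>rad\<close> be the positive part of \<open>\<phi> - 3 * \<epsilon>\<close>, where the network \<open>\<phi>\<close> approximates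
  the distance to the boundary up to \<open>\<epsilon>\<close>. From \<open>y\<close> the walk goes to one of the \<open>2 * d\<close> points
  \<open>y \<plusminus> \<gamma> * rad y * e\<^sub>i\<close>, each with the same probability; \<open>T h y\<close> is the mean of \<open>h\<close> over these points.
  For \<open>q z = \<bar>z - x\<bar>\<^sup>2\<close> one has \<open>T q - q = (\<gamma> * rad)\<^sup>2\<close>, hence \<open>(\<Sum>k<n. (T ^^ k) (\<gamma> * rad)\<^sup>2 x) \<le> R\<^sup>2\<close> for the
  diameter \<open>R\<close> and every \<open>n\<close> (\<open>sum_radii\<close>). This estimate, which does not involve the dimension, does
  two things. It bounds every error that is committed in proportion to \<open>(\<gamma> * rad)\<^sup>2\<close> per step, and it
  shows that the walk is close to the boundary at a time drawn uniformly from the first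
  \<open>M = R\<^sup>2 / (\<epsilon> * \<gamma>)\<^sup>2\<close> steps (\<open>mean_distance\<close>). There \<open>u\<close> may be replaced by \<open>g\<close>, because
  \<open>\<bar>u - g\<bar>\<close> is at most a constant times the distance to the boundary: this is the maximum principle with a
  quadratic barrier in the slab cut out by a supporting hyperplane (\<open>u_minus_g_le_dist\<close>), and it is
  where convexity enters.

  \<^bold>\<open>Consistency.\<close> The walk represents \<open>u\<close> if \<open>T u - u\<close> is close to \<open>- (\<gamma> * rad)\<^sup>2 * f / (2 * d)\<close>. The
  second derivatives of \<open>u\<close> have no known modulus of continuity, so \<open>u\<close> is first convolved with a
  smooth product kernel at scale \<open>\<epsilon>\<close>. In each coordinate two integrations by parts move the difference
  between the second difference quotient and the second derivative onto the kernel, and then only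
  \<open>sup \<bar>u\<bar>\<close> is needed (\<open>second_difference_kernel_bound\<close>, \<open>mollify_stencil\<close>). The convolution changes \<open>u\<close> by at
  most \<open>\<Lambda> * \<epsilon>\<close>, because \<open>u\<close> is Lipschitz; that is the maximum principle again, applied to the
  difference of \<open>u\<close> and a translate of \<open>u\<close> (\<open>u_lipschitz\<close>).

  \<^bold>\<open>Sampling.\<close> The resulting approximation of \<open>u\<close> is a mean over all trajectories. A greedy choice in
  the Hilbert space \<open>L\<^sup>2(D)\<close> finds \<open>N\<close> trajectories whose mean differs from it by at most
  \<open>2 * B * sqrt (\<bar>D\<bar> / N)\<close> in norm, where \<open>B\<close> bounds all payoffs (\<open>sparse_average\<close>).

  \<^bold>\<open>Networks.\<close> A network works on a fixed number of registers, each stored as its positive and its negative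
  part, so that a ReLU layer can copy it. Instructions compose by concatenation of layers and their sizes
  add up (\<open>realizes\<close>). The product of \<open>rad\<^sup>2\<close> and \<open>f\<close> reduces to squares, and these are computed
  with an error that decays exponentially in the size by the tent map identity (\<open>sqr_error\<close>).

  \<^bold>\<open>The dimension.\<close> Carrying a point of dimension \<open>d\<close> through all layers costs a factor \<open>d\<close> on top of \<open>d powr a\<close>,
  and the choice of \<open>\<gamma>\<close> costs \<open>d ^ 6\<close> more. These powers are harmless: comparison with a Gaussian gives
  \<open>\<bar>D\<bar> \<le> exp (4 * pi * R\<^sup>2) / 2 ^ d\<close> (\<open>emeasure_le_gaussian\<close>). So either the zero network is already good
  enough in \<open>L\<^sup>2(D)\<close>, or \<open>2 powr (d / 2)\<close> is at most a constant times \<open>1 / \<delta>\<close>, and then so is \<open>d ^ 7\<close>.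

  \<^bold>\<open>The exponent.\<close> With \<open>\<epsilon>\<close> proportional to \<open>\<delta>\<close> and \<open>\<gamma>\<close> to \<open>\<epsilon> ^ 4 / d ^ 3\<close>, the number of steps is of order
  \<open>d ^ 6 * \<delta> powr -10\<close> and the number of trajectories of order \<open>\<delta> powr -6\<close>. The logarithmic size of the distance
  network and the power of \<open>d\<close> contribute a factor \<open>1 / \<delta>\<close> each, the networks for \<open>f\<close> and \<open>g\<close> at most
  \<open>\<delta> powr -b\<close>. Altogether the size is at most of order \<open>d powr a * \<delta> powr (-18 - b)\<close>, and \<open>18 + b \<le> 14 + 6 * b\<close> because \<open>b > 1\<close>.
\<close>


section \<open>The Euclidean metric on tuples\<close>

declare topspace_product_topology [simp del]

lemma topspace_rtop: "topspace (rtop d) = PiE {..<d} (\<lambda>_. UNIV)"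
  by (simp add: topspace_product_topology)

lemma edist_nonneg [simp]: "0 \<le> edist d x y"
  by (simp add: edist_def)

lemma edist_refl [simp]: "edist d x x = 0"
  by (simp add: edist_def L2_set_def)

lemma edist_commute: "edist d x y = edist d y x"
  unfolding edist_def L2_set_def by (simp add: power2_commute)

lemma edist_triangle: "edist d x z \<le> edist d x y + edist d y z"
  using L2_set_triangle_ineq[of "\<lambda>i. x i - y i" "\<lambda>i. y i - z i" "{..<d}"]
  by (simp add: edist_def)

lemma edist_sq: "(edist d x y)\<^sup>2 = (\<Sum>i<d. (x i - y i)\<^sup>2)"
  by (simp add: edist_def L2_set_def sum_nonneg)

lemma abs_coord_le_edist: "i < d \<Longrightarrow> \<bar>x i - y i\<bar> \<le> edist d x y"
proof -
  assume i: "i < d"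
  have "(x i - y i)\<^sup>2 \<le> (\<Sum>i<d. (x i - y i)\<^sup>2)" using i by (intro member_le_sum) auto
  then show ?thesis unfolding edist_def L2_set_def using real_sqrt_le_mono by fastforce
qed

lemma edist_le_sum: "edist d x y \<le> (\<Sum>i<d. \<bar>x i - y i\<bar>)"
  unfolding edist_def by (rule L2_set_le_sum_abs)

lemma edist_fun_upd: "i < d \<Longrightarrow> edist d x (x(i := t)) = \<bar>x i - t\<bar>"
proof -
  assume i: "i < d"
  have "(\<Sum>j<d. (x j - (x(i := t)) j)\<^sup>2) = (\<Sum>j<d. if j = i then (x i - t)\<^sup>2 else 0)"
    by (rule sum.cong) auto
  also have "\<dots> = (x i - t)\<^sup>2" using i by simp
  finally show ?thesis by (simp add: edist_def L2_set_def)
qed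

lemma fun_upd_in_space: "i < d \<Longrightarrow> x \<in> topspace (rtop d) \<Longrightarrow> x(i := t) \<in> topspace (rtop d)"
  by (auto simp: topspace_rtop PiE_iff extensional_def)

lemma edist_eq_0_imp_eq:
  assumes "x \<in> topspace (rtop d)" "y \<in> topspace (rtop d)" "edist d x y = 0" shows "x = y"
proof
  fix i show "x i = y i"
  proof (cases "i < d")
    case True then show ?thesis using abs_coord_le_edist[OF True, of x y] assms(3) by simp
  next
    case False then show ?thesis using assms(1,2) by (auto simp: topspace_rtop PiE_iff extensional_def)
  qed
qed

text \<open>
  The index set is finite, so a basic open box around a point contains a Euclidean ball and conversely;
  all topological notions of the statement thereby become metric ones.
\<close>

lemma openin_rtop_iff:
  "openin (rtop d) U \<longleftrightarrow>
     U \<subseteq> topspace (rtop d) \<and> (\<forall>x\<in>U. \<exists>e>0. \<forall>y\<in>topspace (rtop d). edist d x y < e \<longrightarrow> y \<in> U)"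
    (is "?L \<longleftrightarrow> ?S \<and> ?R")
proof
  assume L: ?L
  have "\<exists>e>0. \<forall>y\<in>topspace (rtop d). edist d x y < e \<longrightarrow> y \<in> U" if x: "x \<in> U" for x
  proof -
    obtain V where V: "\<forall>i\<in>{..<d}. open (V i)" "x \<in> PiE {..<d} V" "PiE {..<d} V \<subseteq> U"
      using L x unfolding openin_product_topology_alt by (auto simp: openin_subtopology)
    have "\<exists>e>0. \<forall>t. \<bar>x i - t\<bar> < e \<longrightarrow> t \<in> V i" if "i < d" for i
    proof -
      have "open (V i)" "x i \<in> V i" using V that by (auto simp: topspace_rtop PiE_iff)
      then obtain e where "e > 0" "\<forall>t. dist t (x i) < e \<longrightarrow> t \<in> V i"
        unfolding open_dist by blast
      then show ?thesis by (intro exI[of _ e]) (auto simp: dist_real_def abs_minus_commute)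
    qed
    then obtain e where e: "\<And>i. i < d \<Longrightarrow> e i > 0 \<and> (\<forall>t. \<bar>x i - t\<bar> < e i \<longrightarrow> t \<in> V i)"
      by metis
    define e0 where "e0 = Min (insert 1 (e ` {..<d}))"
    have e0: "e0 > 0" unfolding e0_def using e by (subst Min_gr_iff) auto
    have e0le: "e0 \<le> e i" if "i < d" for i unfolding e0_def using that by (intro Min_le) auto
    show ?thesis
    proof (intro exI[of _ e0] conjI ballI impI e0)
      fix y assume y: "y \<in> topspace (rtop d)" "edist d x y < e0"
      have "y i \<in> V i" if "i < d" for i
        using e[OF that] abs_coord_le_edist[OF that, of x y] y(2) e0le[OF that] by force
      then have "y \<in> PiE {..<d} V" using y(1) by (auto simp: topspace_rtop PiE_iff)
      then show "y \<in> U" using V by blast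
    qed
  qed
  then show "?S \<and> ?R" using openin_subset[OF L] by blast
next
  assume A: "?S \<and> ?R"
  show ?L unfolding openin_product_topology_alt
  proof
    fix x assume x: "x \<in> U"
    then obtain e where e: "e > 0" "\<And>y. y\<in>topspace (rtop d) \<Longrightarrow> edist d x y < e \<Longrightarrow> y \<in> U"
      using A by blast
    have xs: "x \<in> topspace (rtop d)" using A x by blast
    define V where "V = (\<lambda>i. ball (x i) (e / (real d + 1)))"
    have "PiE {..<d} V \<subseteq> U"
    proof
      fix y assume y: "y \<in> PiE {..<d} V"
      have "edist d x y \<le> (\<Sum>i<d. \<bar>x i - y i\<bar>)" by (rule edist_le_sum)
      also have "\<dots> \<le> (\<Sum>i<d. e / (real d + 1))"
        using y by (intro sum_mono) (auto simp: V_def topspace_rtop PiE_iff dist_real_def less_imp_le)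
      also have "\<dots> = e * (real d / (real d + 1))" by simp
      also have "\<dots> < e * 1" using e by (intro mult_strict_left_mono) auto
      finally show "y \<in> U" using y by (intro e(2)) (auto simp: topspace_rtop PiE_iff)
    qed
    moreover have "x \<in> PiE {..<d} V" using xs e(1) by (auto simp: V_def topspace_rtop PiE_iff)
    ultimately show "\<exists>V. finite {i \<in> {..<d}. V i \<noteq> topspace euclideanreal} \<and>
        (\<forall>i\<in>{..<d}. openin euclideanreal (V i)) \<and> x \<in> PiE {..<d} V \<and> PiE {..<d} V \<subseteq> U"
      by (intro exI[of _ V]) (auto simp: V_def)
  qed
qed

lemma openin_rtop_ball:
  assumes "x \<in> U" "openin (rtop d) U"
  shows "\<exists>e>0. \<forall>y\<in>topspace (rtop d). edist d x y < e \<longrightarrow> y \<in> U"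
  using conjunct2[OF iffD1[OF openin_rtop_iff assms(2)]] assms(1) by (rule bspec)

lemma openin_ball_rtop: 
  "openin (rtop d) {y \<in> topspace (rtop d). edist d x y < e}"
  unfolding openin_rtop_iff
proof (intro conjI ballI)
  fix y assume y: "y \<in> {y \<in> topspace (rtop d). edist d x y < e}"
  show "\<exists>s>0. \<forall>z\<in>topspace (rtop d). edist d y z < s \<longrightarrow> z \<in> {y \<in> topspace (rtop d). edist d x y < e}"
  proof (intro exI[of _ "e - edist d x y"] conjI ballI impI)
    fix z assume z: "z \<in> topspace (rtop d)" "edist d y z < e - edist d x y"
    then show "z \<in> {y \<in> topspace (rtop d). edist d x y < e}"
      using edist_triangle[of d x z y] by simp
  qed (use y in simp)
qed auto

lemma closure_of_rtop_iff:
  "x \<in> rtop d closure_of S \<longleftrightarrow>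
     x \<in> topspace (rtop d) \<and> (\<forall>e>0. \<exists>y\<in>S. y \<in> topspace (rtop d) \<and> edist d x y < e)"
proof
  assume x: "x \<in> rtop d closure_of S"
  show "x \<in> topspace (rtop d) \<and> (\<forall>e>0. \<exists>y\<in>S. y \<in> topspace (rtop d) \<and> edist d x y < e)"
  proof (rule conjI; (intro allI impI)?)
    show xs: "x \<in> topspace (rtop d)" using x closure_of_subset_topspace by (rule subsetD[rotated])
    fix e :: real assume e: "0 < e"
    have "x \<in> {y \<in> topspace (rtop d). edist d x y < e}" using xs e by simp
    then have "\<exists>y. y \<in> S \<and> y \<in> {y \<in> topspace (rtop d). edist d x y < e}"
      using x openin_ball_rtop[of d x e] unfolding in_closure_of by metis
    then show "\<exists>y\<in>S. y \<in> topspace (rtop d) \<and> edist d x y < e" by auto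
  qed
next
  assume x: "x \<in> topspace (rtop d) \<and> (\<forall>e>0. \<exists>y\<in>S. y \<in> topspace (rtop d) \<and> edist d x y < e)"
  show "x \<in> rtop d closure_of S" unfolding in_closure_of
  proof (intro conjI allI impI)
    show "x \<in> topspace (rtop d)" using x by blast
    fix T assume T: "x \<in> T \<and> openin (rtop d) T"
    then obtain e where "e > 0" "\<And>y. y \<in> topspace (rtop d) \<Longrightarrow> edist d x y < e \<Longrightarrow> y \<in> T"
      using openin_rtop_ball[OF conjunct1[OF T] conjunct2[OF T]] by blast
    moreover from this(1) obtain y where "y \<in> S" "y \<in> topspace (rtop d)" "edist d x y < e" using x by blast
    ultimately show "\<exists>y. y \<in> S \<and> y \<in> T" by blast
  qed
qed

lemma cont_on_iff:
  assumes S: "S \<subseteq> topspace (rtop d)"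
  shows "cont_on d S h \<longleftrightarrow> (\<forall>x\<in>S. \<forall>e>0. \<exists>s>0. \<forall>y\<in>S. edist d x y < s \<longrightarrow> \<bar>h y - h x\<bar> < e)"
    (is "_ \<longleftrightarrow> ?R")
proof
  assume c: "cont_on d S h"
  show ?R
  proof (intro ballI allI impI)
    fix x and e :: real assume x: "x \<in> S" and e: "0 < e"
    have "openin (subtopology (rtop d) S) {y \<in> topspace (subtopology (rtop d) S). h y \<in> ball (h x) e}"
      using c unfolding cont_on_def continuous_map_def by auto
    then obtain T where T: "openin (rtop d) T"
      "{y \<in> topspace (subtopology (rtop d) S). h y \<in> ball (h x) e} = T \<inter> S"
      unfolding openin_subtopology by blast
    have TS: "y \<in> T \<Longrightarrow> y \<in> S \<Longrightarrow> \<bar>h y - h x\<bar> < e" for y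
      using T(2) by (auto simp: dist_real_def abs_minus_commute set_eq_iff)
    have "x \<in> T" using T(2) x S e by (auto simp: set_eq_iff)
    then obtain s where "s > 0" "\<And>y. y \<in> topspace (rtop d) \<Longrightarrow> edist d x y < s \<Longrightarrow> y \<in> T"
      using openin_rtop_ball[OF \<open>x \<in> T\<close> T(1)] by blast
    then show "\<exists>s>0. \<forall>y\<in>S. edist d x y < s \<longrightarrow> \<bar>h y - h x\<bar> < e"
      using S TS by (intro exI[of _ s]) blast
  qed
next
  assume R: ?R
  show "cont_on d S h" unfolding cont_on_def continuous_map_def
  proof (intro conjI allI impI)
    fix U assume U: "openin euclideanreal U"
    have "\<exists>s>0. \<forall>y\<in>S. edist d x y < s \<longrightarrow> h y \<in> U" if x: "x \<in> S" "h x \<in> U" for x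
    proof -
      obtain e where "e > 0" "\<forall>t. dist t (h x) < e \<longrightarrow> t \<in> U" using U x(2) by (auto simp: open_dist)
      then show ?thesis using R x(1) by (metis dist_real_def)
    qed
    then obtain s where s: "\<And>x. x \<in> S \<Longrightarrow> h x \<in> U \<Longrightarrow> s x > 0 \<and> (\<forall>y\<in>S. edist d x y < s x \<longrightarrow> h y \<in> U)"
      by metis
    define T where "T = (\<Union>x\<in>{x\<in>S. h x \<in> U}. {y \<in> topspace (rtop d). edist d x y < s x})"
    have "openin (rtop d) T" unfolding T_def using openin_ball_rtop by blast
    moreover have "{x \<in> topspace (subtopology (rtop d) S). h x \<in> U} = T \<inter> S"
      using S s unfolding T_def by auto
    ultimately show "openin (subtopology (rtop d) S) {x \<in> topspace (subtopology (rtop d) S). h x \<in> U}"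
      unfolding openin_subtopology by blast
  qed auto
qed

lemma cont_on_subset: "cont_on d S h \<Longrightarrow> T \<subseteq> S \<Longrightarrow> cont_on d T h"
  unfolding cont_on_def by (rule continuous_map_from_subtopology_mono)

lemma cont_on_cong: "cont_on d S h \<Longrightarrow> (\<And>x. x \<in> S \<Longrightarrow> h x = k x) \<Longrightarrow> cont_on d S k"
  unfolding cont_on_def by (erule continuous_map_eq) auto

lemma cont_on_const: "cont_on d S (\<lambda>_. c)" by (simp add: cont_on_def)
lemma cont_on_add: "cont_on d S h \<Longrightarrow> cont_on d S k \<Longrightarrow> cont_on d S (\<lambda>x. h x + k x)"
  unfolding cont_on_def by (rule continuous_map_add)
lemma cont_on_diff: "cont_on d S h \<Longrightarrow> cont_on d S k \<Longrightarrow> cont_on d S (\<lambda>x. h x - k x)"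
  unfolding cont_on_def by (rule continuous_map_diff)
lemma cont_on_mult: "cont_on d S h \<Longrightarrow> cont_on d S k \<Longrightarrow> cont_on d S (\<lambda>x. h x * k x)"
  unfolding cont_on_def by (rule continuous_map_real_mult)
lemma cont_on_sum: "(\<And>i. i \<in> I \<Longrightarrow> cont_on d S (h i)) \<Longrightarrow> cont_on d S (\<lambda>x. \<Sum>i\<in>I. h i x)"
  by (induction I rule: infinite_finite_induct) (auto intro: cont_on_add cont_on_const)
lemma cont_on_max: "cont_on d S h \<Longrightarrow> cont_on d S k \<Longrightarrow> cont_on d S (\<lambda>x. max (h x) (k x))"
  unfolding cont_on_def by (rule continuous_map_real_max)
lemma cont_on_coord:
  assumes "i < d" shows "cont_on d S (\<lambda>x. x i)"
  unfolding cont_on_def using assms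
  by (intro continuous_map_from_subtopology continuous_map_product_projection) auto

lemma lipschitz_imp_cont_on:
  assumes "S \<subseteq> topspace (rtop d)" "\<And>x y. x \<in> S \<Longrightarrow> y \<in> S \<Longrightarrow> \<bar>h x - h y\<bar> \<le> K * edist d x y"
  shows "cont_on d S h"
  unfolding cont_on_iff[OF assms(1)]
proof (intro ballI allI impI)
  fix x and e :: real assume x: "x \<in> S" and e: "0 < e"
  have "\<bar>h y - h x\<bar> < e" if y: "y \<in> S" "edist d x y < e / (\<bar>K\<bar> + 1)" for y
  proof -
    have "\<bar>h y - h x\<bar> \<le> K * edist d x y" using assms(2)[OF y(1) x] by (simp add: edist_commute)
    also have "\<dots> \<le> (\<bar>K\<bar> + 1) * edist d x y" by (intro mult_right_mono) auto
    also have "\<dots> < e" using y(2) by (simp add: field_simps)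
    finally show ?thesis .
  qed
  then show "\<exists>s>0. \<forall>y\<in>S. edist d x y < s \<longrightarrow> \<bar>h y - h x\<bar> < e"
    using e by (intro exI[of _ "e / (\<bar>K\<bar> + 1)"]) auto
qed

lemma cont_on_edist: "S \<subseteq> topspace (rtop d) \<Longrightarrow> cont_on d S (edist d x)"
proof (rule lipschitz_imp_cont_on[where K=1])
  fix y z show "\<bar>edist d x y - edist d x z\<bar> \<le> 1 * edist d y z"
    using edist_triangle[of d x y z] edist_triangle[of d x z y] edist_commute[of d y z] by auto
qed

section \<open>Bounded sets\<close>

definition ebounded :: "nat \<Rightarrow> point set \<Rightarrow> bool" where
  "ebounded d S \<longleftrightarrow> (\<exists>R. \<forall>x\<in>S. \<forall>y\<in>S. edist d x y \<le> R)"

lemma closure_edist_le: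
  assumes x: "x \<in> rtop d closure_of S" and y: "y \<in> rtop d closure_of S"
    and R: "\<And>x y. x \<in> S \<Longrightarrow> y \<in> S \<Longrightarrow> edist d x y \<le> R"
  shows "edist d x y \<le> R"
proof (rule field_le_epsilon)
  fix e :: real assume e: "0 < e"
  obtain x' where x': "x' \<in> S" "edist d x x' < e / 2"
    using x e unfolding closure_of_rtop_iff by (meson half_gt_zero)
  obtain y' where y': "y' \<in> S" "edist d y y' < e / 2"
    using y e unfolding closure_of_rtop_iff by (meson half_gt_zero)
  show "edist d x y \<le> R + e"
    using R[OF x'(1) y'(1)] x' y' edist_triangle[of d x y x'] edist_triangle[of d x' y y']
      edist_commute[of d y y'] by auto
qed

text \<open>
  The closure lies in a product of compact intervals, so Tychonoff's theorem yields Heine-Borel.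
\<close>

lemma compactin_closure:
  assumes b: "ebounded d S" shows "compactin (rtop d) (rtop d closure_of S)"
proof (cases "S \<inter> topspace (rtop d) = {}")
  case True
  then have "rtop d closure_of S = {}"
    by (metis Int_commute closure_of_empty closure_of_restrict)
  then show ?thesis by simp
next
  case False
  then obtain x0 where x0: "x0 \<in> S" "x0 \<in> topspace (rtop d)" by blast
  obtain R where R: "\<And>x y. x \<in> S \<Longrightarrow> y \<in> S \<Longrightarrow> edist d x y \<le> R" using b unfolding ebounded_def by blast
  have x0c: "x0 \<in> rtop d closure_of S" using x0 unfolding closure_of_rtop_iff by force
  have "rtop d closure_of S \<subseteq> PiE {..<d} (\<lambda>i. {x0 i - R..x0 i + R})"
  proof
    fix x assume x: "x \<in> rtop d closure_of S"
    have "\<bar>x i - x0 i\<bar> \<le> R" if "i < d" for i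
      using abs_coord_le_edist[OF that, of x x0] closure_edist_le[OF x x0c R] by linarith
    moreover have "x \<in> topspace (rtop d)" using closure_of_subset_topspace x by (rule subsetD)
    ultimately show "x \<in> PiE {..<d} (\<lambda>i. {x0 i - R..x0 i + R})"
      by (simp add: topspace_rtop PiE_iff abs_le_iff algebra_simps)
  qed
  moreover have "compactin (rtop d) (PiE {..<d} (\<lambda>i. {x0 i - R..x0 i + R}))"
    by (subst compactin_PiE) auto
  ultimately show ?thesis by (meson closed_compactin closedin_closure_of)
qed

lemma compact_attains_max:
  assumes K: "compactin (rtop d) K" "K \<noteq> {}" and h: "cont_on d K h"
  shows "\<exists>x\<in>K. \<forall>y\<in>K. h y \<le> h x"
proof -
  have "compactin euclideanreal (h ` K)"
    using K h unfolding cont_on_def by (metis compactin_subtopology image_compactin subset_refl)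
  then show ?thesis using compact_attains_sup[of "h ` K"] K by auto
qed

lemma compact_bounded_fun:
  assumes K: "compactin (rtop d) K" and h: "cont_on d K h"
  shows "\<exists>B\<ge>0. \<forall>x\<in>K. \<bar>h x\<bar> \<le> B"
proof -
  have "compactin euclideanreal (h ` K)"
    using K h unfolding cont_on_def by (metis compactin_subtopology image_compactin subset_refl)
  then have "bounded (h ` K)" by (simp add: compact_imp_bounded)
  then obtain B where "\<forall>x\<in>K. \<bar>h x\<bar> \<le> B" unfolding bounded_iff by auto
  then show ?thesis by (intro exI[of _ "max 0 B"]) force
qed

lemma frontier_of_open: "openin (rtop d) D \<Longrightarrow> rtop d frontier_of D = rtop d closure_of D - D"
  by (simp add: frontier_of_def interior_of_openin)

lemma open_subset_closure: "openin (rtop d) D \<Longrightarrow> D \<subseteq> rtop d closure_of D"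
  by (simp add: closure_of_subset openin_subset)

section \<open>Segments and the distance to the boundary\<close>

definition seg :: "nat \<Rightarrow> point \<Rightarrow> point \<Rightarrow> real \<Rightarrow> point" where
  "seg d x y t = (\<lambda>i\<in>{..<d}. (1 - t) * x i + t * y i)"

lemma seg_in_space: "seg d x y t \<in> topspace (rtop d)"
  by (simp add: seg_def topspace_rtop)

lemma edist_seg: "edist d (seg d x y s) (seg d x y t) = \<bar>s - t\<bar> * edist d x y"
proof -
  have "(\<Sum>i<d. (seg d x y s i - seg d x y t i)\<^sup>2) = (\<Sum>i<d. (s - t)\<^sup>2 * (x i - y i)\<^sup>2)"
    by (rule sum.cong) (auto simp: seg_def power2_eq_square algebra_simps)
  then show ?thesis
    by (simp add: edist_def L2_set_def sum_distrib_left[symmetric] real_sqrt_mult)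
qed

lemma seg_0: "x \<in> topspace (rtop d) \<Longrightarrow> seg d x y 0 = x"
  and seg_1: "y \<in> topspace (rtop d) \<Longrightarrow> seg d x y 1 = y"
  by (auto simp: topspace_rtop seg_def PiE_iff extensional_def fun_eq_iff)

text \<open>
  The first parameter at which the segment leaves the open set gives a frontier point.
\<close>

lemma segment_meets_frontier:
  assumes D: "openin (rtop d) D" and x: "x \<in> D" and y: "y \<in> topspace (rtop d)" "y \<notin> D"
  shows "\<exists>z \<in> rtop d frontier_of D. edist d x z \<le> edist d x y"
proof -
  have xs: "x \<in> topspace (rtop d)" using D x openin_subset by blast
  define T where "T = {t\<in>{0..1}. seg d x y t \<notin> D}"
  have T1: "1 \<in> T" using y by (simp add: T_def seg_1)
  define s where "s = Inf T"
  have bdd: "bdd_below T" by (rule bdd_belowI[of _ 0]) (auto simp: T_def)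
  have s01: "0 \<le> s" "s \<le> 1" unfolding s_def using T1 bdd
    by (auto intro!: cInf_greatest cInf_lower simp: T_def)
  have near: "\<exists>e>0. \<forall>t. \<bar>t - s\<bar> < e \<longrightarrow> seg d x y t \<in> D" if inD: "seg d x y s \<in> D"
  proof -
    obtain e where e: "e > 0" "\<And>z. z\<in>topspace (rtop d) \<Longrightarrow> edist d (seg d x y s) z < e \<Longrightarrow> z \<in> D"
      using openin_rtop_ball[OF inD D] by blast
    show ?thesis
    proof (intro exI[of _ "e / (edist d x y + 1)"] conjI allI impI)
      show "0 < e / (edist d x y + 1)" using e(1) by (simp add: add_nonneg_pos)
      fix t assume t: "\<bar>t - s\<bar> < e / (edist d x y + 1)"
      have "edist d (seg d x y s) (seg d x y t) \<le> \<bar>t - s\<bar> * (edist d x y + 1)"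
        unfolding edist_seg by (simp add: abs_minus_commute mult_left_mono)
      also have "\<dots> < e" using t by (simp add: pos_less_divide_eq add_nonneg_pos)
      finally show "seg d x y t \<in> D" using e(2) seg_in_space by blast
    qed
  qed
  have notD: "seg d x y s \<notin> D"
  proof
    assume "seg d x y s \<in> D"
    then obtain e where e: "e > 0" "\<And>t. \<bar>t - s\<bar> < e \<Longrightarrow> seg d x y t \<in> D" using near by blast
    have "s + e \<le> Inf T"
    proof (rule cInf_greatest)
      fix t assume t: "t \<in> T"
      then have "s \<le> t" unfolding s_def using bdd by (simp add: cInf_lower)
      moreover have "\<not> \<bar>t - s\<bar> < e" using e(2)[of t] t by (auto simp: T_def)
      ultimately show "s + e \<le> t" by auto
    qed (use T1 in auto)
    then show False using e(1) s_def by simp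
  qed
  have "s \<noteq> 0" using notD x xs by (metis seg_0)
  then have s: "s > 0" using s01 by simp
  have "seg d x y s \<in> rtop d closure_of D"
    unfolding closure_of_rtop_iff
  proof (intro conjI allI impI seg_in_space)
    fix e :: real assume e: "0 < e"
    define c where "c = edist d x y + 1"
    have c: "c > 0" by (simp add: c_def add_nonneg_pos)
    define t where "t = max 0 (s - e / (2 * c))"
    have t: "0 \<le> t" "t < s" "s - t \<le> e / (2 * c)" using s e c by (auto simp: t_def)
    have "t \<notin> T" using t(2) cInf_lower[OF _ bdd, of t] by (auto simp: s_def)
    then have "seg d x y t \<in> D" using t s01 by (auto simp: T_def)
    moreover have "edist d (seg d x y s) (seg d x y t) < e"
    proof -
      have "\<bar>s - t\<bar> * edist d x y \<le> (e / (2 * c)) * c"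
        using t by (intro mult_mono) (auto simp: c_def)
      also have "\<dots> < e" using c e by simp
      finally show ?thesis by (simp add: edist_seg)
    qed
    ultimately show "\<exists>z\<in>D. z \<in> topspace (rtop d) \<and> edist d (seg d x y s) z < e"
      using seg_in_space by blast
  qed
  then have "seg d x y s \<in> rtop d frontier_of D" using notD frontier_of_open[OF D] by simp
  moreover have "edist d x (seg d x y s) \<le> edist d x y"
    using edist_seg[of d x y 0 s] s01 seg_0[OF xs]
    by (simp add: mult_left_le_one_le)
  ultimately show ?thesis by blast
qed

lemma bounded_frontier_nonempty:
  assumes "openin (rtop d) D" "x \<in> D" "ebounded d D" "1 \<le> d"
  shows "rtop d frontier_of D \<noteq> {}"
proof -
  obtain R where R: "\<And>x y. x \<in> D \<Longrightarrow> y \<in> D \<Longrightarrow> edist d x y \<le> R" using assms unfolding ebounded_def by blast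
  define y where "y = x(0 := x 0 + R + 1)"
  have xs: "x \<in> topspace (rtop d)" using assms openin_subset by blast
  have "R \<ge> 0" using R[OF assms(2,2)] by simp
  then have "edist d x y = R + 1" using edist_fun_upd[of 0 d x] assms(4) by (simp add: y_def)
  then have "y \<notin> D" using R[OF assms(2), of y] by auto
  moreover have "y \<in> topspace (rtop d)" unfolding y_def using xs assms(4) by (intro fun_upd_in_space) auto
  ultimately show ?thesis using segment_meets_frontier[OF assms(1,2)] by blast
qed

lemma dist_bdry_le: "y \<in> rtop d frontier_of D \<Longrightarrow> dist_bdry d D x \<le> edist d x y"
  unfolding dist_bdry_def by (rule cINF_lower) (auto intro!: bdd_belowI[of _ 0])

text \<open>
  A point outside would give a frontier point that is at least as near.
\<close>

lemma ball_subset_domain: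
  assumes D: "openin (rtop d) D" and x: "x \<in> D" and y: "y \<in> topspace (rtop d)"
    and "edist d x y < dist_bdry d D x"
  shows "y \<in> D"
  using segment_meets_frontier[OF D x y] dist_bdry_le[of _ d D x] assms(4) by force

lemma nearest_boundary_point:
  assumes D: "openin (rtop d) D" "ebounded d D" "1 \<le> d" and x: "x \<in> D"
  shows "\<exists>y \<in> rtop d frontier_of D. dist_bdry d D x = edist d x y"
proof -
  define K where "K = rtop d frontier_of D"
  have ne: "K \<noteq> {}" unfolding K_def using bounded_frontier_nonempty[OF D(1) x D(2,3)] .
  have "closedin (rtop d) K" unfolding K_def by (rule closedin_frontier_of)
  moreover have "K \<subseteq> rtop d closure_of D" unfolding K_def by (simp add: frontier_of_def)
  ultimately have K: "compactin (rtop d) K" using compactin_closure[OF D(2)] by (meson closed_compactin)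
  have "K \<subseteq> topspace (rtop d)" using K compactin_subset_topspace by blast
  then have "cont_on d K (\<lambda>y. 0 - edist d x y)" by (intro cont_on_diff cont_on_const cont_on_edist)
  then obtain y where y: "y \<in> K" "\<forall>z\<in>K. edist d x y \<le> edist d x z"
    using compact_attains_max[OF K ne] by force
  have "edist d x y \<le> dist_bdry d D x"
    unfolding dist_bdry_def using y ne by (intro cINF_greatest) (auto simp: K_def)
  then show ?thesis using y dist_bdry_le[of y d D x] by (force simp: K_def)
qed

lemma dist_bdry_lipschitz:
  assumes D: "openin (rtop d) D" "ebounded d D" "1 \<le> d" and x: "x \<in> D" and y: "y \<in> D"
  shows "dist_bdry d D x \<le> dist_bdry d D y + edist d x y"
proof -
  obtain z where z: "z \<in> rtop d frontier_of D" "dist_bdry d D y = edist d y z"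
    using nearest_boundary_point[OF D y] by blast
  show ?thesis using dist_bdry_le[OF z(1), of x] edist_triangle[of d x z y] z by simp
qed

lemma dist_bdry_pos:
  assumes D: "openin (rtop d) D" "ebounded d D" "1 \<le> d" and x: "x \<in> D"
  shows "0 < dist_bdry d D x"
proof -
  obtain y where y: "y \<in> rtop d frontier_of D" "dist_bdry d D x = edist d x y"
    using nearest_boundary_point[OF D x] by blast
  have "y \<in> topspace (rtop d)" "y \<notin> D"
    using y frontier_of_open[OF D(1)] by (auto simp: closure_of_rtop_iff)
  then have "edist d x y \<noteq> 0" using edist_eq_0_imp_eq[of x d y] x openin_subset[OF D(1)] by blast
  then show ?thesis using y edist_nonneg[of d x y] by linarith
qed


section \<open>Second derivatives along the coordinates and the maximum principle\<close>

text \<open>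
  A relational version of the second partial derivative: unlike the functions \<open>partial i (partial i v)\<close>, it passes
  to sums, multiples and translates without any side condition on the domain.
\<close>

definition second_deriv_at :: "nat \<Rightarrow> (point \<Rightarrow> real) \<Rightarrow> point \<Rightarrow> real \<Rightarrow> bool" where
  "second_deriv_at i v x s \<longleftrightarrow> (\<exists>\<phi>'.
     (\<forall>\<^sub>F t in nhds (x i). ((\<lambda>t. v (x(i := t))) has_real_derivative \<phi>' t) (at t)) \<and>
     (\<phi>' has_real_derivative s) (at (x i)))"

lemma second_deriv_at_add:
  assumes "second_deriv_at i v x s" "second_deriv_at i w x r"
  shows "second_deriv_at i (\<lambda>z. v z + w z) x (s + r)"
proof -
  obtain p where p: "\<forall>\<^sub>F t in nhds (x i). ((\<lambda>t. v (x(i := t))) has_real_derivative p t) (at t)"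
      "(p has_real_derivative s) (at (x i))"
    using assms(1) unfolding second_deriv_at_def by blast
  obtain q where q: "\<forall>\<^sub>F t in nhds (x i). ((\<lambda>t. w (x(i := t))) has_real_derivative q t) (at t)"
      "(q has_real_derivative r) (at (x i))"
    using assms(2) unfolding second_deriv_at_def by blast
  show ?thesis unfolding second_deriv_at_def
  proof (intro exI[of _ "\<lambda>t. p t + q t"] conjI)
    show "\<forall>\<^sub>F t in nhds (x i). ((\<lambda>t. v (x(i := t)) + w (x(i := t))) has_real_derivative p t + q t) (at t)"
      using p(1) q(1) by eventually_elim (rule DERIV_add)
    show "((\<lambda>t. p t + q t) has_real_derivative s + r) (at (x i))" using p(2) q(2) by (rule DERIV_add)
  qed
qed

lemma second_deriv_at_cmult:
  assumes "second_deriv_at i v x s"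
  shows "second_deriv_at i (\<lambda>z. c * v z) x (c * s)"
proof -
  obtain p where p: "\<forall>\<^sub>F t in nhds (x i). ((\<lambda>t. v (x(i := t))) has_real_derivative p t) (at t)"
      "(p has_real_derivative s) (at (x i))"
    using assms(1) unfolding second_deriv_at_def by blast
  show ?thesis unfolding second_deriv_at_def
  proof (intro exI[of _ "\<lambda>t. c * p t"] conjI)
    show "\<forall>\<^sub>F t in nhds (x i). ((\<lambda>t. c * v (x(i := t))) has_real_derivative c * p t) (at t)"
      using p(1) by eventually_elim (rule DERIV_cmult)
    show "((\<lambda>t. c * p t) has_real_derivative c * s) (at (x i))" using p(2) by (rule DERIV_cmult)
  qed
qed

lemma second_deriv_at_diff:
  assumes "second_deriv_at i v x s" "second_deriv_at i w x r"
  shows "second_deriv_at i (\<lambda>z. v z - w z) x (s - r)"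
  using second_deriv_at_add[OF assms(1) second_deriv_at_cmult[OF assms(2), of "-1"]] by simp

lemma second_deriv_at_quadratic:
  assumes "\<And>t. v (x(i := t)) = \<alpha> * t\<^sup>2 + \<beta> * t + \<gamma>"
  shows "second_deriv_at i v x (2 * \<alpha>)"
  unfolding second_deriv_at_def
proof (intro exI[of _ "\<lambda>t. 2 * \<alpha> * t + \<beta>"] conjI)
  show "\<forall>\<^sub>F t in nhds (x i). ((\<lambda>t. v (x(i := t))) has_real_derivative 2 * \<alpha> * t + \<beta>) (at t)"
    unfolding assms by (auto intro!: always_eventually derivative_eq_intros)
  show "((\<lambda>t. 2 * \<alpha> * t + \<beta>) has_real_derivative 2 * \<alpha>) (at (x i))"
    by (auto intro!: derivative_eq_intros)
qed

definition shift :: "nat \<Rightarrow> point \<Rightarrow> point \<Rightarrow> point" where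
  "shift d h z = (\<lambda>k\<in>{..<d}. z k + h k)"

lemma shift_in_space: "shift d h z \<in> topspace (rtop d)"
  by (simp add: shift_def topspace_rtop)

lemma edist_shift: "edist d (shift d h x) (shift d h y) = edist d x y"
proof -
  have "(\<Sum>i<d. (shift d h x i - shift d h y i)\<^sup>2) = (\<Sum>i<d. (x i - y i)\<^sup>2)"
    by (rule sum.cong) (auto simp: shift_def)
  then show ?thesis by (simp add: edist_def L2_set_def)
qed

lemma second_deriv_at_shift:
  assumes i: "i < d" and s: "second_deriv_at i v (shift d h x) s"
  shows "second_deriv_at i (\<lambda>z. v (shift d h z)) x s"
proof -
  have e: "shift d h (x(i := t)) = (shift d h x)(i := t + h i)" for t
    using i by (auto simp: shift_def fun_eq_iff)
  have xi: "shift d h x i = x i + h i" using i by (simp add: shift_def)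
  obtain p where p: "\<forall>\<^sub>F t in nhds (x i + h i). ((\<lambda>t. v ((shift d h x)(i := t))) has_real_derivative p t) (at t)"
      "(p has_real_derivative s) (at (x i + h i))"
    using s unfolding second_deriv_at_def xi by blast
  show ?thesis unfolding second_deriv_at_def e
  proof (intro exI[of _ "\<lambda>t. p (t + h i)"] conjI)
    have "filterlim (\<lambda>t. t + h i) (nhds (x i + h i)) (nhds (x i))"
      by (intro tendsto_intros filterlim_ident)
    from eventually_compose_filterlim[OF p(1) this]
    show "\<forall>\<^sub>F t in nhds (x i). ((\<lambda>t. v ((shift d h x)(i := t + h i))) has_real_derivative p (t + h i)) (at t)"
      by eventually_elim (simp add: DERIV_shift)
    show "((\<lambda>t. p (t + h i)) has_real_derivative s) (at (x i))"
      using p(2) by (simp add: DERIV_shift)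
  qed
qed

text \<open>
  If the second derivative were positive, then the first one, which vanishes at the maximum, would be positive
  to the right of it, and the function would increase there.
\<close>

lemma second_deriv_at_local_max:
  assumes s: "second_deriv_at i v x s" and e: "0 < e"
    and max: "\<And>t. \<bar>t - x i\<bar> < e \<Longrightarrow> v (x(i := t)) \<le> v x"
  shows "s \<le> 0"
proof (rule ccontr)
  assume "\<not> s \<le> 0" then have sp: "s > 0" by simp
  obtain p where p: "\<forall>\<^sub>F t in nhds (x i). ((\<lambda>t. v (x(i := t))) has_real_derivative p t) (at t)"
      "(p has_real_derivative s) (at (x i))"
    using s unfolding second_deriv_at_def by blast
  have "((\<lambda>t. v (x(i := t))) has_real_derivative p (x i)) (at (x i))"
    using p(1) by (rule eventually_nhds_x_imp_x)
  then have p0: "p (x i) = 0"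
    by (rule DERIV_local_max[OF _ e]) (use max in \<open>simp add: abs_minus_commute\<close>)
  obtain r where r: "r > 0" "\<And>t. \<bar>t - x i\<bar> < r \<Longrightarrow> ((\<lambda>t. v (x(i := t))) has_real_derivative p t) (at t)"
    using p(1) unfolding eventually_nhds_metric dist_real_def by blast
  obtain q where q: "q > 0" "\<And>h. 0 < h \<Longrightarrow> h < q \<Longrightarrow> 0 < p (x i + h)"
    using DERIV_pos_inc_right[OF p(2) sp] p0 by auto
  define h where "h = min e (min r q) / 2"
  have h: "0 < h" "h < e" "h < r" "h < q" using e r q by (auto simp: h_def)
  have "\<exists>z>x i. z < x i + h \<and> v (x(i := x i + h)) - v (x(i := x i)) = (x i + h - x i) * p z"
  proof (rule MVT2)
    fix t assume "x i \<le> t" "t \<le> x i + h"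
    then show "((\<lambda>t. v (x(i := t))) has_real_derivative p t) (at t)" using h by (intro r(2)) auto
  qed (use h in simp)
  then obtain z where z: "z > x i" "z < x i + h" "v (x(i := x i + h)) - v x = h * p z" by auto
  have "p z > 0" using q(2)[of "z - x i"] z h by simp
  then have "v (x(i := x i + h)) > v x" using z h by (smt (verit) mult_pos_pos)
  then show False using max[of "x i + h"] h by simp
qed

text \<open>
  Adding a small multiple of the square of one coordinate makes the function strictly subharmonic. Its maximum over the
  compact closure then cannot be interior, since no pure second derivative is positive there.
\<close>

lemma max_principle:
  assumes D: "openin (rtop d) D" "ebounded d D" "1 \<le> d"
    and v: "cont_on d (rtop d closure_of D) v"
    and sub: "\<And>x. x \<in> D \<Longrightarrow> \<exists>s. (\<forall>i<d. second_deriv_at i v x (s i)) \<and> 0 \<le> (\<Sum>i<d. s i)"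
    and bd: "\<And>x. x \<in> rtop d frontier_of D \<Longrightarrow> v x \<le> m"
    and x: "x \<in> D"
  shows "v x \<le> m"
proof (rule ccontr)
  assume "\<not> v x \<le> m" then have gt: "v x > m" by simp
  obtain R where R: "\<And>x y. x \<in> D \<Longrightarrow> y \<in> D \<Longrightarrow> edist d x y \<le> R"
    using D unfolding ebounded_def by blast
  have R0: "R \<ge> 0" using R[OF x x] by simp
  \<comment> \<open>small enough for the added term not to make up for the excess of \<open>v x\<close> over \<open>m\<close>\<close>
  define \<eta> where "\<eta> = (v x - m) / (2 * (R\<^sup>2 + 1))"
  have R1: "0 < R\<^sup>2 + 1" by (simp add: add_nonneg_pos)
  then have \<eta>: "\<eta> > 0" using gt by (simp add: \<eta>_def)
  have "\<eta> * R\<^sup>2 \<le> \<eta> * (R\<^sup>2 + 1)" using \<eta> by simp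
  also have "\<dots> = (v x - m) / 2"
  proof -
    have "k / (2 * q) * q = k / 2" if "0 < q" for k q :: real using that by simp
    from this[OF R1] show ?thesis unfolding \<eta>_def .
  qed
  finally have \<eta>R: "\<eta> * R\<^sup>2 < v x - m" using gt by simp
  define w where "w = (\<lambda>y. v y + \<eta> * ((y 0 - x 0) * (y 0 - x 0)))"
  define K where "K = rtop d closure_of D"
  have xK: "x \<in> K" unfolding K_def using open_subset_closure[OF D(1)] x by blast
  have "cont_on d K w" unfolding w_def K_def using D(3)
    by (intro cont_on_add v cont_on_mult cont_on_const cont_on_diff cont_on_coord) auto
  then obtain y where y: "y \<in> K" "\<And>z. z \<in> K \<Longrightarrow> w z \<le> w y"
    using compact_attains_max[of d K w] compactin_closure[OF D(2)] xK unfolding K_def by blast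
  have wx: "w x = v x" by (simp add: w_def)
  have yD: "y \<in> D"
  proof (rule ccontr)
    assume "y \<notin> D"
    then have "y \<in> rtop d frontier_of D" using y(1) frontier_of_open[OF D(1)] by (simp add: K_def)
    then have "v y \<le> m" by (rule bd)
    moreover have "\<bar>y 0 - x 0\<bar> \<le> R"
      using abs_coord_le_edist[of 0 d y x] D(3) closure_edist_le[OF y(1)[unfolded K_def] xK[unfolded K_def] R]
      by auto
    then have "(y 0 - x 0)\<^sup>2 \<le> R\<^sup>2" using R0 by (simp add: abs_le_square_iff[symmetric])
    then have "\<eta> * (y 0 - x 0)\<^sup>2 \<le> \<eta> * R\<^sup>2" using \<eta> by simp
    ultimately have "w y < v x" using \<eta>R by (simp add: w_def power2_eq_square)
    then show False using y(2)[OF xK] wx by simp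
  qed
  obtain s where s: "\<And>i. i < d \<Longrightarrow> second_deriv_at i v y (s i)" "0 \<le> (\<Sum>i<d. s i)"
    using sub[OF yD] by blast
  obtain e where e: "e > 0" "\<And>z. z \<in> topspace (rtop d) \<Longrightarrow> edist d y z < e \<Longrightarrow> z \<in> D"
    using openin_rtop_ball[OF yD D(1)] by blast
  have ys: "y \<in> topspace (rtop d)" using yD openin_subset[OF D(1)] by blast
  have sec: "s i + (if i = 0 then 2 * \<eta> else 0) \<le> 0" if i: "i < d" for i
  proof (rule second_deriv_at_local_max[OF _ e(1)])
    have "second_deriv_at i (\<lambda>y. \<eta> * ((y 0 - x 0) * (y 0 - x 0))) y (2 * (if i = 0 then \<eta> else 0))"
      by (rule second_deriv_at_quadratic[where \<beta> = "if i = 0 then - 2 * \<eta> * x 0 else 0"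
            and \<gamma> = "if i = 0 then \<eta> * (x 0)\<^sup>2 else \<eta> * ((y 0 - x 0) * (y 0 - x 0))"])
         (auto simp: power2_eq_square algebra_simps)
    from second_deriv_at_add[OF s(1)[OF i] this]
    show "second_deriv_at i w y (s i + (if i = 0 then 2 * \<eta> else 0))"
      unfolding w_def by (cases "i = 0") simp_all
    fix t assume t: "\<bar>t - y i\<bar> < e"
    have "y(i := t) \<in> D" using t e(2) fun_upd_in_space[OF i ys] edist_fun_upd[OF i, of y t]
      by (simp add: abs_minus_commute)
    then show "w (y(i := t)) \<le> w y" using y(2) open_subset_closure[OF D(1)] by (auto simp: K_def)
  qed
  have "(\<Sum>i<d. s i + (if i = 0 then 2 * \<eta> else 0)) \<le> 0" using sec by (intro sum_nonpos) auto
  moreover have "(\<Sum>i<d. (if i = 0 then 2 * \<eta> else 0)) = 2 * \<eta>" using D(3) by (subst sum.delta) auto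
  ultimately show False using s(2) \<eta> by (simp add: sum.distrib)
qed

lemma C2_on_second_deriv_at:
  assumes D: "openin (rtop d) D" and u: "C2_on d D u" and x: "x \<in> D" and i: "i < d"
  shows "second_deriv_at i u x (partial i (partial i u) x)"
  unfolding second_deriv_at_def
proof (intro exI[of _ "\<lambda>t. partial i u (x(i := t))"] conjI)
  have xs: "x \<in> topspace (rtop d)" using x openin_subset[OF D] by blast
  obtain e where e: "e > 0" "\<And>z. z \<in> topspace (rtop d) \<Longrightarrow> edist d x z < e \<Longrightarrow> z \<in> D"
    using openin_rtop_ball[OF x D] by blast
  show "\<forall>\<^sub>F t in nhds (x i). ((\<lambda>t. u (x(i := t))) has_real_derivative partial i u (x(i := t))) (at t)"
    unfolding eventually_nhds_metric
  proof (intro exI[of _ e] conjI allI impI e(1))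
    fix t assume "dist t (x i) < e"
    then have "x(i := t) \<in> D" using e(2) fun_upd_in_space[OF i xs] edist_fun_upd[OF i, of x t]
      by (simp add: dist_real_def abs_minus_commute)
    then have "partial_exists i u (x(i := t))" using u i unfolding C2_on_def by blast
    then show "((\<lambda>t. u (x(i := t))) has_real_derivative partial i u (x(i := t))) (at t)"
      unfolding partial_exists_def partial_def by (simp add: DERIV_deriv_iff_field_differentiable)
  qed
  have "partial_exists i (partial i u) x" using u i x unfolding C2_on_def by blast
  then show "((\<lambda>t. partial i u (x(i := t))) has_real_derivative partial i (partial i u) x) (at (x i))"
    unfolding partial_exists_def partial_def[of i "partial i u"]
    by (simp add: DERIV_deriv_iff_field_differentiable)
qed

section \<open>A priori bounds for the Poisson problem on a convex domain\<close>

text \<open>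
  The data of the theorem with explicit bounds: \<open>F\<close>, \<open>LG\<close> and \<open>G\<close> for \<open>f\<close>, \<open>laplacian d g\<close> and \<open>g\<close>,
  Lipschitz constants \<open>Lf\<close> and \<open>Lg\<close>, and \<open>R\<close> for the diameter. Constants that are defined from these bounds alone
  do not depend on the dimension or the domain.
\<close>

locale poisson_problem =
  fixes d :: nat and D :: "point set" and f g u :: "point \<Rightarrow> real" and F LG G Lf Lg R :: real
  assumes d1: "1 \<le> d" and open_D: "openin (rtop d) D" and D_ne: "D \<noteq> {}"
    and convex_D: "\<And>x y t. x \<in> D \<Longrightarrow> y \<in> D \<Longrightarrow> 0 \<le> t \<Longrightarrow> t \<le> 1 \<Longrightarrow> seg d x y t \<in> D"
    and diam: "\<And>x y. x \<in> D \<Longrightarrow> y \<in> D \<Longrightarrow> edist d x y \<le> R"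
    and f_bound: "\<And>x. x \<in> D \<Longrightarrow> \<bar>f x\<bar> \<le> F"
    and f_lip: "\<And>x y. x \<in> D \<Longrightarrow> y \<in> D \<Longrightarrow> \<bar>f x - f y\<bar> \<le> Lf * edist d x y"
    and g_C2: "C2_on d D g" and g_cont: "cont_on d (rtop d closure_of D) g"
    and g_bound: "\<And>x. x \<in> D \<Longrightarrow> \<bar>g x\<bar> \<le> G"
    and g_lap: "\<And>x. x \<in> D \<Longrightarrow> \<bar>laplacian d g x\<bar> \<le> LG"
    and g_lip: "\<And>x y. x \<in> rtop d closure_of D \<Longrightarrow> y \<in> rtop d closure_of D \<Longrightarrow>
                  \<bar>g x - g y\<bar> \<le> Lg * edist d x y"
    and Lf0: "0 \<le> Lf" and Lg0: "0 \<le> Lg"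
    and sol: "poisson_solution d D f g u"
begin

lemma bdd: "ebounded d D" unfolding ebounded_def using diam by blast
lemma D_space: "x \<in> D \<Longrightarrow> x \<in> topspace (rtop d)" using openin_subset[OF open_D] by blast
lemma D_closure: "x \<in> D \<Longrightarrow> x \<in> rtop d closure_of D" using open_subset_closure[OF open_D] by blast
lemma R0: "0 \<le> R" using D_ne diam by (metis all_not_in_conv edist_refl)
lemma F0: "0 \<le> F" using D_ne f_bound by (meson abs_ge_zero all_not_in_conv order_trans)
lemma G0: "0 \<le> G" using D_ne g_bound by (meson abs_ge_zero all_not_in_conv order_trans)
lemma LG0: "0 \<le> LG" using D_ne g_lap by (meson abs_ge_zero all_not_in_conv order_trans)
lemma u_C2: "C2_on d D u" using sol unfolding poisson_solution_def by blast
lemma u_cont: "cont_on d (rtop d closure_of D) u" using sol unfolding poisson_solution_def by blast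
lemma u_lap: "x \<in> D \<Longrightarrow> laplacian d u x = - f x" using sol unfolding poisson_solution_def by force
lemma u_bdry: "x \<in> rtop d frontier_of D \<Longrightarrow> u x = g x" using sol unfolding poisson_solution_def by blast
lemma u_sec: "x \<in> D \<Longrightarrow> i < d \<Longrightarrow> second_deriv_at i u x (partial i (partial i u) x)"
  by (rule C2_on_second_deriv_at[OF open_D u_C2])
lemma g_sec: "x \<in> D \<Longrightarrow> i < d \<Longrightarrow> second_deriv_at i g x (partial i (partial i g) x)"
  by (rule C2_on_second_deriv_at[OF open_D g_C2])
lemma frontierD: "x \<in> rtop d frontier_of D \<Longrightarrow> x \<in> rtop d closure_of D \<and> x \<notin> D \<and> x \<in> topspace (rtop d)"
  using closure_of_subset_topspace[of "rtop d" D] by (auto simp: frontier_of_open[OF open_D])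

text \<open>
  The bound for the Laplacian of \<open>u - g\<close>.
\<close>

definition A :: real where "A = F + LG"
lemma A0: "0 \<le> A" using F0 LG0 by (simp add: A_def)

text \<open>
  Here \<open>y\<close> is a boundary point nearest to \<open>x\<close>. If some \<open>z\<close> in \<open>D\<close> were beyond the hyperplane through \<open>y\<close> orthogonal
  to \<open>y - x\<close>, then the prolongation of the segment from \<open>z\<close> through \<open>y\<close> would enter the ball around \<open>x\<close> that touches
  the boundary in \<open>y\<close>. By convexity \<open>y\<close> would belong to the open set \<open>D\<close>.
\<close>

lemma supporting_halfspace:
  assumes x: "x \<in> D" and y: "y \<in> rtop d frontier_of D" and dy: "dist_bdry d D x = edist d x y"
    and z: "z \<in> D"
  shows "(\<Sum>k<d. (y k - x k) * (z k - y k)) \<le> 0"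
proof (rule ccontr)
  define p where "p = (\<Sum>k<d. (y k - x k) * (z k - y k))"
  assume "\<not> ?thesis" then have p: "p > 0" by (simp add: p_def)
  define q where "q = (\<Sum>k<d. (z k - y k)\<^sup>2)"
  have q0: "q \<ge> 0" unfolding q_def by (intro sum_nonneg) auto
  \<comment> \<open>the prolongation beyond \<open>y\<close>; a small multiple, so that the linear term dominates the quadratic one\<close>
  define \<tau> where "\<tau> = p / (q + 1)"
  have \<tau>: "\<tau> > 0" using p q0 by (simp add: \<tau>_def)
  define b where "b = (\<lambda>k\<in>{..<d}. y k - \<tau> * (z k - y k))"
  have bs: "b \<in> topspace (rtop d)" by (simp add: b_def topspace_rtop)
  have "(edist d x b)\<^sup>2 = (\<Sum>k<d. (y k - x k)\<^sup>2 - 2 * \<tau> * ((y k - x k) * (z k - y k)) + \<tau>\<^sup>2 * (z k - y k)\<^sup>2)"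
    unfolding edist_sq by (rule sum.cong) (auto simp: b_def power2_eq_square algebra_simps)
  also have "\<dots> = (edist d x y)\<^sup>2 - 2 * \<tau> * p + \<tau>\<^sup>2 * q"
    unfolding edist_sq p_def q_def
    by (simp add: sum.distrib sum_subtractf sum_distrib_left power2_commute)
  also have "\<dots> < (edist d x y)\<^sup>2"
  proof -
    have "\<tau> * q \<le> p" using q0 p by (simp add: \<tau>_def field_simps)
    then have "\<tau>\<^sup>2 * q \<le> \<tau> * p" using \<tau> by (simp add: power2_eq_square)
    moreover have "0 < \<tau> * p" using \<tau> p by simp
    ultimately show ?thesis by simp
  qed
  finally have "edist d x b < edist d x y" by (rule power2_less_imp_less[OF _ edist_nonneg])
  then have bD: "b \<in> D" using ball_subset_domain[OF open_D x bs] dy by simp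
  have "seg d b z (\<tau> / (1 + \<tau>)) \<in> D" using convex_D[OF bD z, of "\<tau> / (1 + \<tau>)"] \<tau> by simp
  moreover have "seg d b z (\<tau> / (1 + \<tau>)) = y"
  proof
    fix k
    have ys: "y \<in> topspace (rtop d)" using frontierD[OF y] by blast
    have e: "1 - \<tau> / (1 + \<tau>) = 1 / (1 + \<tau>)" using \<tau> by (simp add: field_simps)
    show "seg d b z (\<tau> / (1 + \<tau>)) k = y k"
    proof (cases "k < d")
      case True
      have "(1 / (1 + \<tau>)) * (y k - \<tau> * (z k - y k)) + \<tau> / (1 + \<tau>) * z k = ((1 + \<tau>) * y k) / (1 + \<tau>)"
        by (simp add: add_divide_distrib[symmetric] algebra_simps)
      then show ?thesis using True \<tau> by (simp add: seg_def b_def e)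
    next
      case False then show ?thesis using ys by (auto simp: seg_def topspace_rtop PiE_iff extensional_def)
    qed
  qed
  ultimately show False using frontierD[OF y] by simp
qed

text \<open>
  Let \<open>s\<close> be the distance to the supporting hyperplane at the boundary point nearest to \<open>x\<close>. On \<open>D\<close> it lies between
  \<open>0\<close> and \<open>R\<close>, so \<open>A / 2 * s * (R - s)\<close> is nonnegative. Its Laplacian is \<open>- A\<close>, hence it dominates \<open>\<bar>u - g\<bar>\<close> by
  the maximum principle, and at \<open>x\<close> the value of \<open>s\<close> is the distance to the boundary.
\<close>

lemma u_minus_g_le_dist:
  assumes x: "x \<in> D"
  shows "\<bar>u x - g x\<bar> \<le> A * R / 2 * dist_bdry d D x"
proof -
  obtain y where y: "y \<in> rtop d frontier_of D" "dist_bdry d D x = edist d x y"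
    using nearest_boundary_point[OF open_D bdd d1 x] by blast
  define \<rho> where "\<rho> = edist d x y"
  have \<rho>: "\<rho> > 0" using dist_bdry_pos[OF open_D bdd d1 x] y by (simp add: \<rho>_def)
  define n where "n = (\<lambda>k. (y k - x k) / \<rho>)"
  have n1: "(\<Sum>k<d. (n k)\<^sup>2) = 1"
  proof -
    have "(\<Sum>k<d. (n k)\<^sup>2) = (\<Sum>k<d. (x k - y k)\<^sup>2) / \<rho>\<^sup>2"
      unfolding n_def sum_divide_distrib by (rule sum.cong) (auto simp: power_divide power2_commute)
    then show ?thesis using \<rho> by (simp add: edist_sq[symmetric] \<rho>_def)
  qed
  define s where "s = (\<lambda>z. \<Sum>k<d. n k * (y k - z k))"
  have sD: "0 \<le> s z" if "z \<in> D" for z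
  proof -
    have "s z = - (\<Sum>k<d. (y k - x k) * (z k - y k)) / \<rho>"
      unfolding s_def n_def sum_negf[symmetric] sum_divide_distrib
      by (rule sum.cong) (auto simp: algebra_simps add_divide_distrib diff_divide_distrib)
    then show ?thesis using supporting_halfspace[OF x y that] \<rho> by (simp add: divide_nonpos_pos)
  qed
  have s_lip: "\<bar>s z - s z'\<bar> \<le> edist d z z'" for z z'
  proof -
    have "\<bar>s z - s z'\<bar> = \<bar>\<Sum>k<d. n k * (z' k - z k)\<bar>"
      unfolding s_def sum_subtractf[symmetric] by (simp add: algebra_simps)
    also have "\<dots> \<le> (\<Sum>k<d. \<bar>n k\<bar> * \<bar>z' k - z k\<bar>)"
      by (rule order_trans[OF sum_abs]) (simp add: abs_mult)
    also have "\<dots> \<le> L2_set n {..<d} * L2_set (\<lambda>k. z' k - z k) {..<d}"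
      by (rule L2_set_mult_ineq)
    also have "\<dots> = edist d z z'" using n1 edist_commute[of d z z'] by (simp add: edist_def L2_set_def)
    finally show ?thesis .
  qed
  have s_cl: "0 \<le> s z" if z: "z \<in> rtop d closure_of D" for z
  proof (rule field_le_epsilon)
    fix e :: real assume "0 < e"
    then obtain z' where "z' \<in> D" "edist d z z' < e" using z unfolding closure_of_rtop_iff by blast
    then show "0 \<le> s z + e" using sD[of z'] s_lip[of z z'] by linarith
  qed
  have sy: "s y = 0" by (simp add: s_def)
  have y_cl: "y \<in> rtop d closure_of D" using frontierD[OF y(1)] by blast
  have s_R: "s z \<le> R" if "z \<in> rtop d closure_of D" for z
    using s_lip[of z y] sy closure_edist_le[OF that y_cl diam] by linarith
  have sx: "s x = \<rho>"
  proof -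
    have "s x = (\<Sum>k<d. (n k)\<^sup>2) * \<rho>"
      unfolding s_def n_def sum_distrib_right
      by (rule sum.cong) (use \<rho> in \<open>auto simp: power2_eq_square\<close>)
    then show ?thesis using n1 by simp
  qed
  define \<beta> where "\<beta> = (\<lambda>z. A / 2 * (s z * (R - s z)))"
  have \<beta>_sec: "second_deriv_at i \<beta> z (- A * (n i)\<^sup>2)" if i: "i < d" for i z
  proof -
    define c where "c = s z + n i * z i"
    have e: "s (z(i := t)) = c - n i * t" for t
    proof -
      have "s (z(i := t)) - s z = (\<Sum>k<d. if k = i then n i * (z i - t) else 0)"
        unfolding s_def sum_subtractf[symmetric] by (rule sum.cong) (auto simp: algebra_simps)
      also have "\<dots> = n i * (z i - t)" using i by simp
      finally show ?thesis by (simp add: c_def algebra_simps)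
    qed
    have "second_deriv_at i \<beta> z (2 * (A / 2 * (- (n i)\<^sup>2)))"
      by (rule second_deriv_at_quadratic[where \<beta> = "A / 2 * (2 * c * n i - R * n i)"
            and \<gamma> = "A / 2 * (c * (R - c))"])
         (simp add: \<beta>_def e power2_eq_square field_simps)
    then show ?thesis by simp
  qed
  have \<beta>0: "0 \<le> \<beta> z" if "z \<in> rtop d closure_of D" for z
    unfolding \<beta>_def using A0 s_cl[OF that] s_R[OF that] by simp
  have s_cont: "cont_on d S s" for S
    unfolding s_def by (intro cont_on_sum cont_on_mult cont_on_const cont_on_diff cont_on_coord) auto
  have \<beta>_cont: "cont_on d S \<beta>" for S
    unfolding \<beta>_def by (intro cont_on_mult cont_on_const cont_on_diff s_cont)
  have key: "\<sigma> * (u x - g x) - \<beta> x \<le> 0" if \<sigma>: "\<bar>\<sigma>\<bar> = 1" for \<sigma> :: real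
  proof (rule max_principle[OF open_D bdd d1 _ _ _ x])
    show "cont_on d (rtop d closure_of D) (\<lambda>z. \<sigma> * (u z - g z) - \<beta> z)"
      by (intro cont_on_mult cont_on_const cont_on_diff \<beta>_cont u_cont g_cont)
    show "\<sigma> * (u z - g z) - \<beta> z \<le> 0" if "z \<in> rtop d frontier_of D" for z
      using u_bdry[OF that] \<beta>0[of z] frontierD[OF that] by simp
    fix z assume z: "z \<in> D"
    let ?s = "\<lambda>i. \<sigma> * (partial i (partial i u) z - partial i (partial i g) z) - (- A * (n i)\<^sup>2)"
    have "(\<Sum>i<d. ?s i) = \<sigma> * (laplacian d u z - laplacian d g z) + A * (\<Sum>i<d. (n i)\<^sup>2)"
      unfolding laplacian_def
      by (simp add: sum_subtractf sum.distrib sum_distrib_left[symmetric] sum_negf)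
    also have "\<dots> = \<sigma> * (- f z - laplacian d g z) + A" using u_lap[OF z] n1 by simp
    also have "\<dots> \<ge> 0"
    proof -
      have "\<bar>\<sigma> * (- f z - laplacian d g z)\<bar> \<le> A"
        using \<sigma> f_bound[OF z] g_lap[OF z] by (simp add: abs_mult A_def)
      then show ?thesis by simp
    qed
    finally have sum: "0 \<le> (\<Sum>i<d. ?s i)" .
    have "second_deriv_at i (\<lambda>z. \<sigma> * (u z - g z) - \<beta> z) z (?s i)" if i: "i < d" for i
      by (intro second_deriv_at_cmult second_deriv_at_diff \<beta>_sec u_sec g_sec z i)
    then show "\<exists>s. (\<forall>i<d. second_deriv_at i (\<lambda>z. \<sigma> * (u z - g z) - \<beta> z) z (s i)) \<and> 0 \<le> (\<Sum>i<d. s i)"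
      using sum by (intro exI[of _ ?s]) simp
  qed
  have "\<bar>u x - g x\<bar> \<le> \<beta> x" using key[of 1] key[of "-1"] by simp
  also have "\<beta> x \<le> A / 2 * (\<rho> * R)"
    unfolding \<beta>_def sx using A0 \<rho> by (intro mult_left_mono) auto
  finally show ?thesis using y by (simp add: \<rho>_def mult_ac)
qed

lemma dist_le_R: "x \<in> D \<Longrightarrow> dist_bdry d D x \<le> R"
proof -
  assume x: "x \<in> D"
  obtain y where y: "y \<in> rtop d frontier_of D" "dist_bdry d D x = edist d x y"
    using nearest_boundary_point[OF open_D bdd d1 x] by blast
  then show ?thesis using closure_edist_le[OF D_closure[OF x] _ diam] frontierD by metis
qed

definition U0 :: real where "U0 = G + A * R\<^sup>2 / 2"
lemma U0_nonneg: "0 \<le> U0" unfolding U0_def using G0 A0 by simp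

lemma u_bound: assumes x: "x \<in> D" shows "\<bar>u x\<bar> \<le> U0"
proof -
  have "A * R / 2 * dist_bdry d D x \<le> A * R / 2 * R"
    using dist_le_R[OF x] A0 R0 by (intro mult_left_mono) auto
  then have "\<bar>u x\<bar> \<le> G + A * R / 2 * R" using u_minus_g_le_dist[OF x] g_bound[OF x] by linarith
  then show ?thesis by (simp add: U0_def power2_eq_square mult.assoc)
qed

text \<open>
  A Lipschitz constant of \<open>u\<close>; the three summands stem from the barrier, from \<open>g\<close> and from \<open>f\<close>.
\<close>

definition \<Lambda> :: real where "\<Lambda> = A * R / 2 + Lg + Lf * R\<^sup>2 / 2"
lemma \<Lambda>0: "0 \<le> \<Lambda>" unfolding \<Lambda>_def using A0 R0 Lf0 Lg0 by simp

lemma u_near_bdry: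
  assumes z: "z \<in> rtop d closure_of D" and w: "w \<in> rtop d frontier_of D"
  shows "\<bar>u z - g w\<bar> \<le> (A * R / 2 + Lg) * edist d z w"
proof -
  have "\<bar>u z - g z\<bar> \<le> A * R / 2 * edist d z w"
  proof (cases "z \<in> D")
    case True
    then have "\<bar>u z - g z\<bar> \<le> A * R / 2 * dist_bdry d D z" by (rule u_minus_g_le_dist)
    also have "\<dots> \<le> A * R / 2 * edist d z w"
      using dist_bdry_le[OF w] A0 R0 by (intro mult_left_mono) auto
    finally show ?thesis .
  next
    case False
    then show ?thesis using z u_bdry[of z] frontier_of_open[OF open_D] A0 R0 by simp
  qed
  moreover have "\<bar>g z - g w\<bar> \<le> Lg * edist d z w" using g_lip[OF z] frontierD[OF w] by blast
  ultimately have "\<bar>u z - g w\<bar> \<le> A * R / 2 * edist d z w + Lg * edist d z w" by linarith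
  then show ?thesis by (simp only: distrib_right)
qed

text \<open>
  Let \<open>h = y - x\<close>. On the intersection of \<open>D\<close> with \<open>D - h\<close> the function \<open>u (z + h) - u z\<close> has a Laplacian of size at most
  \<open>Lf * \<bar>h\<bar>\<close>, and on the frontier one of the two points is on the boundary of \<open>D\<close>, so that the difference is at most a
  constant times \<open>\<bar>h\<bar>\<close> there. The maximum principle transports this bound to the point \<open>x\<close>.
\<close>

lemma u_lipschitz:
  assumes x: "x \<in> D" and y: "y \<in> D"
  shows "\<bar>u x - u y\<bar> \<le> \<Lambda> * edist d x y"
proof -
  define len where "len = edist d x y"
  define h where "h = (\<lambda>k. y k - x k)"
  let ?T = "shift d h"
  have dT: "edist d z (?T z) = len" for z
  proof -
    have "(\<Sum>i<d. (z i - ?T z i)\<^sup>2) = (\<Sum>i<d. (x i - y i)\<^sup>2)"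
      by (rule sum.cong) (auto simp: shift_def h_def power2_commute)
    then show ?thesis by (simp add: edist_def L2_set_def len_def)
  qed
  define E where "E = {z \<in> D. ?T z \<in> D}"
  have Tx: "?T x = y" using D_space[OF y] by (auto simp: shift_def h_def topspace_rtop PiE_iff extensional_def fun_eq_iff)
  have xE: "x \<in> E" using x y Tx by (simp add: E_def)
  have E_open: "openin (rtop d) E" unfolding openin_rtop_iff
  proof (intro conjI ballI)
    show "E \<subseteq> topspace (rtop d)" using D_space by (auto simp: E_def)
    fix z assume z: "z \<in> E"
    obtain e where e: "e > 0" "\<And>w. w \<in> topspace (rtop d) \<Longrightarrow> edist d z w < e \<Longrightarrow> w \<in> D"
      using openin_rtop_ball[OF _ open_D, of z] z by (auto simp: E_def)
    obtain e' where e': "e' > 0" "\<And>w. w \<in> topspace (rtop d) \<Longrightarrow> edist d (?T z) w < e' \<Longrightarrow> w \<in> D"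
      using openin_rtop_ball[OF _ open_D, of "?T z"] z by (auto simp: E_def)
    show "\<exists>e>0. \<forall>w\<in>topspace (rtop d). edist d z w < e \<longrightarrow> w \<in> E"
    proof (intro exI[of _ "min e e'"] conjI ballI impI)
      fix w assume w: "w \<in> topspace (rtop d)" "edist d z w < min e e'"
      have "?T w \<in> D" using w e'(2)[OF shift_in_space, of h w] edist_shift[of d h z w] by simp
      moreover have "w \<in> D" using w e(2) by simp
      ultimately show "w \<in> E" by (simp add: E_def)
    qed (use e e' in simp)
  qed
  have E_bdd: "ebounded d E" using diam unfolding ebounded_def E_def by blast
  have E_cl: "z \<in> rtop d closure_of D \<and> ?T z \<in> rtop d closure_of D" if z: "z \<in> rtop d closure_of E" for z
  proof
    show "z \<in> rtop d closure_of D" using z closure_of_mono[of E D "rtop d"] by (auto simp: E_def)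
    show "?T z \<in> rtop d closure_of D" unfolding closure_of_rtop_iff
    proof (intro conjI allI impI shift_in_space)
      fix e :: real assume "0 < e"
      then obtain w where w: "w \<in> E" "edist d z w < e" using z unfolding closure_of_rtop_iff by blast
      then show "\<exists>w\<in>D. w \<in> topspace (rtop d) \<and> edist d (?T z) w < e"
        by (intro bexI[of _ "?T w"]) (auto simp: E_def edist_shift shift_in_space)
    qed
  qed
  have uT_cont: "cont_on d (rtop d closure_of E) (\<lambda>z. u (?T z))"
    unfolding cont_on_iff[OF closure_of_subset_topspace]
  proof (intro ballI allI impI)
    fix z and e :: real assume z: "z \<in> rtop d closure_of E" and e: "0 < e"
    have "?T z \<in> rtop d closure_of D" using E_cl[OF z] by blast
    then obtain s where "s > 0" "\<And>w. w \<in> rtop d closure_of D \<Longrightarrow> edist d (?T z) w < s \<Longrightarrow> \<bar>u w - u (?T z)\<bar> < e"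
      using u_cont e unfolding cont_on_iff[OF closure_of_subset_topspace] by blast
    then show "\<exists>s>0. \<forall>w\<in>rtop d closure_of E. edist d z w < s \<longrightarrow> \<bar>u (?T w) - u (?T z)\<bar> < e"
      using E_cl by (intro exI[of _ s]) (auto simp: edist_shift)
  qed
  have u_cont': "cont_on d (rtop d closure_of E) u"
    using u_cont by (rule cont_on_subset) (use E_cl in blast)
  define \<beta> where "\<beta> = (\<lambda>z::point. Lf * len / 2 * ((z 0 - x 0) * (z 0 - x 0)))"
  have len0: "0 \<le> len" by (simp add: len_def)
  have \<beta>_sec: "second_deriv_at i \<beta> z (if i = 0 then Lf * len else 0)" for i z
  proof -
    have "second_deriv_at i \<beta> z (2 * (if i = 0 then Lf * len / 2 else 0))"
      by (rule second_deriv_at_quadratic[where \<beta> = "if i = 0 then - (Lf * len * x 0) else 0"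
            and \<gamma> = "if i = 0 then Lf * len / 2 * (x 0)\<^sup>2 else \<beta> z"])
         (auto simp: \<beta>_def power2_eq_square field_simps)
    then show ?thesis by (simp split: if_splits)
  qed
  have \<beta>_le: "\<beta> z \<le> Lf * R\<^sup>2 / 2 * len" if z: "z \<in> rtop d closure_of D" for z
  proof -
    have "\<bar>z 0 - x 0\<bar> \<le> R"
      using abs_coord_le_edist[of 0 d z x] d1 closure_edist_le[OF z D_closure[OF x] diam] by auto
    then have "(z 0 - x 0)\<^sup>2 \<le> R\<^sup>2" using R0 by (simp add: abs_le_square_iff[symmetric])
    then have "Lf * len / 2 * (z 0 - x 0)\<^sup>2 \<le> Lf * len / 2 * R\<^sup>2" using Lf0 len0 by (intro mult_left_mono) auto
    then show ?thesis by (simp add: \<beta>_def power2_eq_square mult_ac)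
  qed
  have key: "\<sigma> * (u (?T x) - u x) + \<beta> x \<le> \<Lambda> * len" if \<sigma>: "\<bar>\<sigma>\<bar> = 1" for \<sigma> :: real
  proof (rule max_principle[OF E_open E_bdd d1 _ _ _ xE])
    show "cont_on d (rtop d closure_of E) (\<lambda>z. \<sigma> * (u (?T z) - u z) + \<beta> z)"
      unfolding \<beta>_def using d1
      by (intro cont_on_add cont_on_mult cont_on_const cont_on_diff uT_cont u_cont' cont_on_coord) auto
    show "\<sigma> * (u (?T z) - u z) + \<beta> z \<le> \<Lambda> * len" if "z \<in> rtop d frontier_of E" for z
    proof -
      have z: "z \<in> rtop d closure_of E" "z \<notin> E" using that frontier_of_open[OF E_open] by auto
      note zc = E_cl[OF z(1)]
      have "\<bar>u (?T z) - u z\<bar> \<le> (A * R / 2 + Lg) * len"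
      proof (cases "z \<in> D")
        case True
        then have "?T z \<notin> D" using z(2) by (simp add: E_def)
        then have "?T z \<in> rtop d frontier_of D" using zc frontier_of_open[OF open_D] by simp
        from u_near_bdry[OF _ this, of z] u_bdry[OF this] zc dT[of z] show ?thesis by (simp add: abs_minus_commute)
      next
        case False
        then have zf: "z \<in> rtop d frontier_of D" using zc frontier_of_open[OF open_D] by simp
        from u_near_bdry[OF _ zf, of "?T z"] u_bdry[OF zf] zc dT[of z] edist_commute[of d z]
        show ?thesis by simp
      qed
      then have "\<bar>\<sigma> * (u (?T z) - u z)\<bar> \<le> (A * R / 2 + Lg) * len" using \<sigma> by (simp add: abs_mult)
      then show ?thesis using \<beta>_le[OF conjunct1[OF zc]] unfolding \<Lambda>_def by (simp add: algebra_simps)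
    qed
    fix z assume z: "z \<in> E"
    then have zD: "z \<in> D" "?T z \<in> D" by (auto simp: E_def)
    let ?s = "\<lambda>i. \<sigma> * (partial i (partial i u) (?T z) - partial i (partial i u) z) + (if i = 0 then Lf * len else 0)"
    have "(\<Sum>i<d. ?s i) = \<sigma> * (laplacian d u (?T z) - laplacian d u z) + (\<Sum>i<d. if i = 0 then Lf * len else 0)"
      unfolding laplacian_def
      by (simp add: sum_subtractf sum.distrib sum_distrib_left[symmetric])
    also have "(\<Sum>i<d. if i = 0 then Lf * len else 0) = Lf * len" using d1 by (subst sum.delta) auto
    also have "\<sigma> * (laplacian d u (?T z) - laplacian d u z) + Lf * len \<ge> 0"
    proof -
      have "\<bar>\<sigma> * (laplacian d u (?T z) - laplacian d u z)\<bar> \<le> Lf * len"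
        using \<sigma> f_lip[OF zD] u_lap[OF zD(1)] u_lap[OF zD(2)] dT[of z] by (simp add: abs_mult)
      then show ?thesis by simp
    qed
    finally have sum: "0 \<le> (\<Sum>i<d. ?s i)" .
    have "second_deriv_at i (\<lambda>z. \<sigma> * (u (?T z) - u z) + \<beta> z) z (?s i)" if i: "i < d" for i
      by (intro second_deriv_at_add second_deriv_at_cmult second_deriv_at_diff \<beta>_sec
            second_deriv_at_shift u_sec zD i)
    then show "\<exists>s. (\<forall>i<d. second_deriv_at i (\<lambda>z. \<sigma> * (u (?T z) - u z) + \<beta> z) z (s i)) \<and> 0 \<le> (\<Sum>i<d. s i)"
      using sum by (intro exI[of _ ?s]) simp
  qed
  have "\<beta> x = 0" by (simp add: \<beta>_def)
  then have "\<bar>u (?T x) - u x\<bar> \<le> \<Lambda> * len" using key[of 1] key[of "-1"] by simp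
  then show ?thesis using Tx by (simp add: len_def abs_minus_commute)
qed

end


section \<open>Lebesgue measure on tuples\<close>

lemma space_rleb: "space (rleb d) = topspace (rtop d)"
  by (simp add: space_PiM topspace_rtop)

lemma openin_Int_space: "openin (rtop d) U \<Longrightarrow> U \<inter> space (rleb d) = U"
  using openin_subset[of "rtop d" U] by (auto simp: space_rleb)

lemma openin_Int_PiE: "openin (rtop d) U \<Longrightarrow> U \<inter> PiE {..<d} (\<lambda>_. UNIV) = U"
  using openin_subset[of "rtop d" U] by (auto simp: topspace_rtop)

text \<open>
  The product topology on the countable power has the product sigma algebra as its Borel sets, and the finite power is
  embedded in it measurably.
\<close>

lemma openin_imp_measurable:
  assumes U: "openin (rtop d) U" shows "U \<in> sets (rleb d)"
proof -
  define V where "V = {z. restrict z {..<d} \<in> U}"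
  have "continuous_map (powertop_real UNIV) (rtop d) (\<lambda>z. restrict z {..<d})"
    by (rule continuous_on_restrict) auto
  then have "openin (powertop_real UNIV) {z \<in> topspace (powertop_real UNIV). restrict z {..<d} \<in> U}"
    using U by (rule openin_continuous_map_preimage)
  then have "open V" by (simp add: V_def open_fun_def topspace_product_topology)
  then have V: "V \<in> sets (Pi\<^sub>M UNIV (\<lambda>_::nat. borel :: real measure))"
    by (simp add: sets_PiM_equal_borel)
  have "(\<lambda>x i. x i) \<in> measurable (rleb d) (Pi\<^sub>M UNIV (\<lambda>_::nat. borel :: real measure))"
  proof (rule measurable_PiM_single')
    fix i :: nat
    show "(\<lambda>x. x i) \<in> measurable (rleb d) borel"
    proof (cases "i < d")
      case True then show ?thesis using measurable_component_singleton[of i "{..<d}" "\<lambda>_. lborel :: real measure"] by simp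
    next
      case False
      show ?thesis
        by (subst measurable_cong[where g = "\<lambda>_. undefined"])
           (use False in \<open>auto simp: space_PiM PiE_iff extensional_def\<close>)
    qed
  qed (simp add: space_PiM)
  from measurable_sets[OF this V]
  have "V \<inter> space (rleb d) \<in> sets (rleb d)" by (simp add: vimage_def Int_def)
  moreover have "V \<inter> space (rleb d) = U"
    using openin_subset[OF U] by (auto simp: V_def space_rleb topspace_rtop PiE_restrict)
  ultimately show ?thesis by simp
qed

lemma cont_on_measurable_restrict:
  assumes D: "openin (rtop d) D" and h: "cont_on d D h"
  shows "h \<in> borel_measurable (restrict_space (rleb d) D)"
proof (rule borel_measurableI)
  fix S :: "real set" assume "open S"
  have "openin (subtopology (rtop d) D) {x \<in> topspace (subtopology (rtop d) D). h x \<in> S}"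
    using h \<open>open S\<close> unfolding cont_on_def by (intro openin_continuous_map_preimage) auto
  then have "openin (rtop d) {x \<in> topspace (subtopology (rtop d) D). h x \<in> S}"
    using D by (meson openin_trans_full)
  moreover have "{x \<in> topspace (subtopology (rtop d) D). h x \<in> S} = h -` S \<inter> D"
    using openin_subset[OF D] by auto
  ultimately have m: "h -` S \<inter> D \<in> sets (rleb d)" using openin_imp_measurable by simp
  have D': "D \<in> sets (rleb d)" using D by (rule openin_imp_measurable)
  have "space (restrict_space (rleb d) D) = D"
    by (metis D Int_commute openin_Int_space space_restrict_space)
  then show "h -` S \<inter> space (restrict_space (rleb d) D) \<in> sets (restrict_space (rleb d) D)"
    using m D' by (simp add: sets_restrict_space_iff openin_Int_space[OF D] openin_Int_PiE[OF D])
qed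

lemma cont_on_set_measurable:
  assumes D: "openin (rtop d) D" and h: "cont_on d D h"
  shows "set_borel_measurable (rleb d) D h"
  unfolding set_borel_measurable_def
  using cont_on_measurable_restrict[OF assms] openin_imp_measurable[OF D]
  by (subst (asm) borel_measurable_restrict_space_iff) (auto simp: openin_Int_space[OF D] openin_Int_PiE[OF D])

interpretation PL: product_sigma_finite "\<lambda>_::nat. lborel :: real measure" ..

lemma emeasure_open_pos:
  assumes U: "openin (rtop d) U" and x: "x \<in> U"
  shows "0 < emeasure (rleb d) U"
proof -
  obtain e where e: "e > 0" "\<And>y. y \<in> topspace (rtop d) \<Longrightarrow> edist d x y < e \<Longrightarrow> y \<in> U"
    using openin_rtop_ball[OF x U] by blast
  define s where "s = e / (real d + 1)"
  have s: "s > 0" using e by (simp add: s_def)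
  define Bx where "Bx = PiE {..<d} (\<lambda>i. {x i..x i + s})"
  have "Bx \<subseteq> U"
  proof
    fix y assume y: "y \<in> Bx"
    have "edist d x y \<le> (\<Sum>i<d. \<bar>x i - y i\<bar>)" by (rule edist_le_sum)
    also have "\<dots> \<le> (\<Sum>i<d. s)" using y by (intro sum_mono) (simp add: Bx_def PiE_iff abs_le_iff algebra_simps)
    also have "\<dots> = e * (real d / (real d + 1))" by (simp add: s_def)
    also have "\<dots> < e * 1" using e by (intro mult_strict_left_mono) auto
    finally show "y \<in> U" using y by (intro e(2)) (auto simp: Bx_def topspace_rtop PiE_iff)
  qed
  moreover have "emeasure (rleb d) Bx = (\<Prod>i<d. ennreal s)"
    unfolding Bx_def using s by (subst PL.emeasure_PiM) auto
  moreover have "(\<Prod>i<d. ennreal s) = ennreal (s ^ d)" using s by (subst prod_ennreal) auto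
  moreover have "ennreal (s ^ d) > 0" using s by simp
  ultimately show ?thesis using emeasure_mono[OF _ openin_imp_measurable[OF U], of Bx]
    by (metis order_less_le_trans)
qed

text \<open>
  On \<open>D\<close> the function \<open>exp (4 * pi * (R\<^sup>2 - \<bar>y - x\<bar>\<^sup>2))\<close> is at least \<open>1\<close>, and its integral over the whole space is a product
  of one-dimensional Gaussian integrals, each equal to \<open>1/2\<close>. The point is the exponential decay in \<open>d\<close> for a
  fixed diameter.
\<close>

lemma emeasure_le_gaussian:
  assumes D: "D \<in> sets (rleb d)" and R: "\<And>y. y \<in> D \<Longrightarrow> edist d x y \<le> R" and R0: "0 \<le> R"
  shows "emeasure (rleb d) D \<le> ennreal (exp (4 * pi * R\<^sup>2) * (1/2) ^ d)"
proof -
  \<comment> \<open>the variance for which the normal density is twice \<open>exp (- 4 * pi * (t - x i)\<^sup>2)\<close>\<close>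
  define n where "n = (\<lambda>i. normal_density (x i) (1 / sqrt (8 * pi)))"
  have n: "n i t = 2 * exp (- (4 * pi * (t - x i)\<^sup>2))" for i t
  proof -
    have "2 * pi * (1 / sqrt (8 * pi))\<^sup>2 = (1 / 2)\<^sup>2"
      by (simp add: power_divide)
    then have "sqrt (2 * pi * (1 / sqrt (8 * pi))\<^sup>2) = 1 / 2" by (simp only: real_sqrt_abs)
    moreover have "- (t - x i)\<^sup>2 / (2 * (1 / sqrt (8 * pi))\<^sup>2) = - (4 * pi * (t - x i)\<^sup>2)"
      by (simp add: power_divide)
    ultimately show ?thesis unfolding n_def normal_density_def by (simp only:) simp
  qed
  have int: "(\<integral>\<^sup>+t. ennreal (n i t) \<partial>lborel) = 1" for i
    unfolding n_def by (subst nn_integral_eq_integral) (auto intro!: integrable_normal_density)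
  have "emeasure (rleb d) D = (\<integral>\<^sup>+y. indicator D y \<partial>rleb d)" using D by simp
  also have "\<dots> \<le> (\<integral>\<^sup>+y. ennreal (exp (4 * pi * R\<^sup>2) * (1/2) ^ d) * (\<Prod>i<d. ennreal (n i (y i))) \<partial>rleb d)"
  proof (rule nn_integral_mono)
    fix y
    have "(1::real) \<le> exp (4 * pi * R\<^sup>2) * (1/2)^d * (\<Prod>i<d. n i (y i))" if y: "y \<in> D"
    proof -
      have "(\<Prod>i<d. n i (y i)) = 2 ^ d * exp (\<Sum>i<d. - (4 * pi * (y i - x i)\<^sup>2))"
        by (simp add: n prod.distrib exp_sum)
      also have "(\<Sum>i<d. - (4 * pi * (y i - x i)\<^sup>2)) = - (4 * pi * (edist d x y)\<^sup>2)"
        by (simp add: edist_sq sum_negf sum_distrib_left power2_commute)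
      finally have e: "exp (4 * pi * R\<^sup>2) * (1/2)^d * (\<Prod>i<d. n i (y i)) = exp (4 * pi * R\<^sup>2 - 4 * pi * (edist d x y)\<^sup>2)"
        by (simp add: power_divide exp_diff exp_minus field_simps)
      have "(edist d x y)\<^sup>2 \<le> R\<^sup>2" using R[OF y] by (intro power_mono) auto
      then show ?thesis unfolding e by simp
    qed
    then show "indicator D y \<le> ennreal (exp (4 * pi * R\<^sup>2) * (1/2) ^ d) * (\<Prod>i<d. ennreal (n i (y i)))"
      by (auto simp: indicator_def prod_ennreal n ennreal_mult''[symmetric] prod_nonneg)
  qed
  also have "\<dots> = ennreal (exp (4 * pi * R\<^sup>2) * (1/2) ^ d) * (\<integral>\<^sup>+y. (\<Prod>i<d. ennreal (n i (y i))) \<partial>rleb d)"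
    by (rule nn_integral_cmult) (simp add: n_def)
  also have "(\<integral>\<^sup>+y. (\<Prod>i<d. ennreal (n i (y i))) \<partial>rleb d) = (\<Prod>i<d. (\<integral>\<^sup>+t. ennreal (n i t) \<partial>lborel))"
    by (rule PL.product_nn_integral_prod) (auto simp: n_def)
  finally show ?thesis by (simp add: int)
qed

text \<open>
  For a continuous function the set where a bound fails is open, and nonempty open sets have positive measure; so a bound
  almost everywhere holds everywhere.
\<close>

lemma Linf_norm_pointwise:
  assumes D: "openin (rtop d) D" and h: "cont_on d D h" and x: "x \<in> D"
    and le: "Linf_norm d D h \<le> ereal c"
  shows "\<bar>h x\<bar> \<le> c"
proof (rule ccontr)
  assume n: "\<not> \<bar>h x\<bar> \<le> c"
  have D': "D \<in> sets (rleb d)" using D by (rule openin_imp_measurable)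
  have "AE y in restrict_space (rleb d) D. ereal \<bar>h y\<bar> \<le> Linf_norm d D h"
    unfolding Linf_norm_def by (rule esssup_AE)
  then have "AE y in restrict_space (rleb d) D. \<bar>h y\<bar> \<le> c"
    by eventually_elim (use le in \<open>meson ereal_less_eq(3) order_trans\<close>)
  then have AE: "AE y in rleb d. y \<in> D \<longrightarrow> \<bar>h y\<bar> \<le> c"
    using D' by (subst (asm) AE_restrict_space_iff) (auto simp: openin_Int_space[OF D] openin_Int_PiE[OF D])
  have "continuous_map (subtopology (rtop d) D) euclideanreal (\<lambda>y. \<bar>h y\<bar>)"
    using h unfolding cont_on_def by (rule continuous_map_real_abs)
  then have "openin (subtopology (rtop d) D) {y \<in> topspace (subtopology (rtop d) D). \<bar>h y\<bar> \<in> {c<..}}"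
    by (rule openin_continuous_map_preimage) auto
  then have op: "openin (rtop d) {y \<in> topspace (subtopology (rtop d) D). \<bar>h y\<bar> \<in> {c<..}}"
    using D by (meson openin_trans_full)
  have eq: "{y \<in> topspace (subtopology (rtop d) D). \<bar>h y\<bar> \<in> {c<..}} = {y \<in> space (rleb d). \<not> (y \<in> D \<longrightarrow> \<bar>h y\<bar> \<le> c)}"
    using openin_subset[OF D] by (auto simp: space_rleb)
  have "emeasure (rleb d) {y \<in> topspace (subtopology (rtop d) D). \<bar>h y\<bar> \<in> {c<..}} = 0"
    by (rule iffD1[OF AE_iff_measurable[OF openin_imp_measurable[OF op] eq[symmetric]] AE])
  moreover have "x \<in> {y \<in> topspace (subtopology (rtop d) D). \<bar>h y\<bar> \<in> {c<..}}"
    using n x openin_subset[OF D] by auto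
  ultimately show False using emeasure_open_pos[OF op] by force
qed

lemma Linf_norm_bounds_fun:
  assumes D: "openin (rtop d) D" and h: "cont_on d D h" and x: "x \<in> D"
    and bd: "\<And>y. y \<in> D \<Longrightarrow> \<bar>h y\<bar> \<le> B"
  shows "\<bar>h x\<bar> \<le> real_of_ereal (Linf_norm d D h)"
proof -
  let ?M = "restrict_space (rleb d) D"
  have m: "(\<lambda>x. ereal \<bar>h x\<bar>) \<in> borel_measurable ?M"
    using cont_on_measurable_restrict[OF D h] by measurable
  have D': "D \<in> sets (rleb d)" using D by (rule openin_imp_measurable)
  have sp: "space ?M = D"
    by (metis D Int_commute openin_Int_space space_restrict_space)
  have up: "Linf_norm d D h \<le> ereal B" unfolding Linf_norm_def
    by (rule esssup_I[OF m]) (use bd sp in auto)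
  have "0 \<le> Linf_norm d D h"
  proof -
    have "emeasure ?M (space ?M) > 0"
      using emeasure_open_pos[OF D x] D' sp
      by (simp add: emeasure_restrict_space openin_Int_space[OF D] openin_Int_PiE[OF D])
    then have "esssup ?M (\<lambda>x. 0::ereal) = 0" by (intro esssup_const) auto
    moreover have "esssup ?M (\<lambda>x. 0::ereal) \<le> Linf_norm d D h"
      unfolding Linf_norm_def by (rule esssup_mono) auto
    ultimately show ?thesis by simp
  qed
  with up have "Linf_norm d D h = ereal (real_of_ereal (Linf_norm d D h))"
    by (cases "Linf_norm d D h") auto
  then show ?thesis using Linf_norm_pointwise[OF D h x] by (metis order_refl)
qed

section \<open>A smoothing kernel on the line\<close>

text \<open>
  For \<open>n > k\<close> the power \<open>bump n\<close> is \<open>k\<close> times continuously differentiable on the line, which allows derivatives up to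
  the third of \<open>bump 4\<close> with a bounded last one.
\<close>

definition bump :: "nat \<Rightarrow> real \<Rightarrow> real" where
  "bump n t = (max 0 (1 - t\<^sup>2)) ^ n"

lemma bump_nonneg [simp]: "0 \<le> bump n t" by (simp add: bump_def)
lemma bump_zero: "1 \<le> \<bar>t\<bar> \<Longrightarrow> 0 < n \<Longrightarrow> bump n t = 0"
  using abs_le_square_iff[of 1 t] by (simp add: bump_def max_def)
lemma bump_le_1: "bump n t \<le> 1" unfolding bump_def by (intro power_le_one) auto
lemma bump_cont: "continuous_on S (bump n)" unfolding bump_def by (intro continuous_intros)

text \<open>
  The cases to the left and right of \<open>0\<close> are polynomial; at \<open>0\<close> Caratheodory's characterization applies.
\<close>

lemma DERIV_relu_power:
  "((\<lambda>t. (max 0 t) ^ Suc (Suc n)) has_real_derivative real (Suc (Suc n)) * (max 0 t) ^ Suc n) (at t)"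
proof -
  consider "t < 0" | "t = 0" | "t > 0" by linarith
  then show ?thesis
  proof cases
    case 1
    have "((\<lambda>t::real. 0) has_real_derivative 0) (at t)" by simp
    then have "((\<lambda>t. (max 0 t) ^ Suc (Suc n)) has_real_derivative 0) (at t)"
      by (rule has_field_derivative_transform_within_open[of _ _ _ "{..<0}"]) (use 1 in auto)
    then show ?thesis using 1 by simp
  next
    case 2
    have "\<exists>g. (\<forall>z. (max 0 z) ^ Suc (Suc n) - (max 0 (0::real)) ^ Suc (Suc n) = g z * (z - 0)) \<and> isCont g 0 \<and> g 0 = 0"
    proof (intro exI[of _ "\<lambda>z::real. (max 0 z) ^ Suc n"] conjI allI)
      fix z :: real
      show "(max 0 z) ^ Suc (Suc n) - (max 0 0) ^ Suc (Suc n) = (max 0 z) ^ Suc n * (z - 0)"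
        by (cases "0 \<le> z") (auto simp: max_def)
      show "isCont (\<lambda>z::real. (max 0 z) ^ Suc n) 0" by (intro continuous_intros)
    qed simp
    then have "((\<lambda>t::real. (max 0 t) ^ Suc (Suc n)) has_real_derivative 0) (at 0)"
      unfolding CARAT_DERIV .
    then show ?thesis using 2 by simp
  next
    case 3
    have "((\<lambda>t. t ^ Suc (Suc n)) has_real_derivative real (Suc (Suc n)) * t ^ Suc n) (at t)"
      using DERIV_pow[of "Suc (Suc n)" t UNIV] by (simp only: diff_Suc_Suc diff_zero)
    then have "((\<lambda>t. (max 0 t) ^ Suc (Suc n)) has_real_derivative real (Suc (Suc n)) * t ^ Suc n) (at t)"
      by (rule has_field_derivative_transform_within_open[of _ _ _ "{0<..}"]) (use 3 in auto)
    then show ?thesis using 3 by simp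
  qed
qed

lemma DERIV_bump:
  "(bump (Suc (Suc n)) has_real_derivative - (2 * real (Suc (Suc n))) * t * bump (Suc n) t) (at t)"
proof -
  have "((\<lambda>t. 1 - t\<^sup>2) has_real_derivative - 2 * t) (at t)"
    by (auto intro!: derivative_eq_intros)
  from DERIV_chain2[OF DERIV_relu_power this, of n]
  show ?thesis unfolding bump_def[abs_def] by (rule DERIV_cong) (simp only: mult_ac mult_minus_left mult_minus_right)
qed

text \<open>
  \<open>B1\<close>, \<open>B2\<close> and \<open>B3\<close> are the successive derivatives of the kernel \<open>B0\<close>.
\<close>

definition B0 :: "real \<Rightarrow> real" where "B0 = bump 4"
definition B1 :: "real \<Rightarrow> real" where "B1 t = - 8 * t * bump 3 t"
definition B2 :: "real \<Rightarrow> real" where "B2 t = 48 * t\<^sup>2 * bump 2 t - 8 * bump 3 t"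
definition B3 :: "real \<Rightarrow> real" where "B3 t = 144 * t * bump 2 t - 192 * t ^ 3 * bump 1 t"

lemma DERIV_B0: "(B0 has_real_derivative B1 t) (at t)"
  using DERIV_bump[of 2 t] by (simp add: B0_def B1_def numeral_eq_Suc)

lemma DERIV_B1: "(B1 has_real_derivative B2 t) (at t)"
proof -
  have "(bump 3 has_real_derivative - 6 * t * bump 2 t) (at t)"
    using DERIV_bump[of 1 t] by (simp add: numeral_eq_Suc)
  then show ?thesis unfolding B1_def[abs_def] B2_def
    by (auto intro!: derivative_eq_intros simp: power2_eq_square)
qed

lemma DERIV_B2: "(B2 has_real_derivative B3 t) (at t)"
proof -
  have 3: "(bump 3 has_real_derivative - 6 * t * bump 2 t) (at t)"
    using DERIV_bump[of 1 t] by (simp add: numeral_eq_Suc)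
  have 2: "(bump 2 has_real_derivative - 4 * t * bump 1 t) (at t)"
    using DERIV_bump[of 0 t] by (simp add: numeral_eq_Suc)
  show ?thesis unfolding B2_def[abs_def] B3_def
    by (rule derivative_eq_intros 2 3 refl | simp)+ (simp add: power2_eq_square power3_eq_cube algebra_simps)
qed

lemma B3_bound: "\<bar>B3 t\<bar> \<le> 336"
proof (cases "1 \<le> \<bar>t\<bar>")
  case True then show ?thesis by (simp add: B3_def bump_zero)
next
  case False
  then have t: "\<bar>t\<bar> \<le> 1" by simp
  have "\<bar>144 * t * bump 2 t\<bar> \<le> 144 * 1 * 1"
    unfolding abs_mult using t bump_le_1[of 2 t] by (intro mult_mono) auto
  moreover have "\<bar>192 * t ^ 3 * bump 1 t\<bar> \<le> 192 * 1 * 1"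
    unfolding abs_mult power_abs using t bump_le_1[of 1 t] by (intro mult_mono power_le_one) auto
  ultimately show ?thesis unfolding B3_def by linarith
qed

lemma B0_taylor: "\<bar>B0 (t + s) - B0 t - s * B1 t - s\<^sup>2 / 2 * B2 t\<bar> \<le> 56 * \<bar>s\<bar> ^ 3"
proof (cases "s = 0")
  case False
  define df where "df = (\<lambda>m::nat. if m = 0 then B0 else if m = 1 then B1 else if m = 2 then B2 else B3)"
  have "\<exists>z. (if t + s < t then t + s < z \<and> z < t else t < z \<and> z < t + s) \<and>
      B0 (t + s) = (\<Sum>m<3. df m t / fact m * (t + s - t) ^ m) + df 3 z / fact 3 * (t + s - t) ^ 3"
  proof (rule Taylor[where a = "t - \<bar>s\<bar>" and b = "t + \<bar>s\<bar>"])
    show "\<forall>m z. m < 3 \<and> t - \<bar>s\<bar> \<le> z \<and> z \<le> t + \<bar>s\<bar> \<longrightarrow> (df m has_real_derivative df (Suc m) z) (at z)"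
      using DERIV_B0 DERIV_B1 DERIV_B2 by (auto simp: df_def less_Suc_eq numeral_eq_Suc)
  qed (use False in \<open>auto simp: df_def\<close>)
  then obtain z where "B0 (t + s) = (\<Sum>m<3. df m t / fact m * s ^ m) + B3 z / fact 3 * s ^ 3"
    by (auto simp: df_def)
  then have "B0 (t + s) - B0 t - s * B1 t - s\<^sup>2 / 2 * B2 t = B3 z / 6 * s ^ 3"
    by (simp add: df_def numeral_eq_Suc)
  also have "\<bar>\<dots>\<bar> \<le> 336 / 6 * \<bar>s\<bar> ^ 3"
    using B3_bound[of z] by (simp add: abs_mult power_abs mult_right_mono)
  finally show ?thesis by simp
qed simp

lemma has_integral_shift_right:
  fixes F :: "real \<Rightarrow> real"
  assumes "(F has_integral I) {a + c..b + c}"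
  shows "((\<lambda>t. F (t + c)) has_integral I) {a..b}"
proof -
  have "((\<lambda>x. F (1 *\<^sub>R x + c)) has_integral (1 / (\<bar>1\<bar> ^ DIM(real))) *\<^sub>R I)
      ((\<lambda>x. (1 / 1) *\<^sub>R x + -((1 / 1) *\<^sub>R c)) ` cbox (a + c) (b + c))"
    by (rule has_integral_affinity) (use assms in auto)
  moreover have "(\<lambda>x. (1 / 1) *\<^sub>R x + -((1 / 1) *\<^sub>R c)) ` cbox (a + c) (b + c) = {a..b}"
    by (auto simp: image_def intro!: bexI[of _ "_ + c"])
  ultimately show ?thesis by simp
qed

text \<open>
  After a shift in the first two terms and two integrations by parts in the last one, the integral is that of \<open>\<phi>\<close>
  against the second difference of the kernel minus \<open>s\<^sup>2\<close> times its second derivative. The latter is of order \<open>s ^ 3\<close>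
  by Taylor's formula, so no regularity of \<open>\<phi>\<close> beyond its bound enters the constant.
\<close>

lemma second_difference_kernel_bound:
  fixes \<phi> \<phi>1 \<phi>2 :: "real \<Rightarrow> real"
  assumes s: "0 \<le> s" "s \<le> 1"
    and cont: "continuous_on {-1 - s..1 + s} \<phi>"
    and d1: "\<And>t. t \<in> {-1..1} \<Longrightarrow> (\<phi> has_real_derivative \<phi>1 t) (at t)"
    and d2: "\<And>t. t \<in> {-1..1} \<Longrightarrow> (\<phi>1 has_real_derivative \<phi>2 t) (at t)"
    and cont2: "continuous_on {-1..1} \<phi>2"
    and bd: "\<And>t. t \<in> {-1 - s..1 + s} \<Longrightarrow> \<bar>\<phi> t\<bar> \<le> U"
  shows "\<bar>integral {-1..1} (\<lambda>t. (\<phi> (t + s) + \<phi> (t - s) - 2 * \<phi> t - s\<^sup>2 * \<phi>2 t) * B0 t)\<bar> \<le> 448 * U * s ^ 3"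
proof -
  let ?J = "{-1 - s..1 + s}"
  have B0c: "continuous_on S B0" for S unfolding B0_def by (rule bump_cont)
  have B2c: "continuous_on S B2" for S unfolding B2_def[abs_def] by (intro continuous_intros bump_cont)
  have B0z: "1 \<le> \<bar>t\<bar> \<Longrightarrow> B0 t = 0" for t by (simp add: B0_def bump_zero)
  have shifted: "((\<lambda>t. \<phi> (t + c) * B0 t) has_integral integral ?J (\<lambda>t. \<phi> t * B0 (t - c))) {-1..1}"
    if c: "\<bar>c\<bar> \<le> s" for c
  proof -
    have cc: "continuous_on ?J (\<lambda>t. \<phi> t * B0 (t - c))"
      by (intro continuous_intros cont continuous_on_compose2[OF B0c[of UNIV]]) auto
    have sub: "{-1 + c..1 + c} \<subseteq> ?J" using c by auto
    have "(\<lambda>t. \<phi> t * B0 (t - c)) integrable_on {-1 + c..1 + c}"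
      by (rule integrable_continuous_real) (rule continuous_on_subset[OF cc sub])
    then obtain I where I: "((\<lambda>t. \<phi> t * B0 (t - c)) has_integral I) {-1 + c..1 + c}" by blast
    have "((\<lambda>t. \<phi> t * B0 (t - c)) has_integral I) ?J"
      by (rule has_integral_on_superset[OF I _ sub]) (auto intro!: B0z)
    then have "I = integral ?J (\<lambda>t. \<phi> t * B0 (t - c))" by (simp add: integral_unique)
    with has_integral_shift_right[OF I] show ?thesis by simp
  qed
  have sup0: "((\<lambda>t. \<phi> t * B0 t) has_integral integral ?J (\<lambda>t. \<phi> t * B0 t)) {-1..1}"
    using shifted[of 0] s by simp
  have second: "((\<lambda>t. \<phi>2 t * B0 t) has_integral integral ?J (\<lambda>t. \<phi> t * B2 t)) {-1..1}"
  proof -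
    have c1: "continuous_on {-1..1} (\<lambda>t. \<phi> t * B2 t)"
      by (intro continuous_intros B2c continuous_on_subset[OF cont]) (use s in auto)
    then have "(\<lambda>t. \<phi> t * B2 t) integrable_on {-1..1}" by (rule integrable_continuous_real)
    then obtain I where I: "((\<lambda>t. \<phi> t * B2 t) has_integral I) {-1..1}" by blast
    have "((\<lambda>t. \<phi>2 t * B0 t - \<phi> t * B2 t) has_integral
        ((\<phi>1 1 * B0 1 - \<phi> 1 * B1 1) - (\<phi>1 (-1) * B0 (-1) - \<phi> (-1) * B1 (-1)))) {-1..1}"
    proof (rule fundamental_theorem_of_calculus)
      fix t :: real assume t: "t \<in> {-1..1}"
      have "((\<lambda>t. \<phi>1 t * B0 t - \<phi> t * B1 t) has_real_derivative
          (\<phi>1 t * B1 t + \<phi>2 t * B0 t) - (\<phi> t * B2 t + \<phi>1 t * B1 t)) (at t)"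
        by (intro DERIV_diff DERIV_mult' d1 d2 DERIV_B0 DERIV_B1 t)
      then have "((\<lambda>t. \<phi>1 t * B0 t - \<phi> t * B1 t) has_real_derivative (\<phi>2 t * B0 t - \<phi> t * B2 t)) (at t)"
        by (rule DERIV_cong) simp
      then show "((\<lambda>t. \<phi>1 t * B0 t - \<phi> t * B1 t) has_vector_derivative \<phi>2 t * B0 t - \<phi> t * B2 t) (at t within {-1..1})"
        by (simp add: has_real_derivative_iff_has_vector_derivative has_vector_derivative_at_within)
    qed simp
    moreover have "B0 1 = 0" "B0 (-1) = 0" "B1 1 = 0" "B1 (-1) = 0"
      by (simp_all add: B0_def B1_def bump_zero)
    ultimately have "((\<lambda>t. \<phi>2 t * B0 t - \<phi> t * B2 t) has_integral 0) {-1..1}" by simp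
    from has_integral_add[OF this I] have A: "((\<lambda>t. \<phi>2 t * B0 t) has_integral I) {-1..1}" by simp
    have "((\<lambda>t. \<phi> t * B2 t) has_integral I) ?J"
      by (rule has_integral_on_superset[OF I]) (use s in \<open>auto simp: B2_def bump_zero\<close>)
    then have "I = integral ?J (\<lambda>t. \<phi> t * B2 t)" by (simp add: integral_unique)
    with A show ?thesis by simp
  qed
  let ?G = "\<lambda>t. \<phi> t * (B0 (t - s) + B0 (t + s) - 2 * B0 t - s\<^sup>2 * B2 t)"
  have int: "(\<lambda>t. \<phi> t * b t) integrable_on ?J" if "continuous_on ?J b" for b
    by (intro integrable_continuous_real continuous_intros cont that)
  have i1: "(\<lambda>t. \<phi> t * B0 (t - s)) integrable_on ?J" "(\<lambda>t. \<phi> t * B0 (t + s)) integrable_on ?J"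
    "(\<lambda>t. \<phi> t * B0 t) integrable_on ?J" "(\<lambda>t. \<phi> t * B2 t) integrable_on ?J"
    by (intro int B0c B2c continuous_intros continuous_on_compose2[OF B0c[of UNIV]]; simp)+
  have "integral {-1..1} (\<lambda>t. (\<phi> (t + s) + \<phi> (t - s) - 2 * \<phi> t - s\<^sup>2 * \<phi>2 t) * B0 t)
      = integral ?J (\<lambda>t. \<phi> t * B0 (t - s)) + integral ?J (\<lambda>t. \<phi> t * B0 (t + s))
        - 2 * integral ?J (\<lambda>t. \<phi> t * B0 t) - s\<^sup>2 * integral ?J (\<lambda>t. \<phi> t * B2 t)"
  proof (rule integral_unique)
    have "((\<lambda>t. \<phi> (t + s) * B0 t + \<phi> (t + (- s)) * B0 t - 2 * (\<phi> t * B0 t) - s\<^sup>2 * (\<phi>2 t * B0 t)) has_integral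
      integral ?J (\<lambda>t. \<phi> t * B0 (t - s)) + integral ?J (\<lambda>t. \<phi> t * B0 (t - (- s)))
        - 2 * integral ?J (\<lambda>t. \<phi> t * B0 t) - s\<^sup>2 * integral ?J (\<lambda>t. \<phi> t * B2 t)) {-1..1}"
      using s by (intro has_integral_diff has_integral_add has_integral_mult_right shifted sup0 second) auto
    then show "((\<lambda>t. (\<phi> (t + s) + \<phi> (t - s) - 2 * \<phi> t - s\<^sup>2 * \<phi>2 t) * B0 t) has_integral
      integral ?J (\<lambda>t. \<phi> t * B0 (t - s)) + integral ?J (\<lambda>t. \<phi> t * B0 (t + s))
        - 2 * integral ?J (\<lambda>t. \<phi> t * B0 t) - s\<^sup>2 * integral ?J (\<lambda>t. \<phi> t * B2 t)) {-1..1}"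
      by (simp add: algebra_simps)
  qed
  also have "\<dots> = integral ?J ?G"
  proof (rule integral_unique[symmetric])
    have "((\<lambda>t. \<phi> t * B0 (t - s) + \<phi> t * B0 (t + s) - 2 * (\<phi> t * B0 t) - s\<^sup>2 * (\<phi> t * B2 t)) has_integral
      integral ?J (\<lambda>t. \<phi> t * B0 (t - s)) + integral ?J (\<lambda>t. \<phi> t * B0 (t + s))
        - 2 * integral ?J (\<lambda>t. \<phi> t * B0 t) - s\<^sup>2 * integral ?J (\<lambda>t. \<phi> t * B2 t)) ?J"
      by (intro has_integral_diff has_integral_add has_integral_mult_right integrable_integral i1)
    then show "(?G has_integral
      integral ?J (\<lambda>t. \<phi> t * B0 (t - s)) + integral ?J (\<lambda>t. \<phi> t * B0 (t + s))
        - 2 * integral ?J (\<lambda>t. \<phi> t * B0 t) - s\<^sup>2 * integral ?J (\<lambda>t. \<phi> t * B2 t)) ?J"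
      by (simp add: algebra_simps)
  qed
  finally have eq: "integral {-1..1} (\<lambda>t. (\<phi> (t + s) + \<phi> (t - s) - 2 * \<phi> t - s\<^sup>2 * \<phi>2 t) * B0 t) = integral ?J ?G" .
  have U: "0 \<le> U" using bd[of 0] s by auto
  have G: "norm (?G t) \<le> U * (112 * s ^ 3)" if t: "t \<in> cbox (-1 - s) (1 + s)" for t
  proof -
    have "B0 (t - s) + B0 (t + s) - 2 * B0 t - s\<^sup>2 * B2 t =
      (B0 (t + s) - B0 t - s * B1 t - s\<^sup>2 / 2 * B2 t) + (B0 (t + (- s)) - B0 t - (- s) * B1 t - (- s)\<^sup>2 / 2 * B2 t)"
      by simp
    also have "\<bar>\<dots>\<bar> \<le> 56 * \<bar>s\<bar> ^ 3 + 56 * \<bar>- s\<bar> ^ 3"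
      using B0_taylor[of t s] B0_taylor[of t "- s"] by linarith
    finally have "\<bar>B0 (t - s) + B0 (t + s) - 2 * B0 t - s\<^sup>2 * B2 t\<bar> \<le> 112 * s ^ 3" using s by simp
    then show ?thesis using bd[of t] t U by (simp add: abs_mult mult_mono)
  qed
  have "?G integrable_on ?J"
    by (intro int continuous_intros B0c B2c continuous_on_compose2[OF B0c[of UNIV]]) auto
  then have "(?G has_integral integral ?J ?G) (cbox (-1 - s) (1 + s))" by (simp add: integrable_integral)
  from has_integral_bound[OF _ this G] U s
  have "\<bar>integral ?J ?G\<bar> \<le> U * (112 * s ^ 3) * measure lborel (cbox (-1 - s) (1 + s))" by simp
  also have "measure lborel (cbox (-1 - s) (1 + s)) = 2 + 2 * s" using s by simp
  also have "U * (112 * s ^ 3) * (2 + 2 * s) \<le> U * (112 * s ^ 3) * 4" using s U by (intro mult_left_mono) auto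
  finally show ?thesis unfolding eq by simp
qed


section \<open>Mollification\<close>

definition kmass :: real where "kmass = integral {-1..1} B0"

lemma B0_cont: "continuous_on S B0" unfolding B0_def by (rule bump_cont)
lemma B0_nonneg [simp]: "0 \<le> B0 t" by (simp add: B0_def)

lemma kmass_pos: "0 < kmass"
proof -
  have "0 \<le> kmass" unfolding kmass_def
    by (intro integral_nonneg integrable_continuous_real B0_cont) simp
  moreover have "kmass \<noteq> 0"
  proof
    assume "kmass = 0"
    then have "\<forall>t\<in>{-1..1}. B0 t = 0"
      unfolding kmass_def using integral_eq_0_iff[of "-1" 1 B0] B0_cont by simp
    then have "B0 0 = 0" by simp
    then show False by (simp add: B0_def bump_def)
  qed
  ultimately show ?thesis by simp
qed

definition kern :: "real measure" where "kern = density lborel (\<lambda>t. ennreal (B0 t / kmass))"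

lemma B0_measurable [measurable]: "B0 \<in> borel_measurable borel"
  using B0_cont by (rule borel_measurable_continuous_onI)

lemma sets_kern [simp, measurable_cong]: "sets kern = sets borel" by (simp add: kern_def)
lemma space_kern [simp]: "space kern = UNIV" by (simp add: kern_def)

lemma kern_integral:
  assumes H: "continuous_on {-1..1} H"
  shows "(\<integral>t. indicator {-1..1} t * H t \<partial>kern) = integral {-1..1} (\<lambda>t. H t * B0 t) / kmass"
proof -
  have m: "(\<lambda>t. indicator {-1..1} t * H t) \<in> borel_measurable lborel"
    using borel_measurable_continuous_on_indicator[OF _ H] by simp
  have "(\<integral>t. indicator {-1..1} t * H t \<partial>kern) = (\<integral>t. (B0 t / kmass) *\<^sub>R (indicator {-1..1} t * H t) \<partial>lborel)"
    unfolding kern_def by (rule integral_density[OF m]) (use kmass_pos in auto)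
  also have "\<dots> = (\<integral>t. indicator {-1..1} t *\<^sub>R (H t * B0 t) / kmass \<partial>lborel)"
    by (simp add: mult_ac)
  also have "\<dots> = (LINT t:{-1..1}|lborel. H t * B0 t) / kmass"
    unfolding set_lebesgue_integral_def by simp
  also have "(LINT t:{-1..1}|lborel. H t * B0 t) = integral {-1..1} (\<lambda>t. H t * B0 t)"
    by (intro set_borel_integral_eq_integral borel_integrable_atLeastAtMost' continuous_intros H B0_cont)
  finally show ?thesis .
qed

lemma emeasure_kern: "emeasure kern {-1..1} = 1" and prob_kern: "prob_space kern"
proof -
  have z: "B0 t = indicator {-1..1} t * B0 t" for t
  proof (cases "t \<in> {-1..1}")
    case False
    then have "1 \<le> \<bar>t\<bar>" by auto
    then show ?thesis by (simp add: B0_def bump_zero)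
  qed simp
  have si: "set_integrable lborel {-1..1} B0" by (intro borel_integrable_atLeastAtMost' B0_cont)
  have i: "integrable lborel B0" using si unfolding set_integrable_def real_scaleR_def z[symmetric] .
  have "integral\<^sup>L lborel B0 = (LINT t:{-1..1}|lborel. B0 t)" unfolding set_lebesgue_integral_def real_scaleR_def z[symmetric] ..
  also have "\<dots> = kmass" unfolding kmass_def by (rule set_borel_integral_eq_integral[OF si])
  finally have I: "integral\<^sup>L lborel B0 = kmass" .
  have n: "(\<integral>\<^sup>+t. ennreal (B0 t / kmass) \<partial>lborel) = 1"
    by (subst nn_integral_eq_integral) (use i I kmass_pos in auto)
  then show "prob_space kern" by (intro prob_spaceI) (simp add: kern_def emeasure_density)
  have "emeasure kern {-1..1} = (\<integral>\<^sup>+t. ennreal (B0 t / kmass) * indicator {-1..1} t \<partial>lborel)"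
    by (simp add: kern_def emeasure_density)
  also have "\<dots> = (\<integral>\<^sup>+t. ennreal (B0 t / kmass) \<partial>lborel)"
  proof (rule nn_integral_cong)
    fix t show "ennreal (B0 t / kmass) * indicator {-1..1} t = ennreal (B0 t / kmass)"
      using z[of t] by (cases "t \<in> {-1..1}") auto
  qed
  finally show "emeasure kern {-1..1} = 1" using n by simp
qed

interpretation PK: product_sigma_finite "\<lambda>_::nat. kern"
  by (intro product_sigma_finite.intro prob_space_imp_sigma_finite prob_kern)

abbreviation Pk :: "nat \<Rightarrow> point measure" where "Pk d \<equiv> Pi\<^sub>M {..<d} (\<lambda>_. kern)"

definition cube :: "nat \<Rightarrow> point set" where "cube d = PiE {..<d} (\<lambda>_. {-1..1})"

definition zoom :: "nat \<Rightarrow> real \<Rightarrow> point \<Rightarrow> point \<Rightarrow> point" where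
  "zoom d h x y = (\<lambda>i\<in>{..<d}. x i + h * y i)"

text \<open>
  The mean of \<open>v (x + h * y)\<close> for \<open>y\<close> distributed according to the product kernel. The indicator is \<open>1\<close> almost surely; it
  makes the integrand vanish off the cube, where \<open>v\<close> is not controlled.
\<close>

definition mollify :: "nat \<Rightarrow> real \<Rightarrow> (point \<Rightarrow> real) \<Rightarrow> point \<Rightarrow> real" where
  "mollify d h v x = (\<integral>y. indicator (cube d) y * v (zoom d h x y) \<partial>Pk d)"

lemma prob_Pk: "prob_space (Pk d)" by (intro prob_space_PiM prob_kern)

lemma cube_sets [measurable]: "cube d \<in> sets (Pk d)"
  unfolding cube_def by (intro sets_PiM_I_finite) auto

lemma measure_cube: "measure (Pk d) (cube d) = 1"
  unfolding cube_def measure_def by (subst PK.emeasure_PiM) (auto simp: emeasure_kern)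

lemma zoom_in_space: "zoom d h x y \<in> topspace (rtop d)"
  by (simp add: zoom_def topspace_rtop)

lemma zoom_measurable: "zoom d h x \<in> measurable (Pk d) (rleb d)"
  unfolding zoom_def by (intro measurable_restrict) (simp add: measurable_lborel1, measurable)

lemma edist_zoom:
  assumes y: "y \<in> cube d" and h: "0 \<le> h"
  shows "edist d x (zoom d h x y) \<le> real d * h"
proof -
  have "edist d x (zoom d h x y) \<le> (\<Sum>i<d. \<bar>x i - zoom d h x y i\<bar>)" by (rule edist_le_sum)
  also have "\<dots> \<le> (\<Sum>i<d. h)"
  proof (rule sum_mono)
    fix i assume i: "i \<in> {..<d}"
    then have "\<bar>y i\<bar> \<le> 1" using y by (auto simp: cube_def PiE_iff abs_le_iff)
    then have "h * \<bar>y i\<bar> \<le> h" using h by (simp add: mult_left_le)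
    then show "\<bar>x i - zoom d h x y i\<bar> \<le> h" using i h by (simp add: zoom_def abs_mult)
  qed
  finally show ?thesis by simp
qed

definition ecball :: "nat \<Rightarrow> point \<Rightarrow> real \<Rightarrow> point set" where
  "ecball d x c = {z \<in> topspace (rtop d). edist d x z \<le> c}"

lemma compactin_ecball: "compactin (rtop d) (ecball d x c)"
proof -
  have b: "ebounded d (ecball d x c)" unfolding ebounded_def
  proof (intro exI[of _ "2 * c"] ballI)
    fix y z assume "y \<in> ecball d x c" "z \<in> ecball d x c"
    then show "edist d y z \<le> 2 * c"
      using edist_triangle[of d y z x] edist_commute[of d x y] by (simp add: ecball_def)
  qed
  have "rtop d closure_of ecball d x c \<subseteq> ecball d x c"
  proof
    fix z assume z: "z \<in> rtop d closure_of ecball d x c"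
    have "edist d x z \<le> c"
    proof (rule field_le_epsilon)
      fix e :: real assume "0 < e"
      then obtain w where "w \<in> ecball d x c" "edist d z w < e"
        using z unfolding closure_of_rtop_iff by blast
      then show "edist d x z \<le> c + e"
        using edist_triangle[of d x z w] edist_commute[of d z w] by (simp add: ecball_def)
    qed
    then show "z \<in> ecball d x c" using z closure_of_subset_topspace[of "rtop d"] by (auto simp: ecball_def)
  qed
  moreover have "ecball d x c \<subseteq> rtop d closure_of ecball d x c"
    by (rule closure_of_subset) (auto simp: ecball_def)
  ultimately have "rtop d closure_of ecball d x c = ecball d x c" by blast
  then show ?thesis using compactin_closure[OF b] by simp
qed

lemma zoom_cube_ecball: "y \<in> cube d \<Longrightarrow> 0 \<le> h \<Longrightarrow> zoom d h x y \<in> ecball d x (real d * h)"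
  by (simp add: ecball_def zoom_in_space edist_zoom)

text \<open>
  On the compact set of arguments a continuous function is bounded.
\<close>

lemma mollify_integrand:
  assumes D: "openin (rtop d) D" and v: "cont_on d D v"
    and h: "0 \<le> h" and ball: "ecball d x (real d * h) \<subseteq> D"
  shows "integrable (Pk d) (\<lambda>y. indicator (cube d) y * v (zoom d h x y))"
proof -
  have eq: "indicator (cube d) y * v (zoom d h x y) = indicator (cube d) y * (indicator D (zoom d h x y) *\<^sub>R v (zoom d h x y))" for y
    using zoom_cube_ecball[OF _ h, of y d x] ball by (auto simp: indicator_def)
  have "(\<lambda>z. indicator D z *\<^sub>R v z) \<in> borel_measurable (rleb d)"
    using cont_on_set_measurable[OF D v] by (simp add: set_borel_measurable_def)
  from measurable_compose[OF zoom_measurable[of d h x] this]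
  have m: "(\<lambda>y. indicator (cube d) y * v (zoom d h x y)) \<in> borel_measurable (Pk d)"
    unfolding eq by measurable
  obtain B where B: "B \<ge> 0" "\<And>z. z \<in> ecball d x (real d * h) \<Longrightarrow> \<bar>v z\<bar> \<le> B"
    using compact_bounded_fun[OF compactin_ecball cont_on_subset[OF v ball]] by blast
  interpret prob_space "Pk d" by (rule prob_Pk)
  show ?thesis
  proof (rule integrable_const_bound[OF _ m])
    show "AE y in Pk d. norm (indicator (cube d) y * v (zoom d h x y)) \<le> B"
      using B zoom_cube_ecball[OF _ h, of _ d x] by (intro AE_I2) (auto simp: indicator_def)
  qed
qed

lemma (in prob_space) abs_integral_le:
  assumes "\<And>x. x \<in> space M \<Longrightarrow> \<bar>f x\<bar> \<le> c" and c: "0 \<le> c"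
  shows "\<bar>\<integral>x. f x \<partial>M\<bar> \<le> (c::real)"
proof (cases "integrable M f")
  case True
  have "\<bar>\<integral>x. f x \<partial>M\<bar> \<le> (\<integral>x. \<bar>f x\<bar> \<partial>M)" by (rule integral_abs_bound)
  also have "\<dots> \<le> c" by (rule integral_le_const) (use True assms in auto)
  finally show ?thesis .
qed (simp add: not_integrable_integral_eq c)

lemma mollify_close:
  assumes D: "openin (rtop d) D" and v: "cont_on d D v"
    and h: "0 \<le> h" and ball: "ecball d x (real d * h) \<subseteq> D"
    and lip: "\<And>z. z \<in> ecball d x (real d * h) \<Longrightarrow> \<bar>v z - a\<bar> \<le> c" and c: "0 \<le> c"
  shows "\<bar>mollify d h v x - a\<bar> \<le> c"
proof -
  interpret prob_space "Pk d" by (rule prob_Pk)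
  have i: "integrable (Pk d) (\<lambda>y. indicator (cube d) y * a)"
    by (intro integrable_mult_left integrable_real_indicator) (auto simp: emeasure_eq_measure)
  have "mollify d h v x - a = mollify d h v x - (\<integral>y. indicator (cube d) y * a \<partial>Pk d)"
    using measure_cube[of d] by simp
  also have "\<dots> = (\<integral>y. indicator (cube d) y * v (zoom d h x y) - indicator (cube d) y * a \<partial>Pk d)"
    unfolding mollify_def by (rule Bochner_Integration.integral_diff[symmetric, OF mollify_integrand[OF D v h ball] i])
  also have "\<bar>\<dots>\<bar> \<le> c"
    by (rule abs_integral_le) (use lip zoom_cube_ecball[OF _ h] c in \<open>auto simp: indicator_def\<close>)
  finally show ?thesis .
qed

text \<open>
  Fubini's theorem, with the coordinate \<open>i\<close> integrated first.
\<close>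

lemma slice_bound:
  fixes G :: "point \<Rightarrow> real"
  assumes i: "i < d" and int: "integrable (Pk d) (\<lambda>y. indicator (cube d) y * G y)" and c: "0 \<le> c"
    and slice: "\<And>y. y \<in> cube d \<Longrightarrow> \<bar>\<integral>t. indicator {-1..1} t * G (y(i := t)) \<partial>kern\<bar> \<le> c"
  shows "\<bar>\<integral>y. indicator (cube d) y * G y \<partial>Pk d\<bar> \<le> c"
proof -
  let ?I = "{..<d} - {i}"
  have ins: "insert i ?I = {..<d}" using i by auto
  have "(\<integral>y. indicator (cube d) y * G y \<partial>Pi\<^sub>M (insert i ?I) (\<lambda>_. kern)) =
      (\<integral>y. (\<integral>t. indicator (cube d) (y(i := t)) * G (y(i := t)) \<partial>kern) \<partial>Pi\<^sub>M ?I (\<lambda>_. kern))"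
    using PK.product_integral_insert[of ?I i "\<lambda>y. indicator (cube d) y * G y"] int ins by simp
  also have "\<bar>\<dots>\<bar> \<le> c"
  proof (rule prob_space.abs_integral_le[OF prob_space_PiM[OF prob_kern]])
    fix y assume y: "y \<in> space (Pi\<^sub>M ?I (\<lambda>_. kern))"
    show "\<bar>\<integral>t. indicator (cube d) (y(i := t)) * G (y(i := t)) \<partial>kern\<bar> \<le> c"
    proof (cases "y \<in> PiE ?I (\<lambda>_. {-1..1})")
      case True
      have "y(i := 0) \<in> cube d" using True i by (auto simp: cube_def PiE_iff extensional_def)
      moreover have "indicator (cube d) (y(i := t)) = (indicator {-1..1} t :: real)" for t
        using True i by (auto simp: indicator_def cube_def PiE_iff extensional_def)
      ultimately show ?thesis using slice[of "y(i := 0)"] by simp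
    next
      case False
      then have "y(i := t) \<notin> cube d" for t
        using y by (auto simp: cube_def PiE_iff extensional_def space_PiM split: if_splits)
      then show ?thesis using c by simp
    qed
  qed (use c in auto)
  finally show ?thesis unfolding ins .
qed

definition CK :: real where "CK = 448 / kmass"
lemma CK0: "0 < CK" using kmass_pos by (simp add: CK_def)

lemma cont_on_line:
  assumes w: "cont_on d D w" and D: "D \<subseteq> topspace (rtop d)" and i: "i < d"
    and sub: "\<And>s. s \<in> S \<Longrightarrow> z(i := \<alpha> + \<beta> * s) \<in> D"
  shows "continuous_on S (\<lambda>s. w (z(i := \<alpha> + \<beta> * s)))"
  unfolding continuous_on_iff
proof (intro ballI allI impI)
  fix s and e :: real assume s: "s \<in> S" and e: "0 < e"
  obtain r where r: "r > 0" "\<And>y. y \<in> D \<Longrightarrow> edist d (z(i := \<alpha> + \<beta> * s)) y < r \<Longrightarrow> \<bar>w y - w (z(i := \<alpha> + \<beta> * s))\<bar> < e"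
    using w sub[OF s] e unfolding cont_on_iff[OF D] by blast
  show "\<exists>r>0. \<forall>s'\<in>S. dist s' s < r \<longrightarrow> dist (w (z(i := \<alpha> + \<beta> * s'))) (w (z(i := \<alpha> + \<beta> * s))) < e"
  proof (intro exI[of _ "r / (\<bar>\<beta>\<bar> + 1)"] conjI ballI impI)
    show "0 < r / (\<bar>\<beta>\<bar> + 1)" using r by simp
    fix s' assume s': "s' \<in> S" "dist s' s < r / (\<bar>\<beta>\<bar> + 1)"
    have "edist d (z(i := \<alpha> + \<beta> * s)) ((z(i := \<alpha> + \<beta> * s))(i := \<alpha> + \<beta> * s')) = \<bar>\<beta>\<bar> * dist s' s"
      by (subst edist_fun_upd[OF i]) (simp add: dist_real_def abs_mult[symmetric] algebra_simps abs_minus_commute)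
    also have "\<dots> \<le> (\<bar>\<beta>\<bar> + 1) * dist s' s" by (intro mult_right_mono) auto
    also have "\<dots> < r" using s'(2) by (simp add: pos_less_divide_eq mult.commute)
    finally show "dist (w (z(i := \<alpha> + \<beta> * s'))) (w (z(i := \<alpha> + \<beta> * s))) < e"
      using r(2)[OF sub[OF s'(1)]] by (simp add: dist_real_def)
  qed
qed

context poisson_problem begin

text \<open>
  For fixed other coordinates the integrand in the coordinate \<open>i\<close> is the expression of
  \<open>second_difference_kernel_bound\<close> with step \<open>r / h\<close> for the function \<open>t \<mapsto> u (x + h * t * e\<^sub>i)\<close>.
\<close>

lemma mollify_stencil_coord:
  assumes x: "x \<in> D" and h: "0 < h" and r: "0 \<le> r" "r \<le> h"
    and ball: "ecball d x (real d * h + r) \<subseteq> D" and i: "i < d"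
  shows "\<bar>mollify d h u (x(i := x i + r)) + mollify d h u (x(i := x i - r)) - 2 * mollify d h u x
      - r\<^sup>2 * mollify d h (partial i (partial i u)) x\<bar> \<le> CK * U0 * (r / h) ^ 3"
proof -
  let ?w = "partial i (partial i u)"
  have xs: "x \<in> topspace (rtop d)" using D_space[OF x] .
  have uc: "cont_on d D u" using u_C2 unfolding C2_on_def by blast
  have wc: "cont_on d D ?w" using u_C2 i unfolding C2_on_def by blast
  have ballx: "ecball d (x(i := x i + s)) (real d * h) \<subseteq> D" if s: "\<bar>s\<bar> \<le> r" for s
  proof
    fix z assume z: "z \<in> ecball d (x(i := x i + s)) (real d * h)"
    have "edist d x z \<le> edist d x (x(i := x i + s)) + edist d (x(i := x i + s)) z" by (rule edist_triangle)
    also have "\<dots> \<le> real d * h + r" using z s edist_fun_upd[OF i, of x "x i + s"] by (simp add: ecball_def)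
    finally show "z \<in> D" using ball z by (auto simp: ecball_def)
  qed
  have b0: "ecball d x (real d * h) \<subseteq> D" using ballx[of 0] r by simp
  have h0: "0 \<le> h" using h by simp
  let ?u = "\<lambda>s y. u (zoom d h (x(i := x i + s)) y)"
  define \<sigma> where "\<sigma> = r / h"
  have \<sigma>: "0 \<le> \<sigma>" "\<sigma> \<le> 1" using r h by (auto simp: \<sigma>_def)
  have h\<sigma>: "h * \<sigma> = r" using h by (simp add: \<sigma>_def)
  define G where "G = (\<lambda>y. ?u r y + ?u (- r) y - 2 * u (zoom d h x y) - r\<^sup>2 * ?w (zoom d h x y))"
  have int_u: "integrable (Pk d) (\<lambda>y. indicator (cube d) y * ?u s y)" if "\<bar>s\<bar> \<le> r" for s
    by (rule mollify_integrand[OF open_D uc h0 ballx[OF that]])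
  have int_0: "integrable (Pk d) (\<lambda>y. indicator (cube d) y * u (zoom d h x y))"
    using int_u[of 0] r by simp
  have int_w: "integrable (Pk d) (\<lambda>y. indicator (cube d) y * ?w (zoom d h x y))"
    by (rule mollify_integrand[OF open_D wc h0 b0])
  have split: "indicator (cube d) y * G y = indicator (cube d) y * ?u r y + indicator (cube d) y * ?u (- r) y
      - 2 * (indicator (cube d) y * u (zoom d h x y)) - r\<^sup>2 * (indicator (cube d) y * ?w (zoom d h x y))" for y
    by (simp add: G_def algebra_simps)
  have intG: "integrable (Pk d) (\<lambda>y. indicator (cube d) y * G y)"
    unfolding split using int_u[of r] int_u[of "- r"] int_0 int_w r
    by (intro Bochner_Integration.integrable_add Bochner_Integration.integrable_diff integrable_mult_right) auto
  have "mollify d h u (x(i := x i + r)) + mollify d h u (x(i := x i - r)) - 2 * mollify d h u x - r\<^sup>2 * mollify d h ?w x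
      = (\<integral>y. indicator (cube d) y * G y \<partial>Pk d)"
    unfolding mollify_def split using int_u[of r] int_u[of "- r"] int_0 int_w r
    by (simp add: Bochner_Integration.integral_add Bochner_Integration.integral_diff)
  also have "\<bar>\<dots>\<bar> \<le> CK * U0 * \<sigma> ^ 3"
  proof (rule slice_bound[OF i intG])
    show "0 \<le> CK * U0 * \<sigma> ^ 3" using CK0 U0_nonneg \<sigma> by simp
    fix y assume y: "y \<in> cube d"
    define z where "z = zoom d h x y"
    define \<phi> where "\<phi> = (\<lambda>t. u (z(i := x i + h * t)))"
    define \<phi>1 where "\<phi>1 = (\<lambda>t. h * partial i u (z(i := x i + h * t)))"
    define \<phi>2 where "\<phi>2 = (\<lambda>t. h\<^sup>2 * ?w (z(i := x i + h * t)))"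
    have zt: "zoom d h (x(i := x i + s)) (y(i := t)) = z(i := x i + h * t + s)" for s t
      using i by (auto simp: z_def zoom_def fun_eq_iff)
    have inD: "z(i := x i + h * t) \<in> D" if t: "t \<in> {-1 - \<sigma>..1 + \<sigma>}" for t
    proof -
      have "edist d x (z(i := x i + h * t)) \<le> (\<Sum>j<d. \<bar>x j - (z(i := x i + h * t)) j\<bar>)" by (rule edist_le_sum)
      also have "\<dots> \<le> (\<Sum>j<d. h + (if j = i then r else 0))"
      proof (rule sum_mono)
        fix j assume j: "j \<in> {..<d}"
        show "\<bar>x j - (z(i := x i + h * t)) j\<bar> \<le> h + (if j = i then r else 0)"
        proof (cases "j = i")
          case True
          have "\<bar>t\<bar> \<le> 1 + \<sigma>" using t by auto
          then have "h * \<bar>t\<bar> \<le> h * (1 + \<sigma>)" using h by (intro mult_left_mono) auto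
          then show ?thesis using True h h\<sigma> by (simp add: abs_mult distrib_left)
        next
          case False
          have "\<bar>y j\<bar> \<le> 1" using y j by (auto simp: cube_def PiE_iff abs_le_iff)
          then have "h * \<bar>y j\<bar> \<le> h" using h by (simp add: mult_left_le)
          then show ?thesis using False j h by (simp add: z_def zoom_def abs_mult)
        qed
      qed
      also have "\<dots> = real d * h + r" using i by (simp add: sum.distrib)
      finally have "z(i := x i + h * t) \<in> ecball d x (real d * h + r)"
        using fun_upd_in_space[OF i zoom_in_space] by (simp add: ecball_def z_def)
      then show ?thesis using ball by blast
    qed
    have Gt: "G (y(i := t)) = \<phi> (t + \<sigma>) + \<phi> (t - \<sigma>) - 2 * \<phi> t - \<sigma>\<^sup>2 * \<phi>2 t" for t
    proof -
      have "\<phi> (t + \<sigma>) = u (z(i := x i + h * t + r))" "\<phi> (t - \<sigma>) = u (z(i := x i + h * t + - r))"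
        unfolding \<phi>_def h\<sigma>[symmetric] by (simp_all add: distrib_left right_diff_distrib add.assoc add_diff_eq)
      moreover have "\<sigma>\<^sup>2 * h\<^sup>2 = r\<^sup>2" using h\<sigma> by (metis mult.commute power_mult_distrib)
      moreover have "zoom d h x (y(i := t)) = z(i := x i + h * t)" using zt[of 0 t] by simp
      ultimately show ?thesis unfolding G_def zt \<phi>2_def by (simp add: mult.assoc[symmetric] \<phi>_def[THEN fun_cong, of t])
    qed
    have chain: "((\<lambda>t. p (z(i := x i + h * t))) has_real_derivative h * q) (at t)"
      if "((\<lambda>s. p (z(i := s))) has_real_derivative q) (at (x i + h * t))" for p q t
    proof -
      have "((\<lambda>t. x i + h * t) has_real_derivative h) (at t)" by (auto intro!: derivative_eq_intros)
      from DERIV_chain2[OF that this] show ?thesis by (rule DERIV_cong) (rule mult.commute)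
    qed
    have d1: "(\<phi> has_real_derivative \<phi>1 t) (at t)" if t: "t \<in> {-1 - \<sigma>..1 + \<sigma>}" for t
    proof -
      have "partial_exists i u (z(i := x i + h * t))" using u_C2 i inD[OF t] unfolding C2_on_def by blast
      then have "((\<lambda>s. u (z(i := s))) has_real_derivative partial i u (z(i := x i + h * t))) (at (x i + h * t))"
        by (simp add: partial_exists_def partial_def DERIV_deriv_iff_field_differentiable)
      from chain[OF this] show ?thesis unfolding \<phi>_def \<phi>1_def .
    qed
    have d2: "(\<phi>1 has_real_derivative \<phi>2 t) (at t)" if t: "t \<in> {-1 - \<sigma>..1 + \<sigma>}" for t
    proof -
      have "partial_exists i (partial i u) (z(i := x i + h * t))" using u_C2 i inD[OF t] unfolding C2_on_def by blast
      then have "((\<lambda>s. partial i u (z(i := s))) has_real_derivative ?w (z(i := x i + h * t))) (at (x i + h * t))"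
        by (simp add: partial_exists_def partial_def[of i "partial i u"] DERIV_deriv_iff_field_differentiable)
      from DERIV_cmult[OF chain[OF this], of h] show ?thesis unfolding \<phi>1_def \<phi>2_def
        by (rule DERIV_cong) (simp add: power2_eq_square)
    qed
    have c0: "continuous_on {-1 - \<sigma>..1 + \<sigma>} \<phi>"
      by (rule DERIV_atLeastAtMost_imp_continuous_on) (use d1 in auto)
    have c2: "continuous_on {-1..1} \<phi>2" unfolding \<phi>2_def
      by (intro continuous_intros cont_on_line[OF wc _ i] inD) (use \<sigma> D_space in auto)
    have cG: "continuous_on {-1..1} (\<lambda>t. \<phi> (t + \<sigma>) + \<phi> (t - \<sigma>) - 2 * \<phi> t - \<sigma>\<^sup>2 * \<phi>2 t)"
      by (intro continuous_intros c2 continuous_on_compose2[OF c0] continuous_on_subset[OF c0]) (use \<sigma> in auto)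
    have "\<bar>integral {-1..1} (\<lambda>t. (\<phi> (t + \<sigma>) + \<phi> (t - \<sigma>) - 2 * \<phi> t - \<sigma>\<^sup>2 * \<phi>2 t) * B0 t)\<bar> \<le> 448 * U0 * \<sigma> ^ 3"
    proof (rule second_difference_kernel_bound[where ?\<phi>1.0 = \<phi>1, OF \<sigma> c0 _ _ c2])
      show "\<bar>\<phi> t\<bar> \<le> U0" if "t \<in> {-1 - \<sigma>..1 + \<sigma>}" for t
        unfolding \<phi>_def using u_bound[OF inD[OF that]] .
    qed (use d1 d2 \<sigma> in auto)
    then show "\<bar>\<integral>t. indicator {-1..1} t * G (y(i := t)) \<partial>kern\<bar> \<le> CK * U0 * \<sigma> ^ 3"
      unfolding Gt kern_integral[OF cG] using kmass_pos by (simp add: CK_def divide_right_mono)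
  qed
  finally show ?thesis by (simp add: \<sigma>_def)
qed

text \<open>
  Summed over the coordinates, the second derivatives under the integral combine to the Laplacian, that is to \<open>- f\<close>,
  and the mean of \<open>f\<close> differs from \<open>f x\<close> by the Lipschitz constant times the radius of the cube.
\<close>

lemma mollify_stencil:
  assumes x: "x \<in> D" and h: "0 < h" and r: "0 \<le> r" "r \<le> h"
    and ball: "ecball d x (real d * h + r) \<subseteq> D"
  shows "\<bar>(\<Sum>i<d. mollify d h u (x(i := x i + r)) + mollify d h u (x(i := x i - r)) - 2 * mollify d h u x)
      + r\<^sup>2 * f x\<bar> \<le> real d * (CK * U0 * (r / h) ^ 3) + r\<^sup>2 * (Lf * (real d * h))"
proof -
  let ?w = "\<lambda>i. partial i (partial i u)"
  have b0: "ecball d x (real d * h) \<subseteq> D" using ball r by (auto simp: ecball_def)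
  have h0: "0 \<le> h" using h by simp
  have wc: "cont_on d D (?w i)" if "i < d" for i using u_C2 that unfolding C2_on_def by blast
  have fc: "cont_on d D f" by (rule lipschitz_imp_cont_on[OF _ f_lip]) (use D_space in auto)
  have "(\<Sum>i<d. mollify d h (?w i) x) = (\<integral>y. (\<Sum>i<d. indicator (cube d) y * ?w i (zoom d h x y)) \<partial>Pk d)"
    unfolding mollify_def
    by (rule Bochner_Integration.integral_sum[symmetric]) (rule mollify_integrand[OF open_D wc h0 b0], simp)
  also have "\<dots> = (\<integral>y. - (indicator (cube d) y * f (zoom d h x y)) \<partial>Pk d)"
  proof (rule Bochner_Integration.integral_cong[OF refl])
    fix y
    show "(\<Sum>i<d. indicator (cube d) y * ?w i (zoom d h x y)) = - (indicator (cube d) y * f (zoom d h x y))"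
    proof (cases "y \<in> cube d")
      case True
      have "zoom d h x y \<in> D" using zoom_cube_ecball[OF True h0] b0 by blast
      from u_lap[OF this] show ?thesis using True by (simp add: laplacian_def)
    qed simp
  qed
  also have "\<dots> = - mollify d h f x" by (simp add: mollify_def)
  finally have lap: "(\<Sum>i<d. mollify d h (?w i) x) = - mollify d h f x" .
  have mf: "\<bar>mollify d h f x - f x\<bar> \<le> Lf * (real d * h)"
  proof (rule mollify_close[OF open_D fc h0 b0])
    fix z assume z: "z \<in> ecball d x (real d * h)"
    have "\<bar>f z - f x\<bar> \<le> Lf * edist d x z" using f_lip[of z x] z b0 x by (auto simp: edist_commute)
    also have "\<dots> \<le> Lf * (real d * h)" using z Lf0 by (intro mult_left_mono) (auto simp: ecball_def)
    finally show "\<bar>f z - f x\<bar> \<le> Lf * (real d * h)" .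
  qed (use Lf0 h in simp)
  let ?E = "\<lambda>i. mollify d h u (x(i := x i + r)) + mollify d h u (x(i := x i - r)) - 2 * mollify d h u x - r\<^sup>2 * mollify d h (?w i) x"
  have "\<bar>\<Sum>i<d. ?E i\<bar> \<le> (\<Sum>i<d. CK * U0 * (r / h) ^ 3)"
    by (rule order_trans[OF sum_abs]) (rule sum_mono, use mollify_stencil_coord[OF x h r ball] in auto)
  moreover have "(\<Sum>i<d. mollify d h u (x(i := x i + r)) + mollify d h u (x(i := x i - r)) - 2 * mollify d h u x) + r\<^sup>2 * f x
      = (\<Sum>i<d. ?E i) + r\<^sup>2 * (f x - mollify d h f x)"
    by (simp add: sum_subtractf sum_distrib_left[symmetric] lap) (simp add: algebra_simps)
  moreover have "\<bar>r\<^sup>2 * (f x - mollify d h f x)\<bar> \<le> r\<^sup>2 * (Lf * (real d * h))"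
    using mf unfolding abs_mult by (intro mult_mono) (auto simp: abs_minus_commute)
  ultimately show ?thesis by simp
qed

end


section \<open>The walk on coordinate stencils\<close>

text \<open>
  \<open>rad\<close> stands for a computable step size. Where it is positive, the point has distance more than \<open>2 * \<epsilon>\<close>
  from the boundary, so that mollification at scale \<open>\<epsilon>\<close> makes sense at the point and at its neighbours.
\<close>

locale walk = poisson_problem +
  fixes \<epsilon> \<gamma> :: real and rad :: "point \<Rightarrow> real"
  assumes eps: "0 < \<epsilon>" and gam: "0 < \<gamma>" "\<gamma> \<le> 1" "\<gamma> * R * real d \<le> \<epsilon>"
    and rad_nonneg: "\<And>x. x \<in> D \<Longrightarrow> 0 \<le> rad x"
    and rad_upper: "\<And>x. x \<in> D \<Longrightarrow> rad x \<le> max 0 (dist_bdry d D x - 2 * \<epsilon>)"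
    and rad_lower: "\<And>x. x \<in> D \<Longrightarrow> dist_bdry d D x - 4 * \<epsilon> \<le> rad x"
begin

definition step :: "nat \<Rightarrow> real \<Rightarrow> point \<Rightarrow> point" where
  "step i s x = x(i := x i + s * (\<gamma> * rad x))"

definition T :: "(point \<Rightarrow> real) \<Rightarrow> point \<Rightarrow> real" where
  "T h x = (\<Sum>i<d. h (step i 1 x) + h (step i (-1) x)) / (2 * real d)"

lemma d0: "0 < real d" using d1 by simp

lemma rad_le_R: "x \<in> D \<Longrightarrow> rad x \<le> R"
  using rad_upper[of x] dist_le_R[of x] R0 eps by auto

lemma step_in_D:
  assumes x: "x \<in> D" and i: "i < d" and s: "\<bar>s\<bar> = 1"
  shows "step i s x \<in> D"
proof (cases "rad x = 0")
  case True then show ?thesis using x by (simp add: step_def)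
next
  case False
  then have "0 < rad x" "rad x \<le> dist_bdry d D x - 2 * \<epsilon>"
    using rad_nonneg[OF x] rad_upper[OF x] by auto
  moreover have "\<gamma> * rad x \<le> rad x" using gam rad_nonneg[OF x] by (simp add: mult_left_le_one_le)
  ultimately have "\<gamma> * rad x < dist_bdry d D x" using eps by linarith
  moreover have "edist d x (step i s x) = \<gamma> * rad x"
    unfolding step_def using edist_fun_upd[OF i] s gam rad_nonneg[OF x] by (simp add: abs_mult)
  moreover have "step i s x \<in> topspace (rtop d)"
    unfolding step_def using D_space[OF x] i by (intro fun_upd_in_space)
  ultimately show ?thesis using ball_subset_domain[OF open_D x] by simp
qed

lemma T_mono:
  assumes "\<And>y. y \<in> D \<Longrightarrow> h y \<le> k y" and x: "x \<in> D"
  shows "T h x \<le> T k x"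
  unfolding T_def using d0 by (intro divide_right_mono sum_mono add_mono assms step_in_D x) auto

lemma T_lincomb: "T (\<lambda>y. a * h y + b * k y) x = a * T h x + b * T k x"
  unfolding T_def by (simp add: sum.distrib sum_distrib_left[symmetric] add_divide_distrib[symmetric] algebra_simps)

lemma T_const: "T (\<lambda>y. c) x = c"
  unfolding T_def using d0 by simp

lemma Tn_mono:
  assumes "\<And>y. y \<in> D \<Longrightarrow> h y \<le> k y" and "x \<in> D"
  shows "(T ^^ n) h x \<le> (T ^^ n) k x"
  using assms(2) by (induction n arbitrary: x) (auto intro: assms(1) T_mono)

lemma Tn_lincomb: "(T ^^ n) (\<lambda>y. a * h y + b * k y) x = a * (T ^^ n) h x + b * (T ^^ n) k x"
proof (induction n arbitrary: x)
  case (Suc n)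
  have "(T ^^ Suc n) (\<lambda>y. a * h y + b * k y) x = T (\<lambda>y. (T ^^ n) (\<lambda>y. a * h y + b * k y) y) x" by simp
  also have "\<dots> = T (\<lambda>y. a * (T ^^ n) h y + b * (T ^^ n) k y) x" using Suc by presburger
  finally show ?case by (simp add: T_lincomb)
qed simp

lemma Tn_const: "(T ^^ n) (\<lambda>y. c) x = c"
proof (induction n arbitrary: x)
  case (Suc n)
  have "(T ^^ Suc n) (\<lambda>y. c) x = T (\<lambda>y. (T ^^ n) (\<lambda>y. c) y) x" by simp
  also have "\<dots> = T (\<lambda>y. c) x" using Suc by presburger
  finally show ?case by (simp add: T_const)
qed simp

lemma Tn_cmult: "(T ^^ n) (\<lambda>y. a * h y) x = a * (T ^^ n) h x"
  using Tn_lincomb[of n a h 0 h x] by simp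
lemma Tn_add: "(T ^^ n) (\<lambda>y. h y + k y) x = (T ^^ n) h x + (T ^^ n) k x"
  using Tn_lincomb[of n 1 h 1 k x] by simp
lemma Tn_diff: "(T ^^ n) (\<lambda>y. h y - k y) x = (T ^^ n) h x - (T ^^ n) k x"
  using Tn_lincomb[of n 1 h "-1" k x] by simp

lemma Tn_abs_diff_le:
  assumes "\<And>y. y \<in> D \<Longrightarrow> \<bar>h y - k y\<bar> \<le> e y" and x: "x \<in> D"
  shows "\<bar>(T ^^ n) h x - (T ^^ n) k x\<bar> \<le> (T ^^ n) e x"
proof -
  have "(T ^^ n) h x \<le> (T ^^ n) (\<lambda>y. k y + e y) x" "(T ^^ n) k x \<le> (T ^^ n) (\<lambda>y. h y + e y) x"
    using assms by (auto intro!: Tn_mono simp: abs_le_iff algebra_simps)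
  then show ?thesis by (simp add: Tn_add abs_le_iff)
qed

lemma T_telescope: "(T ^^ n) h x = h x + (\<Sum>k<n. (T ^^ k) (\<lambda>y. T h y - h y) x)"
proof (induction n)
  case (Suc n)
  have "(T ^^ n) (\<lambda>y. T h y - h y) x = (T ^^ n) (T h) x - (T ^^ n) h x" by (rule Tn_diff)
  also have "(T ^^ n) (T h) x = (T ^^ Suc n) h x" by (simp add: funpow_swap1)
  finally show ?case using Suc by simp
qed simp

text \<open>
  The squared distance from \<open>x\<close> grows by exactly \<open>(\<gamma> * rad)\<^sup>2\<close> in the mean at every step, and it never exceeds \<open>R\<^sup>2\<close>.
\<close>

lemma sum_radii:
  assumes x: "x \<in> D"
  shows "(\<Sum>k<n. (T ^^ k) (\<lambda>y. (\<gamma> * rad y)\<^sup>2) x) \<le> R\<^sup>2"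
proof -
  define q where "q = (\<lambda>z. \<Sum>i<d. (x i - z i)\<^sup>2)"
  have "T q y - q y = (\<gamma> * rad y)\<^sup>2" for y
  proof -
    let ?r = "\<gamma> * rad y"
    have upd: "q (y(i := t)) = q y + ((x i - t)\<^sup>2 - (x i - y i)\<^sup>2)" if i: "i < d" for i t
    proof -
      have "q (y(i := t)) - q y = (\<Sum>j<d. if j = i then (x i - t)\<^sup>2 - (x i - y i)\<^sup>2 else 0)"
        unfolding q_def sum_subtractf[symmetric] by (rule sum.cong) auto
      then show ?thesis using i by simp
    qed
    have "(\<Sum>i<d. q (step i 1 y) + q (step i (-1) y)) = (\<Sum>i<d. 2 * q y + 2 * ?r\<^sup>2)"
      by (rule sum.cong) (simp_all add: step_def upd power2_eq_square algebra_simps)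
    then show ?thesis using d0 by (simp add: T_def field_simps)
  qed
  then have "(T ^^ n) q x = q x + (\<Sum>k<n. (T ^^ k) (\<lambda>y. (\<gamma> * rad y)\<^sup>2) x)"
    using T_telescope[of n q x] by simp
  moreover have "q x = 0" by (simp add: q_def)
  moreover have "(T ^^ n) q x \<le> (T ^^ n) (\<lambda>_. R\<^sup>2) x"
  proof (rule Tn_mono[OF _ x])
    fix y assume y: "y \<in> D"
    have "q y = (edist d x y)\<^sup>2" by (simp add: q_def edist_sq)
    also have "\<dots> \<le> R\<^sup>2" using diam[OF x y] by (intro power_mono) auto
    finally show "q y \<le> R\<^sup>2" .
  qed
  ultimately show ?thesis by (simp add: Tn_const)
qed

definition mol_radius :: real where "mol_radius = \<epsilon> / real d"
lemma mol_radius: "0 < mol_radius" "real d * mol_radius = \<epsilon>" using eps d0 by (auto simp: mol_radius_def)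

text \<open>
  The mollified solution, continued by \<open>u\<close> itself where the kernel would reach beyond \<open>D\<close>.
\<close>

definition U :: "point \<Rightarrow> real" where
  "U x = (if \<epsilon> < dist_bdry d D x then mollify d mol_radius u x else u x)"

lemma ecball_in_D: "x \<in> D \<Longrightarrow> c < dist_bdry d D x \<Longrightarrow> ecball d x c \<subseteq> D"
  using ball_subset_domain[OF open_D] by (auto simp: ecball_def)

lemma U_close: assumes x: "x \<in> D" shows "\<bar>U x - u x\<bar> \<le> \<Lambda> * \<epsilon>"
proof (cases "\<epsilon> < dist_bdry d D x")
  case True
  have b: "ecball d x (real d * mol_radius) \<subseteq> D" using ecball_in_D[OF x] True mol_radius by simp
  have "\<bar>mollify d mol_radius u x - u x\<bar> \<le> \<Lambda> * \<epsilon>"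
  proof (rule mollify_close[OF open_D _ _ b])
    show "cont_on d D u" using u_C2 unfolding C2_on_def by blast
    fix z assume z: "z \<in> ecball d x (real d * mol_radius)"
    then have "\<bar>u z - u x\<bar> \<le> \<Lambda> * edist d z x" using b x by (intro u_lipschitz) auto
    also have "\<dots> \<le> \<Lambda> * \<epsilon>" using z mol_radius \<Lambda>0 by (intro mult_left_mono) (auto simp: ecball_def edist_commute)
    finally show "\<bar>u z - u x\<bar> \<le> \<Lambda> * \<epsilon>" .
  qed (use mol_radius \<Lambda>0 eps in auto)
  then show ?thesis using True by (simp add: U_def)
qed (use \<Lambda>0 eps in \<open>simp add: U_def\<close>)

definition consistency :: real where "consistency = CK * U0 * \<gamma> * R * real d ^ 3 / (2 * \<epsilon> ^ 3) + Lf * \<epsilon> / 2"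

lemma consistency_nonneg: "0 \<le> consistency"
  unfolding consistency_def using CK0 U0_nonneg gam R0 Lf0 eps by (intro add_nonneg_nonneg) auto

text \<open>
  If the walk does not move, both sides vanish. Otherwise the point and its neighbours are in the region where \<open>U\<close>
  is the mollified solution. The cubic error \<open>(r / mol_radius) ^ 3\<close> of \<open>mollify_stencil\<close> is charged to \<open>r\<^sup>2\<close> by
  \<open>r \<le> \<gamma> * R\<close>.
\<close>

lemma U_consistency:
  assumes x: "x \<in> D"
  shows "\<bar>T U x - U x + (\<gamma> * rad x)\<^sup>2 / (2 * real d) * f x\<bar> \<le> consistency * (\<gamma> * rad x)\<^sup>2"
proof (cases "rad x = 0")
  case True
  then have "step i s x = x" for i s by (simp add: step_def)
  then have "T U x = U x" unfolding T_def using d0 by simp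
  then show ?thesis using True by simp
next
  case False
  define r where "r = \<gamma> * rad x"
  have rp: "0 < rad x" and ru: "rad x \<le> dist_bdry d D x - 2 * \<epsilon>"
    using False rad_nonneg[OF x] rad_upper[OF x] by auto
  have r: "0 \<le> r" "r \<le> rad x" using gam rp by (auto simp: r_def mult_left_le_one_le)
  have rR: "r \<le> \<gamma> * R" using rad_le_R[OF x] gam by (simp add: r_def)
  have "r * real d \<le> \<gamma> * R * real d" using rR by (intro mult_right_mono) auto
  then have "r * real d \<le> \<epsilon>" using gam(3) by linarith
  then have rh: "r \<le> mol_radius" using d0 by (simp add: mol_radius_def pos_le_divide_eq)
  have "ecball d x (real d * mol_radius + r) \<subseteq> D"
    by (rule ecball_in_D[OF x]) (use mol_radius r ru eps in linarith)
  note M = mollify_stencil[OF x mol_radius(1) r(1) rh this]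
  have Ux: "U x = mollify d mol_radius u x" unfolding U_def using ru rp eps by auto
  have Us: "U (step i s x) = mollify d mol_radius u (step i s x)" if "i < d" "\<bar>s\<bar> = 1" for i s
  proof -
    have "edist d x (step i s x) = r"
      unfolding step_def r_def using edist_fun_upd[OF that(1)] that(2) gam rp by (simp add: abs_mult)
    then have "dist_bdry d D x \<le> dist_bdry d D (step i s x) + r"
      using dist_bdry_lipschitz[OF open_D bdd d1 x step_in_D[OF x that]] by simp
    then show ?thesis unfolding U_def using r ru eps by auto
  qed
  have "(\<Sum>i<d. U (step i 1 x) + U (step i (-1) x)) =
      (\<Sum>i<d. mollify d mol_radius u (x(i := x i + r)) + mollify d mol_radius u (x(i := x i - r)))"
    by (rule sum.cong) (simp_all add: Us, simp add: step_def r_def)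
  then have "2 * real d * (T U x - U x + r\<^sup>2 / (2 * real d) * f x) =
    (\<Sum>i<d. mollify d mol_radius u (x(i := x i + r)) + mollify d mol_radius u (x(i := x i - r)) - 2 * mollify d mol_radius u x) + r\<^sup>2 * f x"
    using d0 by (simp add: T_def Ux sum_subtractf algebra_simps)
  then have "\<bar>2 * real d * (T U x - U x + r\<^sup>2 / (2 * real d) * f x)\<bar> \<le>
      real d * (CK * U0 * (r / mol_radius) ^ 3) + r\<^sup>2 * (Lf * \<epsilon>)"
    using M mol_radius(2) by simp
  then have "2 * real d * \<bar>T U x - U x + r\<^sup>2 / (2 * real d) * f x\<bar> \<le>
      real d * (CK * U0 * (r / mol_radius) ^ 3) + r\<^sup>2 * (Lf * \<epsilon>)"
    using d0 by (simp add: abs_mult)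
  also have "\<dots> \<le> real d * (CK * U0 * (\<gamma> * R * real d ^ 3 / \<epsilon> ^ 3 * r\<^sup>2)) + real d * (r\<^sup>2 * (Lf * \<epsilon>))"
  proof (intro add_mono mult_left_mono)
    have "(r / mol_radius) ^ 3 = r * (real d ^ 3 / \<epsilon> ^ 3 * r\<^sup>2)"
      by (simp add: mol_radius_def power_divide power_mult_distrib power2_eq_square power3_eq_cube)
    also have "\<dots> \<le> (\<gamma> * R) * (real d ^ 3 / \<epsilon> ^ 3 * r\<^sup>2)"
      using rR eps by (intro mult_right_mono) auto
    finally show "(r / mol_radius) ^ 3 \<le> \<gamma> * R * real d ^ 3 / \<epsilon> ^ 3 * r\<^sup>2" by (simp add: mult_ac)
    have "1 * (r\<^sup>2 * (Lf * \<epsilon>)) \<le> real d * (r\<^sup>2 * (Lf * \<epsilon>))"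
      using d1 Lf0 eps by (intro mult_right_mono) auto
    then show "r\<^sup>2 * (Lf * \<epsilon>) \<le> real d * (r\<^sup>2 * (Lf * \<epsilon>))" by simp
  qed (use CK0 U0_nonneg in auto)
  also have "\<dots> = 2 * real d * (consistency * r\<^sup>2)"
    unfolding consistency_def by (simp add: algebra_simps)
  finally have "\<bar>T U x - U x + r\<^sup>2 / (2 * real d) * f x\<bar> \<le> consistency * r\<^sup>2"
    using d0 by (metis mult_le_cancel_left_pos mult_pos_pos zero_less_numeral)
  then show ?thesis by (simp add: r_def)
qed

text \<open>
  Telescoping along the walk; the errors of the single steps add up to at most \<open>R\<^sup>2\<close> times the constant by
  \<open>sum_radii\<close>.
\<close>

lemma U_representation:
  assumes x: "x \<in> D"
  shows "\<bar>(T ^^ n) U x - U x + (\<Sum>k<n. (T ^^ k) (\<lambda>y. (\<gamma> * rad y)\<^sup>2 / (2 * real d) * f y) x)\<bar> \<le> consistency * R\<^sup>2"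
proof -
  let ?a = "\<lambda>y. (\<gamma> * rad y)\<^sup>2 / (2 * real d) * f y"
  have e: "(T ^^ n) U x - U x + (\<Sum>k<n. (T ^^ k) ?a x) =
      (\<Sum>k<n. (T ^^ k) (\<lambda>y. T U y - U y) x - (T ^^ k) (\<lambda>y. - ?a y) x)"
    using Tn_cmult[of _ "-1" ?a x] by (subst T_telescope) (simp add: sum_subtractf sum_negf sum.distrib)
  have "\<bar>(T ^^ n) U x - U x + (\<Sum>k<n. (T ^^ k) ?a x)\<bar> \<le> (\<Sum>k<n. (T ^^ k) (\<lambda>y. consistency * (\<gamma> * rad y)\<^sup>2) x)"
    unfolding e
  proof (rule order_trans[OF sum_abs], rule sum_mono)
    fix k
    show "\<bar>(T ^^ k) (\<lambda>y. T U y - U y) x - (T ^^ k) (\<lambda>y. - ?a y) x\<bar> \<le> (T ^^ k) (\<lambda>y. consistency * (\<gamma> * rad y)\<^sup>2) x"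
      by (rule Tn_abs_diff_le[OF _ x]) (use U_consistency in auto)
  qed
  also have "\<dots> = consistency * (\<Sum>k<n. (T ^^ k) (\<lambda>y. (\<gamma> * rad y)\<^sup>2) x)"
    by (simp add: Tn_cmult sum_distrib_left)
  also have "\<dots> \<le> consistency * R\<^sup>2" using sum_radii[OF x] consistency_nonneg by (intro mult_left_mono)
  finally show ?thesis .
qed

lemma double_sum_triangle: "(\<Sum>n<M. \<Sum>k<n. a k) = (\<Sum>k<M. (real M - 1 - real k) * (a k :: real))"
proof (induction M)
  case (Suc M)
  have "(\<Sum>k<Suc M. (real (Suc M) - 1 - real k) * a k) = (\<Sum>k<M. (real M - 1 - real k) * a k + a k)"
    by (simp add: algebra_simps)
  then show ?case using Suc by (simp add: sum.distrib)
qed simp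

text \<open>
  Since \<open>rad \<le> \<epsilon> + rad\<^sup>2 / (4 * \<epsilon>)\<close>, the mean of \<open>rad\<close> over the first \<open>M\<close> steps is controlled by the sum of the squared
  step sizes.
\<close>

lemma mean_distance:
  assumes x: "x \<in> D" and M: "0 < M" "R\<^sup>2 \<le> \<epsilon>\<^sup>2 * \<gamma>\<^sup>2 * real M"
  shows "(\<Sum>n<M. (T ^^ n) (dist_bdry d D) x) \<le> real M * (6 * \<epsilon>)"
proof -
  have "(\<Sum>n<M. (T ^^ n) (dist_bdry d D) x) \<le> (\<Sum>n<M. (T ^^ n) (\<lambda>y. 5 * \<epsilon> + (1 / (4 * \<epsilon> * \<gamma>\<^sup>2)) * (\<gamma> * rad y)\<^sup>2) x)"
  proof (intro sum_mono Tn_mono x)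
    fix y assume y: "y \<in> D"
    \<comment> \<open>the inequality of arithmetic and geometric means, with the weight that leaves an error of size \<open>\<epsilon>\<close>\<close>
    have "0 \<le> (rad y - 2 * \<epsilon>)\<^sup>2" by simp
    then have "4 * \<epsilon> * rad y \<le> 4 * \<epsilon> * \<epsilon> + (rad y)\<^sup>2" by (simp add: power2_eq_square algebra_simps)
    then have "rad y \<le> \<epsilon> + (rad y)\<^sup>2 / (4 * \<epsilon>)" using eps by (simp add: field_simps)
    then show "dist_bdry d D y \<le> 5 * \<epsilon> + (1 / (4 * \<epsilon> * \<gamma>\<^sup>2)) * (\<gamma> * rad y)\<^sup>2"
      using rad_lower[OF y] gam by (simp add: power_mult_distrib)
  qed
  also have "\<dots> = real M * (5 * \<epsilon>) + (1 / (4 * \<epsilon> * \<gamma>\<^sup>2)) * (\<Sum>n<M. (T ^^ n) (\<lambda>y. (\<gamma> * rad y)\<^sup>2) x)"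
    by (simp only: Tn_add Tn_cmult Tn_const sum.distrib sum_distrib_left) simp
  also have "\<dots> \<le> real M * (5 * \<epsilon>) + (1 / (4 * \<epsilon> * \<gamma>\<^sup>2)) * (\<epsilon>\<^sup>2 * \<gamma>\<^sup>2 * real M)"
    using sum_radii[OF x, of M] M eps by (intro add_left_mono mult_left_mono) auto
  also have "(1 / (4 * \<epsilon> * \<gamma>\<^sup>2)) * (\<epsilon>\<^sup>2 * \<gamma>\<^sup>2 * real M) = real M * (\<epsilon> / 4)"
    using eps gam by (simp add: power2_eq_square)
  also have "real M * (5 * \<epsilon>) + real M * (\<epsilon> / 4) \<le> real M * (6 * \<epsilon>)"
    using eps by (simp add: distrib_left[symmetric] mult_left_mono)
  finally show ?thesis .
qed

text \<open>
  Stopping at a uniformly distributed time \<open>n < M\<close> visits the \<open>k\<close>-th step of the accumulated source term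
  with weight \<open>(M - 1 - k) / M\<close>. So the mean of the partial sums equals the mean of \<open>(M - 1 - n) / (2 * d) * (\<gamma> * rad)\<^sup>2 * f\<close>
  at the stopping time, and each trajectory needs a single evaluation of \<open>f\<close> and of \<open>g\<close>.
\<close>

lemma walk_approximates_solution:
  assumes x: "x \<in> D" and M: "0 < M" "R\<^sup>2 \<le> \<epsilon>\<^sup>2 * \<gamma>\<^sup>2 * real M"
    and pay: "\<And>n y. n < M \<Longrightarrow> y \<in> D \<Longrightarrow>
       \<bar>pay n y - (g y + (real M - 1 - real n) / (2 * real d) * (\<gamma> * rad y)\<^sup>2 * f y)\<bar> \<le> e1 + real M * e2 * (\<gamma> * rad y)\<^sup>2"
    and e2: "0 \<le> e2"
  shows "\<bar>(\<Sum>n<M. (T ^^ n) (pay n) x) / real M - u x\<bar> \<le>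
     e1 + e2 * R\<^sup>2 + consistency * R\<^sup>2 + 3 * A * R * \<epsilon> + 2 * \<Lambda> * \<epsilon>"
proof -
  let ?a = "\<lambda>y. (\<gamma> * rad y)\<^sup>2 / (2 * real d) * f y"
  let ?S = "\<lambda>n. (\<Sum>k<n. (T ^^ k) ?a x)"
  have "(\<Sum>n<M. (T ^^ n) (\<lambda>y. (real M - 1 - real n) / (2 * real d) * (\<gamma> * rad y)\<^sup>2 * f y) x) = (\<Sum>n<M. ?S n)"
    unfolding double_sum_triangle
  proof (rule sum.cong[OF refl])
    fix n
    have "(\<lambda>y. (real M - 1 - real n) / (2 * real d) * (\<gamma> * rad y)\<^sup>2 * f y) = (\<lambda>y. (real M - 1 - real n) * ?a y)"
      by (simp add: fun_eq_iff)
    then show "(T ^^ n) (\<lambda>y. (real M - 1 - real n) / (2 * real d) * (\<gamma> * rad y)\<^sup>2 * f y) x = (real M - 1 - real n) * (T ^^ n) ?a x"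
      by (simp only: Tn_cmult)
  qed
  then have exact: "(\<Sum>n<M. (T ^^ n) (\<lambda>y. g y + (real M - 1 - real n) / (2 * real d) * (\<gamma> * rad y)\<^sup>2 * f y) x)
      = (\<Sum>n<M. (T ^^ n) g x + ?S n)"
    by (simp only: Tn_add sum.distrib)
  have E1: "\<bar>(\<Sum>n<M. (T ^^ n) (pay n) x) - (\<Sum>n<M. (T ^^ n) g x + ?S n)\<bar> \<le> real M * (e1 + e2 * R\<^sup>2)"
  proof -
    have "\<bar>(\<Sum>n<M. (T ^^ n) (pay n) x) - (\<Sum>n<M. (T ^^ n) g x + ?S n)\<bar>
      \<le> (\<Sum>n<M. (T ^^ n) (\<lambda>y. e1 + real M * e2 * (\<gamma> * rad y)\<^sup>2) x)"
      unfolding exact[symmetric] sum_subtractf[symmetric]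
      by (rule order_trans[OF sum_abs], rule sum_mono, rule Tn_abs_diff_le[OF _ x]) (use pay in auto)
    also have "\<dots> = real M * e1 + real M * e2 * (\<Sum>n<M. (T ^^ n) (\<lambda>y. (\<gamma> * rad y)\<^sup>2) x)"
      by (simp only: Tn_add Tn_cmult Tn_const sum.distrib sum_distrib_left) simp
    also have "\<dots> \<le> real M * e1 + real M * e2 * R\<^sup>2"
      using sum_radii[OF x, of M] e2 by (intro add_left_mono mult_left_mono) auto
    finally show ?thesis by (simp add: algebra_simps)
  qed
  have E2: "\<bar>(T ^^ n) g x + ?S n - u x\<bar> \<le> consistency * R\<^sup>2 + 2 * \<Lambda> * \<epsilon> + A * R / 2 * (T ^^ n) (dist_bdry d D) x" for n
  proof -
    have "\<bar>(T ^^ n) g x - (T ^^ n) U x\<bar> \<le> (T ^^ n) (\<lambda>y. A * R / 2 * dist_bdry d D y + \<Lambda> * \<epsilon>) x"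
    proof (rule Tn_abs_diff_le[OF _ x])
      fix y assume y: "y \<in> D"
      show "\<bar>g y - U y\<bar> \<le> A * R / 2 * dist_bdry d D y + \<Lambda> * \<epsilon>"
        using u_minus_g_le_dist[OF y] U_close[OF y] by linarith
    qed
    also have "\<dots> = A * R / 2 * (T ^^ n) (dist_bdry d D) x + \<Lambda> * \<epsilon>"
      by (simp only: Tn_add Tn_cmult Tn_const)
    finally show ?thesis using U_representation[OF x, of n] U_close[OF x] by linarith
  qed
  have E3: "\<bar>(\<Sum>n<M. (T ^^ n) g x + ?S n) - real M * u x\<bar> \<le> real M * (consistency * R\<^sup>2 + 2 * \<Lambda> * \<epsilon> + 3 * A * R * \<epsilon>)"
  proof -
    have e: "(\<Sum>n<M. (T ^^ n) g x + ?S n) - real M * u x = (\<Sum>n<M. (T ^^ n) g x + ?S n - u x)"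
      by (simp add: sum_subtractf)
    have "\<bar>(\<Sum>n<M. (T ^^ n) g x + ?S n) - real M * u x\<bar> \<le>
        (\<Sum>n<M. consistency * R\<^sup>2 + 2 * \<Lambda> * \<epsilon> + A * R / 2 * (T ^^ n) (dist_bdry d D) x)"
      unfolding e by (rule order_trans[OF sum_abs], rule sum_mono) (rule E2)
    also have "\<dots> = real M * (consistency * R\<^sup>2 + 2 * \<Lambda> * \<epsilon>) + A * R / 2 * (\<Sum>n<M. (T ^^ n) (dist_bdry d D) x)"
      by (subst sum.distrib) (simp only: sum_constant card_lessThan sum_distrib_left)
    also have "\<dots> \<le> real M * (consistency * R\<^sup>2 + 2 * \<Lambda> * \<epsilon>) + A * R / 2 * (real M * (6 * \<epsilon>))"
      using mean_distance[OF x M] A0 R0 by (intro add_left_mono mult_left_mono) auto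
    finally show ?thesis by (simp add: algebra_simps)
  qed
  have "\<bar>(\<Sum>n<M. (T ^^ n) (pay n) x) - real M * u x\<bar> \<le>
     real M * (e1 + e2 * R\<^sup>2 + consistency * R\<^sup>2 + 3 * A * R * \<epsilon> + 2 * \<Lambda> * \<epsilon>)"
    using E1 E3 by (simp add: distrib_left)
  moreover have "(\<Sum>n<M. (T ^^ n) (pay n) x) / real M - u x = ((\<Sum>n<M. (T ^^ n) (pay n) x) - real M * u x) / real M"
    using M by (simp add: field_simps)
  ultimately show ?thesis using M by (simp add: abs_divide pos_divide_le_eq mult.commute)
qed

end

section \<open>Averages and their sparse approximation\<close>

text \<open>
  Iterated finite means with equal weights, that is, convex combinations with rational weights. This closure is all that the
  greedy selection below uses, and the mean over all trajectories belongs to it without any bookkeeping of the weights.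
\<close>

inductive_set averages :: "('a \<Rightarrow> real) set \<Rightarrow> ('a \<Rightarrow> real) set" for F where
  base: "h \<in> F \<Longrightarrow> h \<in> averages F"
| avg: "finite I \<Longrightarrow> I \<noteq> {} \<Longrightarrow> (\<And>i::nat. i \<in> I \<Longrightarrow> h i \<in> averages F) \<Longrightarrow>
     (\<lambda>x. (\<Sum>i\<in>I. h i x) / real (card I)) \<in> averages F"

lemma averages_mono:
  assumes "F \<subseteq> F'" "h \<in> averages F" shows "h \<in> averages F'"
  using assms(2)
proof induction
  case (base h) then show ?case using assms(1) by (auto intro: averages.base)
next
  case (avg I h) then show ?case by (intro averages.avg) auto
qed

lemma averages_compose:
  assumes "h \<in> averages F" shows "(\<lambda>x. h (s x)) \<in> averages ((\<lambda>k x. k (s x)) ` F)"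
  using assms
proof induction
  case (base h) then show ?case by (auto intro: averages.base)
next
  case (avg I h) then show ?case by (intro averages.avg) auto
qed

lemma averages_pairs:
  assumes "0 < d" and "\<And>i. i < d \<Longrightarrow> p i \<in> averages F" "\<And>i. i < d \<Longrightarrow> q i \<in> averages F"
  shows "(\<lambda>x. (\<Sum>i<d. p i x + q i x) / (2 * real d)) \<in> averages F"
proof -
  let ?h = "\<lambda>i. if i < d then p i else q (i - d)"
  have "(\<lambda>x. (\<Sum>i<2*d. ?h i x) / real (card {..<2*d})) \<in> averages F"
    using assms by (intro averages.avg) (auto simp: lessThan_empty_iff)
  moreover have "(\<Sum>i<2*d. ?h i x) = (\<Sum>i<d. p i x + q i x)" for x
  proof -
    have "(\<Sum>i<2*d. ?h i x) = (\<Sum>i\<in>{0..<d}. ?h i x) + (\<Sum>i\<in>{d..<d+d}. ?h i x)"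
      by (subst sum.atLeastLessThan_concat) (auto simp: lessThan_atLeast0 mult_2)
    also have "(\<Sum>i\<in>{d..<d+d}. ?h i x) = (\<Sum>i\<in>{0..<d}. q i x)"
      using sum.shift_bounds_nat_ivl[of "\<lambda>i. ?h i x" 0 d d] by simp
    finally show ?thesis by (simp add: sum.distrib lessThan_atLeast0)
  qed
  ultimately show ?thesis by simp
qed

context finite_measure begin

definition tame :: "real \<Rightarrow> ('a \<Rightarrow> real) \<Rightarrow> bool" where
  "tame B h \<longleftrightarrow> h \<in> borel_measurable M \<and> (\<forall>x\<in>space M. \<bar>h x\<bar> \<le> B)"

lemma tame_integrable: "tame B h \<Longrightarrow> integrable M h"
  unfolding tame_def by (intro integrable_const_bound[of _ B]) auto

lemma tame_mult: "tame B h \<Longrightarrow> tame C k \<Longrightarrow> tame (B * C) (\<lambda>x. h x * k x)"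
  unfolding tame_def by (auto simp: abs_mult intro!: mult_mono order_trans[OF abs_ge_zero])

lemma tame_diff: "tame B h \<Longrightarrow> tame C k \<Longrightarrow> tame (B + C) (\<lambda>x. h x - k x)"
  unfolding tame_def by (auto intro: order_trans[OF abs_triangle_ineq4] add_mono)

lemma tame_add: "tame B h \<Longrightarrow> tame C k \<Longrightarrow> tame (B + C) (\<lambda>x. h x + k x)"
  unfolding tame_def by (auto intro: order_trans[OF abs_triangle_ineq] add_mono)

lemma averages_tame:
  assumes F: "\<And>h. h \<in> F \<Longrightarrow> tame B h" and h: "h \<in> averages F"
  shows "tame B h"
  using h
proof induction
  case (base h) then show ?case by (rule F)
next
  case (avg I h)
  have "\<bar>(\<Sum>i\<in>I. h i x) / real (card I)\<bar> \<le> B" if x: "x \<in> space M" for x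
  proof -
    have "\<bar>\<Sum>i\<in>I. h i x\<bar> \<le> (\<Sum>i\<in>I. B)"
      by (rule order_trans[OF sum_abs], rule sum_mono) (use avg.IH x in \<open>auto simp: tame_def\<close>)
    then show ?thesis using avg(1,2) by (simp add: abs_divide pos_divide_le_eq card_gt_0_iff mult.commute)
  qed
  then show ?case using avg.IH unfolding tame_def by (auto intro!: borel_measurable_divide borel_measurable_sum)
qed

text \<open>
  The functional \<open>h \<mapsto> \<integral>x. s x * h x \<partial>M\<close> is linear, so some member of the family is below the mean.
\<close>

lemma averages_select:
  assumes F: "\<And>h. h \<in> F \<Longrightarrow> tame B h" and s: "tame C s" and h: "h \<in> averages F"
  shows "\<exists>k\<in>F. (\<integral>x. s x * k x \<partial>M) \<le> (\<integral>x. s x * h x \<partial>M)"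
  using h
proof induction
  case (base h) then show ?case by blast
next
  case (avg I h)
  have int: "integrable M (\<lambda>x. s x * h i x)" if "i \<in> I" for i
    by (rule tame_integrable[OF tame_mult[OF s averages_tame[OF F avg(3)[OF that]]]])
  have "(\<integral>x. s x * ((\<Sum>i\<in>I. h i x) / real (card I)) \<partial>M) = (\<integral>x. (\<Sum>i\<in>I. s x * h i x) / real (card I) \<partial>M)"
    by (simp add: sum_distrib_left)
  also have "\<dots> = (\<Sum>i\<in>I. (\<integral>x. s x * h i x \<partial>M)) / real (card I)"
    using int by (simp add: Bochner_Integration.integral_sum)
  finally have e: "(\<integral>x. s x * ((\<Sum>i\<in>I. h i x) / real (card I)) \<partial>M) = (\<Sum>i\<in>I. (\<integral>x. s x * h i x \<partial>M)) / real (card I)" .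
  have "\<exists>i\<in>I. (\<integral>x. s x * h i x \<partial>M) \<le> (\<Sum>i\<in>I. (\<integral>x. s x * h i x \<partial>M)) / real (card I)"
  proof (rule ccontr)
    assume "\<not> ?thesis"
    then have "(\<Sum>i\<in>I. (\<Sum>i\<in>I. (\<integral>x. s x * h i x \<partial>M)) / real (card I)) < (\<Sum>i\<in>I. (\<integral>x. s x * h i x \<partial>M))"
      using avg(1,2) by (intro sum_strict_mono) auto
    then show False using avg(1,2) by simp
  qed
  then obtain i where i: "i \<in> I" "(\<integral>x. s x * h i x \<partial>M) \<le> (\<integral>x. s x * ((\<Sum>i\<in>I. h i x) / real (card I)) \<partial>M)"
    unfolding e by blast
  then show ?case using avg.IH[OF i(1)] by (meson order_trans)
qed

text \<open>
  The deterministic form of Maurey's lemma. Given the deviation \<open>s\<close> of the sum of the first \<open>N\<close> members from \<open>N * w\<close>,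
  the next member \<open>p\<close> is chosen with \<open>(\<integral>x. s x * (p x - w x) \<partial>M) \<le> 0\<close>, so that the squared norm grows by at most
  \<open>4 * B\<^sup>2 * measure M (space M)\<close>.
\<close>

lemma sparse_average:
  assumes F: "\<And>h. h \<in> F \<Longrightarrow> tame B h" and w: "w \<in> averages F"
  shows "\<exists>k. (\<forall>i<N. k i \<in> F) \<and>
    (\<integral>x. ((\<Sum>i<N. k i x) - real N * w x)\<^sup>2 \<partial>M) \<le> real N * (4 * B\<^sup>2 * measure M (space M))"
proof (induction N)
  case 0 then show ?case by simp
next
  case (Suc N)
  then obtain k where k: "\<And>i. i < N \<Longrightarrow> k i \<in> F"
    "(\<integral>x. ((\<Sum>i<N. k i x) - real N * w x)\<^sup>2 \<partial>M) \<le> real N * (4 * B\<^sup>2 * measure M (space M))" by blast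
  have wt: "tame B w" by (rule averages_tame[OF F w])
  define s where "s = (\<lambda>x. (\<Sum>i<N. k i x) - real N * w x)"
  have "\<exists>C. tame C (\<lambda>x. (\<Sum>i<n. k i x))" if "n \<le> N" for n
    using that
  proof (induction n)
    case 0 show ?case by (rule exI[of _ 0]) (simp add: tame_def)
  next
    case (Suc n) then show ?case using tame_add[OF _ F[OF k(1)[of n]]] by auto
  qed
  then obtain C where "tame C (\<lambda>x. (\<Sum>i<N. k i x))" by blast
  moreover have "tame (\<bar>real N\<bar>) (\<lambda>x. real N)" by (simp add: tame_def)
  ultimately have st: "tame (C + \<bar>real N\<bar> * B) s" unfolding s_def by (intro tame_diff tame_mult wt)
  obtain p where p: "p \<in> F" "(\<integral>x. s x * p x \<partial>M) \<le> (\<integral>x. s x * w x \<partial>M)"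
    using averages_select[OF F st w] by blast
  have dt: "tame (B + B) (\<lambda>x. p x - w x)" by (rule tame_diff[OF F[OF p(1)] wt])
  have cross: "(\<integral>x. s x * (p x - w x) \<partial>M) \<le> 0"
    using p(2) tame_integrable[OF tame_mult[OF st F[OF p(1)]]] tame_integrable[OF tame_mult[OF st wt]]
    by (simp add: right_diff_distrib)
  have sq: "(\<integral>x. (p x - w x) * (p x - w x) \<partial>M) \<le> 4 * B\<^sup>2 * measure M (space M)"
  proof -
    have t: "tame ((B + B) * (B + B)) (\<lambda>x. (p x - w x) * (p x - w x))" by (rule tame_mult[OF dt dt])
    have "(\<integral>x. (p x - w x) * (p x - w x) \<partial>M) \<le> (\<integral>x. (B + B) * (B + B) \<partial>M)"
      by (rule integral_mono[OF tame_integrable[OF t]]) (use t in \<open>auto simp: tame_def\<close>)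
    then show ?thesis by (simp add: power2_eq_square mult_ac)
  qed
  let ?k = "\<lambda>i. if i < N then k i else p"
  have "(\<integral>x. ((\<Sum>i<Suc N. ?k i x) - real (Suc N) * w x)\<^sup>2 \<partial>M)
      = (\<integral>x. s x * s x + 2 * (s x * (p x - w x)) + (p x - w x) * (p x - w x) \<partial>M)"
    by (rule Bochner_Integration.integral_cong) (auto simp: s_def power2_eq_square algebra_simps)
  also have "\<dots> = (\<integral>x. s x * s x \<partial>M) + 2 * (\<integral>x. s x * (p x - w x) \<partial>M) + (\<integral>x. (p x - w x) * (p x - w x) \<partial>M)"
    using tame_integrable[OF tame_mult[OF st st]] tame_integrable[OF tame_mult[OF st dt]] tame_integrable[OF tame_mult[OF dt dt]]
    by simp
  also have "\<dots> \<le> real (Suc N) * (4 * B\<^sup>2 * measure M (space M))"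
    using k(2) cross sq by (simp add: s_def power2_eq_square algebra_simps)
  finally show ?case using k(1) p(1) by (intro exI[of _ ?k]) auto
qed

end

context walk begin

text \<open>
  The maps from the starting point to the end of a trajectory with \<open>n\<close> steps. The first step is applied innermost, in
  accordance with \<open>(T ^^ Suc n) h = T ((T ^^ n) h)\<close>.
\<close>

primrec paths :: "nat \<Rightarrow> (point \<Rightarrow> point) set" where
  "paths 0 = {id}"
| "paths (Suc n) = {\<lambda>x. \<sigma> (step i s x) |\<sigma> i s. \<sigma> \<in> paths n \<and> i < d \<and> s \<in> {1, -1}}"

lemma paths_in_D: "\<sigma> \<in> paths n \<Longrightarrow> x \<in> D \<Longrightarrow> \<sigma> x \<in> D"
proof (induction n arbitrary: \<sigma> x)
  case (Suc n)
  then obtain \<sigma>' i s where "\<sigma> = (\<lambda>x. \<sigma>' (step i s x))" "\<sigma>' \<in> paths n" "i < d" "s \<in> {1, -1}" by auto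
  then show ?case using Suc.IH[of \<sigma>' "step i s x"] step_in_D[OF Suc.prems(2), of i s] by auto
qed simp

lemma Tn_averages: "(T ^^ n) h \<in> averages ((\<lambda>\<sigma> x. h (\<sigma> x)) ` paths n)"
proof (induction n)
  case 0 then show ?case by (simp add: averages.base)
next
  case (Suc n)
  have "(\<lambda>x. (T ^^ n) h (step i s x)) \<in> averages ((\<lambda>\<sigma> x. h (\<sigma> x)) ` paths (Suc n))"
    if "i < d" "s \<in> {1, -1}" for i s
  proof (rule averages_mono[OF _ averages_compose[OF Suc]], rule subsetI)
    fix k assume "k \<in> (\<lambda>k x. k (step i s x)) ` (\<lambda>\<sigma> x. h (\<sigma> x)) ` paths n"
    then obtain \<sigma> where \<sigma>: "\<sigma> \<in> paths n" "k = (\<lambda>x. h (\<sigma> (step i s x)))" by auto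
    have "(\<lambda>x. \<sigma> (step i s x)) \<in> paths (Suc n)" unfolding paths.simps using \<sigma>(1) that by blast
    then show "k \<in> (\<lambda>\<sigma> x. h (\<sigma> x)) ` paths (Suc n)"
      unfolding \<sigma>(2) by (rule rev_image_eqI) simp
  qed
  then have "(\<lambda>x. (\<Sum>i<d. (T ^^ n) h (step i 1 x) + (T ^^ n) h (step i (-1) x)) / (2 * real d)) \<in> averages ((\<lambda>\<sigma> x. h (\<sigma> x)) ` paths (Suc n))"
    using d1 by (intro averages_pairs) auto
  then show ?case by (simp add: T_def[abs_def] del: paths.simps)
qed

lemma walk_mean_in_averages:
  assumes "0 < M"
  shows "(\<lambda>x. (\<Sum>n<M. (T ^^ n) (pay n) x) / real M) \<in> averages {\<lambda>x. pay n (\<sigma> x) |n \<sigma>. n < M \<and> \<sigma> \<in> paths n}"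
proof -
  have "(T ^^ n) (pay n) \<in> averages {\<lambda>x. pay n (\<sigma> x) |n \<sigma>. n < M \<and> \<sigma> \<in> paths n}" if "n < M" for n
    by (rule averages_mono[OF _ Tn_averages]) (use that in auto)
  then have "(\<lambda>x. (\<Sum>n\<in>{..<M}. (T ^^ n) (pay n) x) / real (card {..<M})) \<in> averages {\<lambda>x. pay n (\<sigma> x) |n \<sigma>. n < M \<and> \<sigma> \<in> paths n}"
    using assms by (intro averages.avg) auto
  then show ?thesis by simp
qed

end


section \<open>Elementary facts on ReLU networks\<close>

definition layer_size :: "relu_dnn \<Rightarrow> nat \<Rightarrow> nat" where
  "layer_size \<Phi> l = card {(i, j). i < width \<Phi> l \<and> j < width \<Phi> (l - 1) \<and> wmat \<Phi> l i j \<noteq> 0} +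
        card {i. i < width \<Phi> l \<and> bias \<Phi> l i \<noteq> 0}"

lemma dnn_size_layers: "dnn_size \<Phi> = (\<Sum>l=1..depth \<Phi>. layer_size \<Phi> l)"
  by (simp add: dnn_size_def layer_size_def)

lemma finite_support2: "finite {(i, j). i < (a::nat) \<and> j < (b::nat) \<and> P i j}"
  by (rule finite_subset[of _ "{..<a} \<times> {..<b}"]) auto

lemma affine_layer_cong:
  "(\<And>j. j < width \<Phi> (l - 1) \<Longrightarrow> x j = y j) \<Longrightarrow> affine_layer \<Phi> l x = affine_layer \<Phi> l y"
  unfolding affine_layer_def by (intro restrict_ext) simp

lemma dnn_layer_cong:
  assumes "\<And>j. j < width \<Phi> 0 \<Longrightarrow> x j = y j" shows "dnn_layer \<Phi> k x = dnn_layer \<Phi> k y"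
proof (induction k)
  case 0 then show ?case using assms by (auto intro: affine_layer_cong)
next
  case (Suc k) then show ?case by simp
qed

lemma dnn_fun_cong:
  assumes "is_dnn p n \<Phi>" "\<And>j. j < p \<Longrightarrow> x j = y j" shows "dnn_fun \<Phi> x = dnn_fun \<Phi> y"
  using assms dnn_layer_cong[of \<Phi> x y] unfolding dnn_fun_def is_dnn_def by simp

lemma cont_on_dnn_layer:
  assumes w: "width \<Phi> 0 = d" and k: "k < depth \<Phi>"
  shows "i < width \<Phi> (Suc k) \<Longrightarrow> cont_on d S (\<lambda>x. dnn_layer \<Phi> k x i)"
  using k
proof (induction k arbitrary: i)
  case 0
  then show ?case using w
    by (simp add: affine_layer_def) (intro cont_on_add cont_on_sum cont_on_mult cont_on_const cont_on_coord; simp)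
next
  case (Suc k)
  then show ?case
    by (simp add: affine_layer_def) (intro cont_on_add cont_on_sum cont_on_mult cont_on_const cont_on_max; simp)
qed

lemma cont_on_dnn_fun: "is_dnn d 1 \<Phi> \<Longrightarrow> cont_on d S (dnn_fun \<Phi>)"
  unfolding dnn_fun_def is_dnn_def by (intro cont_on_dnn_layer) auto

definition const_dnn :: "nat \<Rightarrow> real \<Rightarrow> relu_dnn" where
  "const_dnn p c = \<lparr>depth = 1, width = (\<lambda>l. if l = 0 then p else 1), wmat = (\<lambda>_ _ _. 0), bias = (\<lambda>_ _. c)\<rparr>"

lemma const_dnn:
  assumes "0 < p"
  shows "is_dnn p 1 (const_dnn p c)" "dnn_fun (const_dnn p c) x = c" "depth (const_dnn p c) = 1"
    "dnn_size (const_dnn p c) = (if c = 0 then 0 else 1)"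
  using assms by (auto simp: is_dnn_def const_dnn_def dnn_fun_def affine_layer_def dnn_size_def)

text \<open>
  A layer without weights outputs \<open>0\<close> whatever its input is, and later layers see nothing else.
\<close>

lemma dead_layer_imp_const:
  assumes l: "1 \<le> l" and z: "layer_size \<Phi> l = 0"
  shows "dnn_layer \<Phi> (l - 1 + t) x = dnn_layer \<Phi> (l - 1 + t) y"
proof (induction t)
  case 0
  have w0: "wmat \<Phi> l i j = 0" if "i < width \<Phi> l" "j < width \<Phi> (l - 1)" for i j
  proof -
    have "card {(i, j). i < width \<Phi> l \<and> j < width \<Phi> (l - 1) \<and> wmat \<Phi> l i j \<noteq> 0} = 0"
      using z unfolding layer_size_def by simp
    then have "{(i, j). i < width \<Phi> l \<and> j < width \<Phi> (l - 1) \<and> wmat \<Phi> l i j \<noteq> 0} = {}"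
      by (subst (asm) card_0_eq[OF finite_support2])
    then show ?thesis using that by auto
  qed
  have aff: "affine_layer \<Phi> l v = affine_layer \<Phi> l v'" for v v'
    unfolding affine_layer_def by (intro restrict_ext) (simp add: w0)
  show ?case
  proof (cases "l - 1")
    case 0
    then have "l = 1" using l by simp
    then show ?thesis using aff by simp
  next
    case (Suc k)
    then have "l = Suc (Suc k)" using l by simp
    then show ?thesis using aff Suc by simp
  qed
next
  case (Suc t) then show ?case by simp
qed

text \<open>
  Either every layer has a weight, and then there are at most as many layers as weights, or the network is constant and can
  be replaced by a single bias.
\<close>

lemma shallow_equivalent:
  assumes n: "is_dnn p 1 \<Phi>"
  obtains \<Psi> where "is_dnn p 1 \<Psi>" "depth \<Psi> \<le> dnn_size \<Phi> + 1" "dnn_size \<Psi> \<le> dnn_size \<Phi> + 1"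
    "\<And>x. dnn_fun \<Psi> x = dnn_fun \<Phi> x"
proof (cases "\<exists>l\<in>{1..depth \<Phi>}. layer_size \<Phi> l = 0")
  case False
  have "depth \<Phi> = (\<Sum>l=1..depth \<Phi>. 1)" by simp
  also have "\<dots> \<le> dnn_size \<Phi>" unfolding dnn_size_layers
    using False by (intro sum_mono) (auto simp: Suc_le_eq)
  finally show ?thesis using that[of \<Phi>] n by simp
next
  case True
  then obtain l where l: "1 \<le> l" "l \<le> depth \<Phi>" "layer_size \<Phi> l = 0" by auto
  have "depth \<Phi> - 1 = l - 1 + (depth \<Phi> - l)" using l by simp
  then have c: "dnn_fun \<Phi> x = dnn_fun \<Phi> (\<lambda>_. 0)" for x
    unfolding dnn_fun_def using dead_layer_imp_const[OF l(1,3), of "depth \<Phi> - l" x "\<lambda>_. 0"] by simp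
  have "0 < p" using n unfolding is_dnn_def by auto
  from const_dnn[OF this, of "dnn_fun \<Phi> (\<lambda>_. 0)"] show ?thesis
    by (intro that[of "const_dnn p (dnn_fun \<Phi> (\<lambda>_. 0))"]) (auto simp: c[symmetric])
qed

section \<open>Register programs\<close>

text \<open>
  A layer consists of its width, its matrix and its bias. In contrast to \<open>relu_dnn\<close> every layer of a list is followed by the
  activation, so that lists of layers can be composed by concatenation.
\<close>

type_synonym layer = "nat \<times> (nat \<Rightarrow> nat \<Rightarrow> real) \<times> (nat \<Rightarrow> real)"

definition act :: "nat \<Rightarrow> layer \<Rightarrow> point \<Rightarrow> point" where
  "act n = (\<lambda>(w, A, b) v i. if i < w then max 0 ((\<Sum>j<n. A i j * v j) + b i) else 0)"

definition lsize :: "nat \<Rightarrow> layer \<Rightarrow> nat" where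
  "lsize n = (\<lambda>(w, A, b). card {(i, j). i < w \<and> j < n \<and> A i j \<noteq> 0} + card {i. i < w \<and> b i \<noteq> 0})"

fun run :: "nat \<Rightarrow> layer list \<Rightarrow> point \<Rightarrow> point" where
  "run n [] v = v"
| "run n (l # ls) v = run (fst l) ls (act n l v)"

fun outw :: "nat \<Rightarrow> layer list \<Rightarrow> nat" where
  "outw n [] = n"
| "outw n (l # ls) = outw (fst l) ls"

fun lssize :: "nat \<Rightarrow> layer list \<Rightarrow> nat" where
  "lssize n [] = 0"
| "lssize n (l # ls) = lsize n l + lssize (fst l) ls"

lemma run_append: "run n (ls @ ks) v = run (outw n ls) ks (run n ls v)"
  by (induction ls arbitrary: n v) auto
lemma outw_append: "outw n (ls @ ks) = outw (outw n ls) ks"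
  by (induction ls arbitrary: n) auto
lemma lssize_append: "lssize n (ls @ ks) = lssize n ls + lssize (outw n ls) ks"
  by (induction ls arbitrary: n) auto

text \<open>
  The positive parts of the \<open>m\<close> registers followed by their negative parts. Encoded states are nonnegative, and therefore
  the activation leaves them unchanged.
\<close>

definition enc :: "nat \<Rightarrow> point \<Rightarrow> point" where
  "enc m z i = (if i < m then max 0 (z i) else if i < 2 * m then max 0 (- z (i - m)) else 0)"

definition realizes :: "nat \<Rightarrow> nat \<Rightarrow> (point \<Rightarrow> point) \<Rightarrow> bool" where
  "realizes m s F \<longleftrightarrow> (\<exists>ls. (\<forall>l\<in>set ls. 0 < fst l) \<and> outw (2 * m) ls = 2 * m \<and>
     lssize (2 * m) ls \<le> s \<and> (\<forall>z. run (2 * m) ls (enc m z) = enc m (F z)))"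

lemma realizes_id: "realizes m 0 (\<lambda>z. z)"
  unfolding realizes_def by (intro exI[of _ "[]"]) simp

lemma realizes_comp:
  assumes "realizes m s F" "realizes m t G"
  shows "realizes m (s + t) (\<lambda>z. G (F z))"
proof -
  obtain ls where ls: "\<forall>l\<in>set ls. 0 < fst l" "outw (2 * m) ls = 2 * m" "lssize (2 * m) ls \<le> s"
    "\<forall>z. run (2 * m) ls (enc m z) = enc m (F z)" using assms(1) unfolding realizes_def by blast
  obtain ks where ks: "\<forall>l\<in>set ks. 0 < fst l" "outw (2 * m) ks = 2 * m" "lssize (2 * m) ks \<le> t"
    "\<forall>z. run (2 * m) ks (enc m z) = enc m (G z)" using assms(2) unfolding realizes_def by blast
  show ?thesis unfolding realizes_def
    by (intro exI[of _ "ls @ ks"]) (use ls ks in \<open>auto simp: run_append outw_append lssize_append\<close>)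
qed

lemma realizes_mono: "realizes m s F \<Longrightarrow> s \<le> t \<Longrightarrow> realizes m t F"
  unfolding realizes_def by (meson order_trans)

definition window :: "(nat \<Rightarrow> real) \<Rightarrow> nat \<Rightarrow> nat \<Rightarrow> nat \<Rightarrow> real" where
  "window c a p j = (if a \<le> j \<and> j < a + p then c (j - a) else 0)"

lemma sum_window:
  assumes "a + p \<le> n" shows "(\<Sum>j<n. window c a p j * v j) = (\<Sum>j<p. c j * v (a + j))"
proof -
  have "(\<Sum>j<n. window c a p j * v j) = (\<Sum>j\<in>{a..<a+p}. window c a p j * v j)"
    by (rule sum.mono_neutral_right) (use assms in \<open>auto simp: window_def\<close>)
  also have "\<dots> = (\<Sum>j\<in>{0..<p}. window c a p (j + a) * v (j + a))"
    using sum.shift_bounds_nat_ivl[of "\<lambda>j. window c a p j * v j" 0 a p] by (simp add: add.commute)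
  also have "\<dots> = (\<Sum>j<p. c j * v (a + j))"
    by (rule sum.cong) (auto simp: window_def add.commute)
  finally show ?thesis .
qed

text \<open>
  The rows of a network that reads the registers starting at \<open>off\<close> while all registers are kept in the first \<open>2 * m\<close>
  neurons. The first layer recombines the two parts of its inputs; later layers read the neurons after position \<open>2 * m\<close>.
\<close>

definition emb_row :: "nat \<Rightarrow> nat \<Rightarrow> relu_dnn \<Rightarrow> nat \<Rightarrow> nat \<Rightarrow> nat \<Rightarrow> real" where
  "emb_row m off \<Phi> l q j =
     (if l = 1 then window (wmat \<Phi> l q) off (width \<Phi> 0) j - window (wmat \<Phi> l q) (m + off) (width \<Phi> 0) j
      else window (wmat \<Phi> l q) (2 * m) (width \<Phi> (l - 1)) j)"

definition emb_hidden :: "nat \<Rightarrow> nat \<Rightarrow> relu_dnn \<Rightarrow> nat \<Rightarrow> layer" where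
  "emb_hidden m off \<Phi> l = (2 * m + width \<Phi> l,
     (\<lambda>i j. if i < 2 * m then (if j = i then 1 else 0) else emb_row m off \<Phi> l (i - 2 * m) j),
     (\<lambda>i. if i < 2 * m then 0 else bias \<Phi> l (i - 2 * m)))"

text \<open>
  The last layer overwrites the two parts of register \<open>k\<close> by the output and its negative.
\<close>

definition emb_last :: "nat \<Rightarrow> nat \<Rightarrow> nat \<Rightarrow> relu_dnn \<Rightarrow> layer" where
  "emb_last m off k \<Phi> = (2 * m,
     (\<lambda>i j. if i = k then emb_row m off \<Phi> (depth \<Phi>) 0 j
            else if i = m + k then - emb_row m off \<Phi> (depth \<Phi>) 0 j else if j = i then 1 else 0),
     (\<lambda>i. if i = k then bias \<Phi> (depth \<Phi>) 0 else if i = m + k then - bias \<Phi> (depth \<Phi>) 0 else 0))"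

definition emb_state :: "nat \<Rightarrow> nat \<Rightarrow> relu_dnn \<Rightarrow> nat \<Rightarrow> point \<Rightarrow> point" where
  "emb_state m off \<Phi> t z i = (if i < 2 * m then enc m z i
     else if 1 \<le> t \<and> i < 2 * m + width \<Phi> t then max 0 (dnn_layer \<Phi> (t - 1) (\<lambda>j. z (off + j)) (i - 2 * m)) else 0)"

definition emb_width :: "nat \<Rightarrow> relu_dnn \<Rightarrow> nat \<Rightarrow> nat" where
  "emb_width m \<Phi> t = (if t = 0 then 2 * m else 2 * m + width \<Phi> t)"

lemma emb_row_sum:
  assumes off: "off + width \<Phi> 0 \<le> m" and q: "q < width \<Phi> (Suc t)"
  shows "(\<Sum>j<emb_width m \<Phi> t. emb_row m off \<Phi> (Suc t) q j * emb_state m off \<Phi> t z j) + bias \<Phi> (Suc t) q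
     = dnn_layer \<Phi> t (\<lambda>j. z (off + j)) q"
proof (cases t)
  case 0
  let ?p = "width \<Phi> 0" and ?w = "wmat \<Phi> 1 q"
  have "(\<Sum>j<2*m. emb_row m off \<Phi> 1 q j * emb_state m off \<Phi> 0 z j)
     = (\<Sum>j<2*m. window ?w off ?p j * emb_state m off \<Phi> 0 z j) - (\<Sum>j<2*m. window ?w (m + off) ?p j * emb_state m off \<Phi> 0 z j)"
    unfolding sum_subtractf[symmetric] by (simp add: emb_row_def algebra_simps)
  also have "\<dots> = (\<Sum>j<?p. ?w j * emb_state m off \<Phi> 0 z (off + j)) - (\<Sum>j<?p. ?w j * emb_state m off \<Phi> 0 z (m + off + j))"
    using off by (subst (1 2) sum_window) auto
  also have "\<dots> = (\<Sum>j<?p. ?w j * z (off + j))"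
    unfolding sum_subtractf[symmetric]
    by (rule sum.cong) (use off in \<open>auto simp: emb_state_def enc_def max_def algebra_simps\<close>)
  finally show ?thesis using 0 q by (simp add: emb_width_def affine_layer_def)
next
  case (Suc k)
  have "(\<Sum>j<emb_width m \<Phi> t. emb_row m off \<Phi> (Suc t) q j * emb_state m off \<Phi> t z j)
     = (\<Sum>j<width \<Phi> t. wmat \<Phi> (Suc t) q j * emb_state m off \<Phi> t z (2 * m + j))"
    using Suc by (simp add: emb_width_def emb_row_def sum_window)
  also have "\<dots> = (\<Sum>j<width \<Phi> t. wmat \<Phi> (Suc t) q j * max 0 (dnn_layer \<Phi> k (\<lambda>j. z (off + j)) j))"
    using Suc by (intro sum.cong) (auto simp: emb_state_def)
  finally show ?thesis using Suc q by (simp add: affine_layer_def)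
qed

lemma sum_delta_row:
  "(i::nat) < n \<Longrightarrow> (\<Sum>j<n. (if j = i then 1 else 0) * v j) = (v i :: real)"
proof -
  assume "i < n"
  have "(\<Sum>j<n. (if j = i then 1 else 0) * v j) = (\<Sum>j<n. if j = i then v j else 0)"
    by (rule sum.cong) auto
  then show ?thesis using \<open>i < n\<close> by simp
qed

lemma enc_nonneg [simp]: "0 \<le> enc m z i" by (simp add: enc_def)

lemma emb_width_ge: "2 * m \<le> emb_width m \<Phi> t" by (simp add: emb_width_def)

lemma act_emb_hidden:
  assumes off: "off + width \<Phi> 0 \<le> m"
  shows "act (emb_width m \<Phi> t) (emb_hidden m off \<Phi> (Suc t)) (emb_state m off \<Phi> t z) = emb_state m off \<Phi> (Suc t) z"
proof
  fix i
  consider "i < 2 * m" | "2 * m \<le> i" "i < 2 * m + width \<Phi> (Suc t)" | "2 * m + width \<Phi> (Suc t) \<le> i" by linarith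
  then show "act (emb_width m \<Phi> t) (emb_hidden m off \<Phi> (Suc t)) (emb_state m off \<Phi> t z) i = emb_state m off \<Phi> (Suc t) z i"
  proof cases
    case 1
    have "i < emb_width m \<Phi> t" using 1 emb_width_ge[of m \<Phi> t] by simp
    then show ?thesis using 1 by (simp add: act_def emb_hidden_def sum_delta_row) (simp add: emb_state_def)
  next
    case 2
    then have "i - 2 * m < width \<Phi> (Suc t)" by simp
    from emb_row_sum[OF off this, of z] 2 show ?thesis
      by (simp add: act_def emb_hidden_def) (simp add: emb_state_def)
  next
    case 3 then show ?thesis by (simp add: act_def emb_hidden_def emb_state_def)
  qed
qed

lemma emb_state_0: "emb_state m off \<Phi> 0 z = enc m z"
  by (auto simp: emb_state_def enc_def fun_eq_iff)

lemma run_emb_hidden: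
  assumes off: "off + width \<Phi> 0 \<le> m"
  shows "outw (2 * m) (map (emb_hidden m off \<Phi>) [1..<Suc t]) = emb_width m \<Phi> t \<and>
    run (2 * m) (map (emb_hidden m off \<Phi>) [1..<Suc t]) (enc m z) = emb_state m off \<Phi> t z"
proof (induction t)
  case 0 show ?case by (simp add: emb_width_def emb_state_0)
next
  case (Suc t)
  have "[1..<Suc (Suc t)] = [1..<Suc t] @ [Suc t]" by simp
  then show ?case using Suc
    by (simp add: run_append outw_append act_emb_hidden[OF off] del: upt_Suc)
       (simp add: emb_hidden_def emb_width_def)
qed

lemma act_emb_last:
  assumes off: "off + width \<Phi> 0 \<le> m" and k: "k < m" and L: "depth \<Phi> = Suc t" and w: "width \<Phi> (Suc t) = 1"
  shows "act (emb_width m \<Phi> t) (emb_last m off k \<Phi>) (emb_state m off \<Phi> t z)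
    = enc m (z(k := dnn_fun \<Phi> (\<lambda>j. z (off + j))))"
proof
  fix i
  let ?s = "\<Sum>j<emb_width m \<Phi> t. emb_row m off \<Phi> (Suc t) 0 j * emb_state m off \<Phi> t z j"
  have S: "?s + bias \<Phi> (Suc t) 0 = dnn_fun \<Phi> (\<lambda>j. z (off + j))"
    using emb_row_sum[OF off, of 0 t z] w L by (simp add: dnn_fun_def)
  consider "i = k" | "i = m + k" | "i < 2 * m" "i \<noteq> k" "i \<noteq> m + k" | "2 * m \<le> i" by linarith
  then show "act (emb_width m \<Phi> t) (emb_last m off k \<Phi>) (emb_state m off \<Phi> t z) i
    = enc m (z(k := dnn_fun \<Phi> (\<lambda>j. z (off + j)))) i"
  proof cases
    case 1
    then show ?thesis using k S by (simp add: act_def emb_last_def L enc_def)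
  next
    case 2
    have "(\<Sum>j<emb_width m \<Phi> t. - emb_row m off \<Phi> (Suc t) 0 j * emb_state m off \<Phi> t z j) = - ?s"
      by (simp add: sum_negf)
    then show ?thesis using 2 k S[symmetric] by (simp add: act_def emb_last_def L enc_def)
  next
    case 3
    have "i < emb_width m \<Phi> t" using 3 emb_width_ge[of m \<Phi> t] by simp
    then show ?thesis using 3 k
      by (simp add: act_def emb_last_def sum_delta_row) (auto simp: emb_state_def enc_def)
  next
    case 4 then show ?thesis using k by (simp add: act_def emb_last_def enc_def)
  qed
qed

lemma card_emb_row:
  fixes r :: "nat \<Rightarrow> nat \<Rightarrow> nat"
  assumes Z: "Z = {(q, j). q < width \<Phi> l \<and> j < width \<Phi> (l - 1) \<and> wmat \<Phi> l q j \<noteq> 0}" and l: "1 \<le> l"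
  shows "card {(c q, j) |q j. q < width \<Phi> l \<and> j < n \<and> emb_row m off \<Phi> l q j \<noteq> 0} \<le> 2 * card Z"
proof -
  have fin: "finite Z" unfolding Z by (rule finite_support2)
  let ?f = "\<lambda>a (q, j). (c q, a + j)"
  let ?W = "?f off ` Z \<union> ?f (m + off) ` Z"
  have sub: "{(c q, j) |q j. q < width \<Phi> l \<and> j < n \<and> emb_row m off \<Phi> l q j \<noteq> 0} \<subseteq>
     (if l = 1 then ?f off ` Z \<union> ?f (m + off) ` Z else ?f (2 * m) ` Z)"
  proof clarify
    fix q j assume q: "q < width \<Phi> l" and nz: "emb_row m off \<Phi> l q j \<noteq> 0"
    have mem: "(c q, j) \<in> ?f a ` Z" if "window (wmat \<Phi> l q) a (width \<Phi> (l - 1)) j \<noteq> 0" for a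
      using that q by (intro image_eqI[of _ _ "(q, j - a)"]) (auto simp: window_def Z split: if_splits)
    show "(c q, j) \<in> (if l = 1 then ?f off ` Z \<union> ?f (m + off) ` Z else ?f (2 * m) ` Z)"
    proof (cases "l = 1")
      case True
      then have "window (wmat \<Phi> l q) off (width \<Phi> (l - 1)) j \<noteq> 0 \<or> window (wmat \<Phi> l q) (m + off) (width \<Phi> (l - 1)) j \<noteq> 0"
        using nz by (auto simp: emb_row_def)
      then show ?thesis using mem True by auto
    next
      case False
      then show ?thesis using nz mem by (auto simp: emb_row_def)
    qed
  qed
  have "card (if l = 1 then ?f off ` Z \<union> ?f (m + off) ` Z else ?f (2 * m) ` Z) \<le> 2 * card Z"
    using card_Un_le[of "?f off ` Z" "?f (m + off) ` Z"] card_image_le[OF fin, of "?f off"]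
      card_image_le[OF fin, of "?f (m + off)"] card_image_le[OF fin, of "?f (2 * m)"] by auto
  moreover have "finite (if l = 1 then ?f off ` Z \<union> ?f (m + off) ` Z else ?f (2 * m) ` Z)" using fin by auto
  ultimately show ?thesis using card_mono[OF _ sub] by (meson order_trans)
qed

lemma card_diag: "card {(i, j). i < (a::nat) \<and> j < (n::nat) \<and> j = i \<and> P i} \<le> a"
proof -
  have "card {(i, j). i < a \<and> j < n \<and> j = i \<and> P i} \<le> card ((\<lambda>i. (i, i)) ` {..<a})"
    by (rule card_mono) auto
  also have "\<dots> \<le> a" using card_image_le[of "{..<a}" "\<lambda>i. (i, i)"] by simp
  finally show ?thesis .
qed

lemma lsize_emb_hidden:
  assumes l: "1 \<le> l" shows "lsize n (emb_hidden m off \<Phi> l) \<le> 2 * m + 2 * layer_size \<Phi> l"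
proof -
  let ?Z = "{(q, j). q < width \<Phi> l \<and> j < width \<Phi> (l - 1) \<and> wmat \<Phi> l q j \<noteq> 0}"
  let ?A = "\<lambda>i j. if i < 2 * m then (if j = i then 1 else 0) else emb_row m off \<Phi> l (i - 2 * m) j"
  let ?R = "{(2 * m + q, j) |q j. q < width \<Phi> l \<and> j < n \<and> emb_row m off \<Phi> l q j \<noteq> 0}"
  have "{(i, j). i < 2 * m + width \<Phi> l \<and> j < n \<and> ?A i j \<noteq> 0} \<subseteq> {(i, j). i < 2 * m \<and> j < n \<and> j = i \<and> True} \<union> ?R"
  proof (rule subrelI)
    fix i j assume "(i, j) \<in> {(i, j). i < 2 * m + width \<Phi> l \<and> j < n \<and> ?A i j \<noteq> 0}"
    then have a: "i < 2 * m + width \<Phi> l" "j < n" "?A i j \<noteq> 0" by auto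
    show "(i, j) \<in> {(i, j). i < 2 * m \<and> j < n \<and> j = i \<and> True} \<union> ?R"
    proof (cases "i < 2 * m")
      case True then show ?thesis using a by (auto split: if_splits)
    next
      case False
      then have "(i, j) \<in> ?R" using a by (intro CollectI exI[of _ "i - 2 * m"] exI[of _ j]) auto
      then show ?thesis by blast
    qed
  qed
  moreover have fin: "finite ({(i, j). i < 2 * m \<and> j < n \<and> j = i \<and> True} \<union> ?R)"
    by (rule finite_subset[of _ "{..<2 * m + width \<Phi> l} \<times> {..<n}"]) auto
  ultimately have "card {(i, j). i < 2 * m + width \<Phi> l \<and> j < n \<and> ?A i j \<noteq> 0}
     \<le> card {(i, j). i < 2 * m \<and> j < n \<and> j = i \<and> True} + card ?R"
    by (meson card_mono card_Un_le order_trans)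
  also have "\<dots> \<le> 2 * m + 2 * card ?Z"
    by (intro add_mono card_diag card_emb_row[OF refl l])
  finally have A: "card {(i, j). i < 2 * m + width \<Phi> l \<and> j < n \<and> ?A i j \<noteq> 0} \<le> 2 * m + 2 * card ?Z" .
  have "{i. i < 2 * m + width \<Phi> l \<and> (if i < 2 * m then 0 else bias \<Phi> l (i - 2 * m)) \<noteq> 0}
     \<subseteq> (\<lambda>i. 2 * m + i) ` {i. i < width \<Phi> l \<and> bias \<Phi> l i \<noteq> 0}"
  proof clarify
    fix i assume "i < 2 * m + width \<Phi> l" "(if i < 2 * m then 0 else bias \<Phi> l (i - 2 * m)) \<noteq> 0"
    then show "i \<in> (\<lambda>i. 2 * m + i) ` {i. i < width \<Phi> l \<and> bias \<Phi> l i \<noteq> 0}"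
      by (intro image_eqI[of _ _ "i - 2 * m"]) (auto split: if_splits)
  qed
  then have "card {i. i < 2 * m + width \<Phi> l \<and> (if i < 2 * m then 0 else bias \<Phi> l (i - 2 * m)) \<noteq> 0}
     \<le> card {i. i < width \<Phi> l \<and> bias \<Phi> l i \<noteq> 0}"
    by (rule order_trans[OF card_mono card_image_le, rotated]) auto
  then show ?thesis using A by (simp add: lsize_def emb_hidden_def layer_size_def)
qed

lemma lsize_emb_last:
  assumes L: "1 \<le> depth \<Phi>" and w: "width \<Phi> (depth \<Phi>) = 1"
  shows "lsize n (emb_last m off k \<Phi>) \<le> 2 * m + 4 * layer_size \<Phi> (depth \<Phi>)"
proof -
  let ?l = "depth \<Phi>"
  let ?Z = "{(q, j). q < width \<Phi> ?l \<and> j < width \<Phi> (?l - 1) \<and> wmat \<Phi> ?l q j \<noteq> 0}"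
  let ?A = "\<lambda>i j. if i = k then emb_row m off \<Phi> ?l 0 j
            else if i = m + k then - emb_row m off \<Phi> ?l 0 j else if j = i then 1 else 0"
  let ?R = "\<lambda>i. {(i :: nat, j) |q j. q < width \<Phi> ?l \<and> j < n \<and> emb_row m off \<Phi> ?l q j \<noteq> 0}"
  let ?I = "{(i, j). i < 2 * m \<and> j < n \<and> j = i \<and> True}"
  have sub: "{(i, j). i < 2 * m \<and> j < n \<and> ?A i j \<noteq> 0} \<subseteq> ?I \<union> (?R k \<union> ?R (m + k))"
    using w by (auto split: if_splits)
  have fin: "finite (?I \<union> (?R k \<union> ?R (m + k)))"
    by (rule finite_subset[of _ "{..<2 * m + k + 1} \<times> {..<n}"]) auto
  have "card {(i, j). i < 2 * m \<and> j < n \<and> ?A i j \<noteq> 0} \<le> card ?I + (card (?R k) + card (?R (m + k)))"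
    using card_mono[OF fin sub] card_Un_le[of ?I "?R k \<union> ?R (m + k)"] card_Un_le[of "?R k" "?R (m + k)"] by linarith
  also have "\<dots> \<le> 2 * m + (2 * card ?Z + 2 * card ?Z)"
    by (intro add_mono card_diag card_emb_row[OF refl L])
  finally have A: "card {(i, j). i < 2 * m \<and> j < n \<and> ?A i j \<noteq> 0} \<le> 2 * m + 4 * card ?Z" by simp
  let ?b = "\<lambda>i. if i = k then bias \<Phi> ?l 0 else if i = m + k then - bias \<Phi> ?l 0 else 0"
  let ?Y = "{i. i < width \<Phi> ?l \<and> bias \<Phi> ?l i \<noteq> 0}"
  have "{i. i < 2 * m \<and> ?b i \<noteq> 0} \<subseteq> (\<lambda>_. k) ` ?Y \<union> (\<lambda>_. m + k) ` ?Y"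
    using w by (auto split: if_splits)
  then have "card {i. i < 2 * m \<and> ?b i \<noteq> 0} \<le> card ((\<lambda>_. k) ` ?Y \<union> (\<lambda>_. m + k) ` ?Y)"
    by (rule card_mono[rotated]) auto
  also have "\<dots> \<le> card ((\<lambda>_. k) ` ?Y) + card ((\<lambda>_. m + k) ` ?Y)" by (rule card_Un_le)
  also have "\<dots> \<le> card ?Y + card ?Y" by (intro add_mono card_image_le) auto
  finally show ?thesis using A by (simp add: lsize_def emb_last_def layer_size_def)
qed

text \<open>
  Each layer keeps the registers at the cost of \<open>2 * m\<close> weights. The weights of the network itself are duplicated in the
  first layer, which reads two parts, and in the last one, which writes two parts; a single layer does both.
\<close>

lemma realizes_dnn_by_depth:
  assumes n: "is_dnn p 1 \<Phi>" and off: "off + p \<le> m" and k: "k < m"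
  shows "realizes m (2 * m * depth \<Phi> + 4 * dnn_size \<Phi>) (\<lambda>z. z(k := dnn_fun \<Phi> (\<lambda>j. z (off + j))))"
proof -
  obtain t where L: "depth \<Phi> = Suc t" using n unfolding is_dnn_def by (metis Suc_le_D One_nat_def)
  have w: "width \<Phi> (Suc t) = 1" "width \<Phi> 0 = p" using n L unfolding is_dnn_def by auto
  have off': "off + width \<Phi> 0 \<le> m" using off w by simp
  let ?hs = "map (emb_hidden m off \<Phi>) [1..<Suc t]"
  let ?ls = "?hs @ [emb_last m off k \<Phi>]"
  have hsize: "lssize (2 * m) (map (emb_hidden m off \<Phi>) [1..<Suc r]) \<le> 2 * m * r + 4 * (\<Sum>l=1..r. layer_size \<Phi> l)" for r
  proof (induction r)
    case (Suc r)
    have e: "[1..<Suc (Suc r)] = [1..<Suc r] @ [Suc r]" by simp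
    show ?case unfolding e using Suc lsize_emb_hidden[of "Suc r" "emb_width m \<Phi> r" m off \<Phi>] run_emb_hidden[OF off', of r]
      by (simp add: lssize_append del: upt_Suc)
  qed simp
  show ?thesis unfolding realizes_def
  proof (intro exI[of _ ?ls] conjI allI)
    show "\<forall>l\<in>set ?ls. 0 < fst l" using k by (auto simp: emb_hidden_def emb_last_def)
    show "outw (2 * m) ?ls = 2 * m" by (simp add: outw_append emb_last_def)
    show "lssize (2 * m) ?ls \<le> 2 * m * depth \<Phi> + 4 * dnn_size \<Phi>"
      using hsize[of t] lsize_emb_last[of \<Phi> "emb_width m \<Phi> t" m off k] run_emb_hidden[OF off', of t] w L
      unfolding dnn_size_layers by (simp add: lssize_append del: upt_Suc)
    fix z
    show "run (2 * m) ?ls (enc m z) = enc m (z(k := dnn_fun \<Phi> (\<lambda>j. z (off + j))))"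
      using run_emb_hidden[OF off', of t z] act_emb_last[OF off' k L w(1), of z]
      by (simp add: run_append del: upt_Suc)
  qed
qed

lemma realizes_dnn:
  assumes n: "is_dnn p 1 \<Phi>" and off: "off + p \<le> m" and k: "k < m"
  shows "realizes m (6 * m * (dnn_size \<Phi> + 1)) (\<lambda>z. z(k := dnn_fun \<Phi> (\<lambda>j. z (off + j))))"
proof -
  obtain \<Psi> where P: "is_dnn p 1 \<Psi>" "depth \<Psi> \<le> dnn_size \<Phi> + 1" "dnn_size \<Psi> \<le> dnn_size \<Phi> + 1"
    "\<And>x. dnn_fun \<Psi> x = dnn_fun \<Phi> x" using shallow_equivalent[OF n] by metis
  have "2 * m * depth \<Psi> + 4 * dnn_size \<Psi> \<le> 2 * m * (dnn_size \<Phi> + 1) + 4 * (dnn_size \<Phi> + 1)"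
    using P by (intro add_mono mult_left_mono) auto
  also have "\<dots> \<le> 2 * m * (dnn_size \<Phi> + 1) + 4 * m * (dnn_size \<Phi> + 1)"
    using k by (intro add_left_mono mult_right_mono) auto
  finally have "2 * m * depth \<Psi> + 4 * dnn_size \<Psi> \<le> 6 * m * (dnn_size \<Phi> + 1)" by simp
  from realizes_mono[OF realizes_dnn_by_depth[OF P(1) off k] this] show ?thesis by (simp add: P(4))
qed

text \<open>
  The affine functions of the registers, as the inputs of hidden neurons.
\<close>

definition linform :: "nat \<Rightarrow> (point \<Rightarrow> real) \<Rightarrow> bool" where
  "linform m l \<longleftrightarrow> (\<exists>a b. \<forall>z. l z = (\<Sum>j<m. a j * z j) + b)"

lemma linform_const: "linform m (\<lambda>z. c)"
  unfolding linform_def by (intro exI[of _ "\<lambda>_. 0"] exI[of _ c]) simp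

lemma linform_coord: "k < m \<Longrightarrow> linform m (\<lambda>z. z k)"
  unfolding linform_def by (intro exI[of _ "\<lambda>j. if j = k then 1 else 0"] exI[of _ 0]) (simp add: sum_delta_row)

lemma linform_add: "linform m l \<Longrightarrow> linform m l' \<Longrightarrow> linform m (\<lambda>z. l z + l' z)"
  unfolding linform_def
proof (elim exE)
  fix a b a' b' assume "\<forall>z. l z = (\<Sum>j<m. a j * z j) + b" "\<forall>z. l' z = (\<Sum>j<m. a' j * z j) + b'"
  then show "\<exists>a b. \<forall>z. l z + l' z = (\<Sum>j<m. a j * z j) + b"
    by (intro exI[of _ "\<lambda>j. a j + a' j"] exI[of _ "b + b'"]) (simp add: sum.distrib distrib_right)
qed

lemma linform_cmult: "linform m l \<Longrightarrow> linform m (\<lambda>z. c * l z)"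
  unfolding linform_def
proof (elim exE)
  fix a b assume "\<forall>z. l z = (\<Sum>j<m. a j * z j) + b"
  then show "\<exists>a b. \<forall>z. c * l z = (\<Sum>j<m. a j * z j) + b"
    by (intro exI[of _ "\<lambda>j. c * a j"] exI[of _ "c * b"]) (simp add: sum_distrib_left distrib_left mult.assoc)
qed

lemma linform_diff: "linform m l \<Longrightarrow> linform m l' \<Longrightarrow> linform m (\<lambda>z. l z - l' z)"
  using linform_add[of m l "\<lambda>z. (-1) * l' z"] linform_cmult[of m l' "-1"] by simp

lemmas linform_intros = linform_const linform_coord linform_add linform_cmult linform_diff

text \<open>
  One hidden layer with two neurons covers affine assignments, positive parts, absolute values and the tent map.
\<close>

lemma realizes_two_neurons:
  assumes l: "linform m l1" "linform m l2" and k: "k < m"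
  shows "realizes m (30 * m) (\<lambda>z. z(k := c1 * max 0 (l1 z) + c2 * max 0 (l2 z)))"
proof -
  obtain a1 b1 where 1: "\<And>z. l1 z = (\<Sum>j<m. a1 j * z j) + b1" using l unfolding linform_def by blast
  obtain a2 b2 where 2: "\<And>z. l2 z = (\<Sum>j<m. a2 j * z j) + b2" using l unfolding linform_def by blast
  define \<Phi> where "\<Phi> = \<lparr>depth = 2, width = (\<lambda>l. if l = 0 then m else if l = 1 then 2 else 1),
    wmat = (\<lambda>l i j. if l = 1 then (if i = 0 then a1 j else a2 j) else if j = 0 then c1 else c2),
    bias = (\<lambda>l i. if l = 1 then (if i = 0 then b1 else b2) else 0)\<rparr>"
  have n: "is_dnn m 1 \<Phi>" using k by (auto simp: is_dnn_def \<Phi>_def)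
  have f: "dnn_fun \<Phi> z = c1 * max 0 (l1 z) + c2 * max 0 (l2 z)" for z
    by (simp add: dnn_fun_def \<Phi>_def affine_layer_def 1 2 numeral_2_eq_2)
  have L1: "layer_size \<Phi> 1 \<le> 2 * m + 2"
  proof -
    have "layer_size \<Phi> 1 \<le> card ({..<2::nat} \<times> {..<m}) + card {..<2::nat}"
      unfolding layer_size_def by (intro add_mono card_mono) (auto simp: \<Phi>_def)
    then show ?thesis by simp
  qed
  have L2: "layer_size \<Phi> 2 \<le> 2"
  proof -
    have "layer_size \<Phi> 2 \<le> card ({..<1::nat} \<times> {..<2::nat}) + card ({}::nat set)"
      unfolding layer_size_def by (intro add_mono card_mono) (auto simp: \<Phi>_def)
    then show ?thesis by simp
  qed
  have "dnn_size \<Phi> = layer_size \<Phi> 1 + layer_size \<Phi> 2"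
    unfolding dnn_size_layers by (simp add: \<Phi>_def numeral_2_eq_2)
  then have s: "dnn_size \<Phi> \<le> 2 * m + 4" using L1 L2 by simp
  have "2 * m * depth \<Phi> + 4 * dnn_size \<Phi> \<le> 30 * m" using s k by (simp add: \<Phi>_def)
  from realizes_mono[OF realizes_dnn_by_depth[OF n _ k, of 0] this] show ?thesis by (simp add: f)
qed

lemma realizes_assign:
  assumes "linform m l" "k < m" shows "realizes m (30 * m) (\<lambda>z. z(k := l z))"
proof -
  have e: "l z = 1 * max 0 (l z) + (-1) * max 0 ((-1) * l z)" for z by (auto simp: max_def)
  show ?thesis by (subst e) (intro realizes_two_neurons linform_intros assms)
qed

lemma realizes_relu:
  assumes "linform m l" "k < m" shows "realizes m (30 * m) (\<lambda>z. z(k := max 0 (l z)))"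
  using realizes_two_neurons[of m l l k 1 0] assms by simp

lemma realizes_abs:
  assumes "linform m l" "k < m" shows "realizes m (30 * m) (\<lambda>z. z(k := \<bar>l z\<bar>))"
proof -
  have e: "\<bar>l z\<bar> = 1 * max 0 (l z) + 1 * max 0 ((-1) * l z)" for z by (auto simp: max_def)
  show ?thesis by (subst e) (intro realizes_two_neurons linform_intros assms)
qed

text \<open>
  On the unit interval this is \<open>min (2 * t) (2 - 2 * t)\<close>.
\<close>

definition tent :: "real \<Rightarrow> real" where "tent t = 2 * max 0 t + (-4) * max 0 (t - 1/2)"

lemma realizes_tent: "k < m \<Longrightarrow> realizes m (30 * m) (\<lambda>z. z(k := tent (z k)))"
  unfolding tent_def by (intro realizes_two_neurons linform_intros) auto

text \<open>
  The partial sums of Yarotsky's expansion of the square into iterates of the tent map.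
\<close>

definition sqr :: "nat \<Rightarrow> real \<Rightarrow> real" where
  "sqr k y = y - (\<Sum>j<k. (tent ^^ Suc j) y / 4 ^ Suc j)"

lemma tent_range: "0 \<le> y \<Longrightarrow> y \<le> 1 \<Longrightarrow> 0 \<le> tent y \<and> tent y \<le> 1"
  unfolding tent_def by (auto simp: max_def)

lemma tent_iter_range: "0 \<le> y \<Longrightarrow> y \<le> 1 \<Longrightarrow> 0 \<le> (tent ^^ k) y \<and> (tent ^^ k) y \<le> 1"
  by (induction k) (auto dest: tent_range)

text \<open>
  The function \<open>p y = y - y\<^sup>2\<close> satisfies \<open>p y = tent y / 4 + p (tent y) / 4\<close>; iteration yields the expansion.
\<close>

lemma tent_identity: "0 \<le> y \<Longrightarrow> y \<le> 1 \<Longrightarrow> y - y\<^sup>2 = tent y / 4 + (tent y - (tent y)\<^sup>2) / 4"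
  unfolding tent_def by (cases "y \<le> 1/2") (auto simp: max_def power2_eq_square field_simps)

lemma sqr_error:
  assumes y: "0 \<le> y" "y \<le> 1"
  shows "sqr k y - y\<^sup>2 = ((tent ^^ k) y - ((tent ^^ k) y)\<^sup>2) / 4 ^ k"
proof (induction k)
  case 0 show ?case by (simp add: sqr_def)
next
  case (Suc k)
  have "sqr (Suc k) y - y\<^sup>2 = sqr k y - y\<^sup>2 - (tent ^^ Suc k) y / 4 ^ Suc k"
    by (simp add: sqr_def)
  also have "\<dots> = ((tent ^^ k) y - ((tent ^^ k) y)\<^sup>2) / 4 ^ k - (tent ^^ Suc k) y / 4 ^ Suc k"
    using Suc by simp
  also have "\<dots> = ((tent ^^ Suc k) y - ((tent ^^ Suc k) y)\<^sup>2) / 4 ^ Suc k"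
  proof -
    have "a / 4 ^ k - b / 4 ^ Suc k = (b - b\<^sup>2) / 4 ^ Suc k" if "a = b / 4 + (b - b\<^sup>2) / 4" for a b :: real
      unfolding that by (simp add: diff_divide_distrib add_divide_distrib)
    from this[OF tent_identity[of "(tent ^^ k) y"]] show ?thesis using tent_iter_range[OF y, of k] by simp
  qed
  finally show ?case .
qed

lemma sqr_approx:
  assumes y: "0 \<le> y" "y \<le> 1"
  shows "\<bar>sqr k y - y\<^sup>2\<bar> \<le> 1 / 4 ^ k" "0 \<le> sqr k y" "sqr k y \<le> 1"
proof -
  let ?t = "(tent ^^ k) y"
  have t: "0 \<le> ?t" "?t \<le> 1" using tent_iter_range[OF y] by auto
  have p: "0 \<le> ?t - ?t\<^sup>2" "?t - ?t\<^sup>2 \<le> 1"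
    using t zero_le_power2[of ?t] by (simp add: power2_eq_square mult_left_le_one_le) (use t zero_le_power2[of ?t] in linarith)
  have e: "sqr k y - y\<^sup>2 = (?t - ?t\<^sup>2) / 4 ^ k" by (rule sqr_error[OF y])
  show "\<bar>sqr k y - y\<^sup>2\<bar> \<le> 1 / 4 ^ k" unfolding e using p by (simp add: divide_right_mono)
  have "0 \<le> sqr k y - y\<^sup>2" unfolding e using p by simp
  moreover have "0 \<le> y\<^sup>2" by simp
  ultimately show "0 \<le> sqr k y" by linarith
  have "0 \<le> (\<Sum>j<k. (tent ^^ Suc j) y / 4 ^ Suc j)"
    by (intro sum_nonneg divide_nonneg_nonneg) (use tent_iter_range[OF y] in blast, simp)
  then show "sqr k y \<le> 1" using y unfolding sqr_def by linarith
qed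

text \<open>
  Every step replaces the register \<open>t\<close> by its tent map and adds it to \<open>out\<close> with the weight of the expansion. The final
  value of \<open>t\<close> is recorded since the induction needs it.
\<close>

lemma realizes_add_sqr:
  assumes "t < m" "out < m" "t \<noteq> out"
  shows "realizes m (60 * m * (k + 1)) (\<lambda>z. z(t := (tent ^^ k) (z t), out := z out + c * sqr k (z t)))"
proof (induction k)
  case 0
  have "realizes m (30 * m) (\<lambda>z. z(out := z out + c * z t))"
    using assms by (intro realizes_assign linform_intros)
  then have "realizes m (30 * m) (\<lambda>z. z(t := (tent ^^ 0) (z t), out := z out + c * sqr 0 (z t)))"
    by (simp add: sqr_def)
  then show ?case by (rule realizes_mono) simp
next
  case (Suc k)
  have 1: "realizes m (30 * m) (\<lambda>z. z(t := tent (z t)))" using assms by (intro realizes_tent)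
  have 2: "realizes m (30 * m) (\<lambda>z. z(out := z out + (- (c / 4 ^ Suc k)) * z t))"
    using assms by (intro realizes_assign linform_intros)
  have e: "(\<lambda>z. (((z(t := (tent ^^ k) (z t), out := z out + c * sqr k (z t)))
       (t := tent ((z(t := (tent ^^ k) (z t), out := z out + c * sqr k (z t))) t))))
       (out := (((z(t := (tent ^^ k) (z t), out := z out + c * sqr k (z t)))
       (t := tent ((z(t := (tent ^^ k) (z t), out := z out + c * sqr k (z t))) t)))) out
         + (- (c / 4 ^ Suc k)) * (((z(t := (tent ^^ k) (z t), out := z out + c * sqr k (z t)))
       (t := tent ((z(t := (tent ^^ k) (z t), out := z out + c * sqr k (z t))) t)))) t))
     = (\<lambda>z. z(t := (tent ^^ Suc k) (z t), out := z out + c * sqr (Suc k) (z t)))"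
    using assms(3) by (auto simp: fun_eq_iff sqr_def algebra_simps)
  show ?case using realizes_comp[OF realizes_comp[OF Suc 1] 2] unfolding e
    by (rule realizes_mono) simp
qed

section \<open>From programs to networks\<close>

text \<open>
  An initial layer splits the inputs into positive and negative parts, and an output layer without activation recombines
  the two parts of the register \<open>out\<close>.
\<close>

lemma program_to_dnn:
  assumes F: "realizes m s F" and d: "1 \<le> d" "d \<le> m" and out: "out < m"
  shows "\<exists>\<Phi>. is_dnn d 1 \<Phi> \<and> dnn_size \<Phi> \<le> s + 2 * d + 2 \<and>
     (\<forall>x. dnn_fun \<Phi> x = c * F (\<lambda>j. if j < d then x j else 0) out)"
proof -
  obtain ls where ls: "\<forall>l\<in>set ls. 0 < fst l" "outw (2 * m) ls = 2 * m" "lssize (2 * m) ls \<le> s"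
    "\<And>z. run (2 * m) ls (enc m z) = enc m (F z)" using F unfolding realizes_def by blast
  define E :: layer where "E = (2 * m, (\<lambda>i j. if i = j then 1 else if i = m + j then -1 else 0), (\<lambda>_. 0))"
  define LL where "LL = E # ls"
  define N where "N = length LL"
  define \<Phi> where "\<Phi> = \<lparr>depth = Suc N,
     width = (\<lambda>l. if l = 0 then d else if l \<le> N then fst (LL ! (l - 1)) else 1),
     wmat = (\<lambda>l i j. if l \<le> N then fst (snd (LL ! (l - 1))) i j else if j = out then c else if j = m + out then - c else 0),
     bias = (\<lambda>l i. if l \<le> N then snd (snd (LL ! (l - 1))) i else 0)\<rparr>"
  have N1: "1 \<le> N" by (simp add: N_def LL_def)
  have pos: "0 < fst (LL ! i)" if "i < N" for i
  proof -
    have "LL ! i \<in> set LL" using that by (simp add: N_def)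
    then show ?thesis using ls(1) d by (auto simp: LL_def E_def)
  qed
  have n: "is_dnn d 1 \<Phi>" using d pos N1 by (auto simp: is_dnn_def \<Phi>_def)
  have wd: "outw d (take t LL) = width \<Phi> t" if "t \<le> N" for t
    using that
  proof (cases t)
    case (Suc k)
    then have "take t LL = take k LL @ [LL ! k]" using that by (simp add: take_Suc_conv_app_nth N_def)
    then show ?thesis using Suc that by (simp add: outw_append \<Phi>_def)
  qed (simp add: \<Phi>_def)
  have sem: "\<forall>i<width \<Phi> (Suc t). max 0 (dnn_layer \<Phi> t x i) = run d (take (Suc t) LL) x i" if "t < N" for t x
    using that
  proof (induction t)
    case 0
    have "take (Suc 0) LL = [LL ! 0]" by (simp add: LL_def)
    then show ?case using 0 wd[of 0]
      by (cases "LL ! 0") (auto simp: affine_layer_def act_def \<Phi>_def)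
  next
    case (Suc t)
    have e: "take (Suc (Suc t)) LL = take (Suc t) LL @ [LL ! Suc t]"
      using Suc.prems by (simp add: take_Suc_conv_app_nth N_def)
    obtain w A b where l: "LL ! Suc t = (w, A, b)" by (cases "LL ! Suc t")
    have W: "width \<Phi> (Suc (Suc t)) = w" "wmat \<Phi> (Suc (Suc t)) = A" "bias \<Phi> (Suc (Suc t)) = b"
      using Suc.prems l by (auto simp: \<Phi>_def)
    have o: "outw d (take (Suc t) LL) = width \<Phi> (Suc t)" using wd[of "Suc t"] Suc.prems by simp
    show ?case
    proof (intro allI impI)
      fix i assume i: "i < width \<Phi> (Suc (Suc t))"
      have "(\<Sum>j<width \<Phi> (Suc t). A i j * max 0 (dnn_layer \<Phi> t x j)) =
          (\<Sum>j<width \<Phi> (Suc t). A i j * run d (take (Suc t) LL) x j)"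
        using Suc.IH Suc.prems by (intro sum.cong) auto
      then show "max 0 (dnn_layer \<Phi> (Suc t) x i) = run d (take (Suc (Suc t)) LL) x i"
        using i unfolding e run_append o by (simp add: l act_def affine_layer_def W)
    qed
  qed
  have first: "act d E x = enc m (\<lambda>j. if j < d then x j else 0)" for x
  proof
    fix i
    consider "i < m" | "m \<le> i" "i < 2 * m" | "2 * m \<le> i" by linarith
    then show "act d E x i = enc m (\<lambda>j. if j < d then x j else 0) i"
    proof cases
      case 1
      have "(\<Sum>j<d. (if i = j then 1 else if i = m + j then -1 else 0) * x j) = (\<Sum>j<d. if j = i then x j else 0)"
        using 1 by (intro sum.cong) auto
      then show ?thesis using 1 by (simp add: act_def E_def enc_def)
    next
      case 2
      have "(\<Sum>j<d. (if i = j then 1 else if i = m + j then -1 else 0) * x j) = (\<Sum>j<d. if j = i - m then - x j else 0)"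
        using 2 d by (intro sum.cong) auto
      then show ?thesis using 2 by (simp add: act_def E_def enc_def)
    next
      case 3 then show ?thesis by (simp add: act_def E_def enc_def)
    qed
  qed
  have full: "run d LL x = enc m (F (\<lambda>j. if j < d then x j else 0))" for x
    using ls(4) by (simp add: LL_def first) (simp add: E_def)
  have wN: "width \<Phi> N = 2 * m"
    using wd[of N] ls(2) by (simp add: N_def) (simp add: LL_def E_def)
  have val: "dnn_fun \<Phi> x = c * F (\<lambda>j. if j < d then x j else 0) out" for x
  proof -
    obtain t where t: "N = Suc t" using N1 by (metis Suc_le_D One_nat_def)
    let ?v = "F (\<lambda>j. if j < d then x j else 0)"
    have "dnn_fun \<Phi> x = dnn_layer \<Phi> (Suc t) x 0" using t by (simp add: dnn_fun_def \<Phi>_def)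
    also have "\<dots> = (\<Sum>j<width \<Phi> (Suc t). wmat \<Phi> (Suc (Suc t)) 0 j * max 0 (dnn_layer \<Phi> t x j))"
      using t by (simp add: affine_layer_def) (simp add: \<Phi>_def)
    also have "\<dots> = (\<Sum>j<2 * m. wmat \<Phi> (Suc (Suc t)) 0 j * enc m ?v j)"
      using sem[of t x] wN t full[of x] by (intro sum.cong) (auto simp: N_def)
    also have "\<dots> = (\<Sum>j<2 * m. (if j = out then c * enc m ?v j else 0) + (if j = m + out then - c * enc m ?v j else 0))"
      using t out by (intro sum.cong) (auto simp: \<Phi>_def)
    also have "\<dots> = c * enc m ?v out - c * enc m ?v (m + out)" using out by (simp add: sum.distrib)
    also have "\<dots> = c * ?v out" using out by (auto simp: enc_def max_def)
    finally show ?thesis .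
  qed
  have sizes: "lssize d (take t LL) = (\<Sum>l=1..t. layer_size \<Phi> l)" if "t \<le> N" for t
    using that
  proof (induction t)
    case (Suc t)
    have e: "take (Suc t) LL = take t LL @ [LL ! t]"
      using Suc.prems by (simp add: take_Suc_conv_app_nth N_def)
    obtain w A b where l: "LL ! t = (w, A, b)" by (cases "LL ! t")
    have W: "width \<Phi> (Suc t) = w" "wmat \<Phi> (Suc t) = A" "bias \<Phi> (Suc t) = b"
      using Suc.prems l by (auto simp: \<Phi>_def)
    have o: "outw d (take t LL) = width \<Phi> t" using wd[of t] Suc.prems by simp
    have "lsize (width \<Phi> t) (LL ! t) = layer_size \<Phi> (Suc t)"
      by (simp add: l lsize_def layer_size_def W)
    then show ?case using Suc by (simp add: e lssize_append o)
  qed simp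
  have "lsize d E \<le> 2 * d"
  proof -
    have "{(i, j). i < 2 * m \<and> j < d \<and> (if i = j then 1 else if i = m + j then -1 else (0::real)) \<noteq> 0}
      \<subseteq> (\<lambda>j. (j, j)) ` {..<d} \<union> (\<lambda>j. (m + j, j)) ` {..<d}" by (auto split: if_splits)
    then have "card {(i, j). i < 2 * m \<and> j < d \<and> (if i = j then 1 else if i = m + j then -1 else (0::real)) \<noteq> 0}
      \<le> card ((\<lambda>j. (j, j)) ` {..<d} \<union> (\<lambda>j. (m + j, j)) ` {..<d})" by (rule card_mono[rotated]) auto
    also have "\<dots> \<le> card ((\<lambda>j. (j, j)) ` {..<d}) + card ((\<lambda>j. (m + j, j)) ` {..<d})" by (rule card_Un_le)
    also have "\<dots> \<le> card {..<d} + card {..<d}" by (intro add_mono card_image_le) auto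
    finally show ?thesis by (simp add: lsize_def E_def)
  qed
  moreover have "layer_size \<Phi> (Suc N) \<le> 2"
  proof -
    have "{(i, j). i < width \<Phi> (Suc N) \<and> j < width \<Phi> (Suc N - 1) \<and> wmat \<Phi> (Suc N) i j \<noteq> 0} \<subseteq> {(0, out), (0, m + out)}"
      by (auto simp: \<Phi>_def split: if_splits)
    then have "card {(i, j). i < width \<Phi> (Suc N) \<and> j < width \<Phi> (Suc N - 1) \<and> wmat \<Phi> (Suc N) i j \<noteq> 0} \<le> card {(0::nat, out), (0, m + out)}"
      by (rule card_mono[rotated]) auto
    also have "\<dots> \<le> 2" by (simp add: card_insert_if)
    finally show ?thesis by (simp add: layer_size_def) (simp add: \<Phi>_def)
  qed
  moreover have "dnn_size \<Phi> = lssize d LL + layer_size \<Phi> (Suc N)"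
    using sizes[of N] by (simp add: dnn_size_layers N_def) (simp add: \<Phi>_def N_def)
  moreover have "lssize d LL = lsize d E + lssize (2 * m) ls" by (simp add: LL_def) (simp add: E_def)
  ultimately have "dnn_size \<Phi> \<le> s + 2 * d + 2" using ls(3) by linarith
  then show ?thesis using n val by blast
qed


section \<open>A network for one trajectory\<close>

text \<open>
  The registers \<open>0..<d\<close> hold the starting point, the registers \<open>d..<2 * d\<close> the current point of the walk.
  Register \<open>2 * d + 3\<close> accumulates the payoffs, and the three registers before it are used for intermediate results.
\<close>

definition xpart :: "nat \<Rightarrow> point \<Rightarrow> point" where "xpart d z = (\<lambda>j\<in>{..<d}. z j)"
definition ypart :: "nat \<Rightarrow> point \<Rightarrow> point" where "ypart d z = (\<lambda>j\<in>{..<d}. z (d + j))"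

lemma xpart_upd: "d \<le> k \<Longrightarrow> xpart d (z(k := v)) = xpart d z"
  by (auto simp: xpart_def fun_eq_iff restrict_def)
lemma ypart_upd: "2 * d \<le> k \<Longrightarrow> ypart d (z(k := v)) = ypart d z"
  by (auto simp: ypart_def fun_eq_iff restrict_def)
lemma ypart_upd_coord: "i < d \<Longrightarrow> ypart d (z(d + i := v)) = (ypart d z)(i := v)"
  by (auto simp: ypart_def fun_eq_iff restrict_def)
lemma dnn_fun_ypart: "is_dnn d 1 \<Phi> \<Longrightarrow> dnn_fun \<Phi> (\<lambda>j. z (d + j)) = dnn_fun \<Phi> (ypart d z)"
  by (rule dnn_fun_cong) (auto simp: ypart_def)

text \<open>
  The product \<open>a\<^sup>2 * b\<close> by polarization, with both squares and the square of \<open>a\<close> replaced by \<open>sqr k\<close>.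
\<close>

definition product_net :: "nat \<Rightarrow> real \<Rightarrow> real \<Rightarrow> real" where
  "product_net k a b = sqr k \<bar>sqr k a / 2 + b / 2\<bar> - sqr k \<bar>sqr k a / 2 - b / 2\<bar>"

lemma product_net_approx:
  assumes a: "0 \<le> a" "a \<le> 1" and b: "\<bar>b\<bar> \<le> 1"
  shows "\<bar>product_net k a b - a\<^sup>2 * b\<bar> \<le> 3 / 4 ^ k" "\<bar>product_net k a b\<bar> \<le> 1"
proof -
  let ?q = "sqr k a"
  have q: "0 \<le> ?q" "?q \<le> 1" "\<bar>?q - a\<^sup>2\<bar> \<le> 1 / 4 ^ k" using sqr_approx[OF a] by auto
  have p: "0 \<le> \<bar>?q / 2 + b / 2\<bar>" "\<bar>?q / 2 + b / 2\<bar> \<le> 1" "0 \<le> \<bar>?q / 2 - b / 2\<bar>" "\<bar>?q / 2 - b / 2\<bar> \<le> 1"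
    using q b by auto
  note s1 = sqr_approx[OF p(1,2), of k] and s2 = sqr_approx[OF p(3,4), of k]
  have pol: "(?q / 2 + b / 2)\<^sup>2 - (?q / 2 - b / 2)\<^sup>2 = ?q * b" by (simp add: power2_eq_square field_simps)
  have "\<bar>product_net k a b - ?q * b\<bar> \<le> 2 / 4 ^ k"
    using s1(1) s2(1) unfolding product_net_def pol[symmetric] power2_abs by linarith
  moreover have "\<bar>?q * b - a\<^sup>2 * b\<bar> \<le> 1 / 4 ^ k"
  proof -
    have "\<bar>?q * b - a\<^sup>2 * b\<bar> = \<bar>?q - a\<^sup>2\<bar> * \<bar>b\<bar>" by (simp add: abs_mult[symmetric] left_diff_distrib)
    also have "\<dots> \<le> 1 / 4 ^ k * 1" using q b by (intro mult_mono) auto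
    finally show ?thesis by simp
  qed
  ultimately show "\<bar>product_net k a b - a\<^sup>2 * b\<bar> \<le> 3 / 4 ^ k" by linarith
  show "\<bar>product_net k a b\<bar> \<le> 1" using s1(2,3) s2(2,3) unfolding product_net_def by linarith
qed

context walk begin

text \<open>
  The payoff at the stopping time. The step size and \<open>f\<close> are normalized by \<open>R1\<close> and \<open>F1\<close> because squares are computed on
  the unit interval; \<open>\<kappa>\<close> restores the scale.
\<close>

definition payoff :: "relu_dnn \<Rightarrow> relu_dnn \<Rightarrow> nat \<Rightarrow> real \<Rightarrow> real \<Rightarrow> real \<Rightarrow> point \<Rightarrow> real" where
  "payoff \<Phi>f \<Phi>g k R1 F1 \<kappa> y = dnn_fun \<Phi>g y + \<kappa> * product_net k (rad y / R1) (dnn_fun \<Phi>f y / F1)"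

abbreviation regs :: nat where "regs \<equiv> 2 * d + 4"

lemma path_program:
  assumes net: "is_dnn d 1 \<Phi>d" and rad_net: "\<And>x. rad x = max 0 (dnn_fun \<Phi>d x - 3 * \<epsilon>)"
    and \<sigma>: "\<sigma> \<in> paths n"
  shows "\<exists>F. realizes regs (n * (6 * regs * (dnn_size \<Phi>d + 1) + 60 * regs)) F \<and>
    (\<forall>z. ypart d (F z) = \<sigma> (ypart d z) \<and> xpart d (F z) = xpart d z \<and> F z (2 * d + 3) = z (2 * d + 3))"
  using \<sigma>
proof (induction n arbitrary: \<sigma>)
  case 0
  show ?case using 0 realizes_id[of regs] by (intro exI[of _ "\<lambda>z. z"]) auto
next
  case (Suc n)
  let ?c = "6 * regs * (dnn_size \<Phi>d + 1) + 60 * regs"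
  obtain \<sigma>' i s where \<sigma>: "\<sigma> = (\<lambda>x. \<sigma>' (step i s x))" "\<sigma>' \<in> paths n" and i: "i < d"
    using Suc.prems by auto
  obtain F where F: "realizes regs (n * ?c) F"
    "\<And>z. ypart d (F z) = \<sigma>' (ypart d z)" "\<And>z. xpart d (F z) = xpart d z" "\<And>z. F z (2 * d + 3) = z (2 * d + 3)"
    using Suc.IH[OF \<sigma>(2)] by blast
  let ?T = "2 * d"
  define P1 where "P1 = (\<lambda>z::point. z(?T := dnn_fun \<Phi>d (\<lambda>j. z (d + j))))"
  define P2 where "P2 = (\<lambda>z::point. z(?T := max 0 (z ?T - 3 * \<epsilon>)))"
  define P3 where "P3 = (\<lambda>z::point. z(d + i := z (d + i) + (s * \<gamma>) * z ?T))"
  have r1: "realizes regs (6 * regs * (dnn_size \<Phi>d + 1)) P1"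
    unfolding P1_def by (rule realizes_dnn[OF net]) auto
  have r2: "realizes regs (30 * regs) P2"
    unfolding P2_def by (intro realizes_relu linform_intros) auto
  have r3: "realizes regs (30 * regs) P3"
    unfolding P3_def using i by (intro realizes_assign linform_intros) auto
  have R: "realizes regs (Suc n * ?c) (\<lambda>z. F (P3 (P2 (P1 z))))"
    using realizes_comp[OF realizes_comp[OF realizes_comp[OF r1 r2] r3] F(1)] by (rule realizes_mono) simp
  have "ypart d (P3 (P2 (P1 z))) = step i s (ypart d z) \<and> xpart d (P3 (P2 (P1 z))) = xpart d z
      \<and> P3 (P2 (P1 z)) (2 * d + 3) = z (2 * d + 3)" for z
  proof -
    have T2: "P2 (P1 z) ?T = rad (ypart d z)"
      by (simp add: P2_def P1_def rad_net dnn_fun_ypart[OF net])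
    have y2: "ypart d (P2 (P1 z)) = ypart d z" by (simp add: P2_def P1_def ypart_upd)
    have x2: "xpart d (P2 (P1 z)) = xpart d z" by (simp add: P2_def P1_def xpart_upd)
    have a2: "P2 (P1 z) (2 * d + 3) = z (2 * d + 3)" by (simp add: P2_def P1_def)
    have c2: "P2 (P1 z) (d + i) = ypart d z i" using i by (simp add: P2_def P1_def ypart_def)
    show ?thesis using i
      by (simp add: P3_def ypart_upd_coord xpart_upd T2 y2 x2 a2 c2 step_def mult.assoc)
  qed
  then show ?case using R F(2-4) unfolding \<sigma>(1) by (intro exI[of _ "\<lambda>z. F (P3 (P2 (P1 z)))"]) auto
qed

lemma payoff_program:
  assumes net: "is_dnn d 1 \<Phi>d" "is_dnn d 1 \<Phi>f" "is_dnn d 1 \<Phi>g"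
    and rad_net: "\<And>x. rad x = max 0 (dnn_fun \<Phi>d x - 3 * \<epsilon>)" and R1: "0 < R1"
  shows "\<exists>F. realizes regs (6 * regs * (dnn_size \<Phi>d + dnn_size \<Phi>f + dnn_size \<Phi>g + 3) + 150 * regs + 180 * regs * (k + 1)) F \<and>
    (\<forall>z. xpart d (F z) = xpart d z \<and> F z (2 * d + 3) = z (2 * d + 3) + payoff \<Phi>f \<Phi>g k R1 F1 \<kappa> (ypart d z))"
proof -
  let ?T = "2 * d" and ?V = "2 * d + 1" and ?W = "2 * d + 2" and ?A = "2 * d + 3"
  define P1 where "P1 = (\<lambda>z::point. z(?T := dnn_fun \<Phi>d (\<lambda>j. z (d + j))))"
  define P2 where "P2 = (\<lambda>z::point. z(?T := max 0 ((1 / R1) * (z ?T - 3 * \<epsilon>))))"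
  define P3 where "P3 = (\<lambda>z::point. z(?V := dnn_fun \<Phi>f (\<lambda>j. z (d + j))))"
  define P4 where "P4 = (\<lambda>z::point. z(?W := 0))"
  define P5 where "P5 = (\<lambda>z::point. z(?T := (tent ^^ k) (z ?T), ?W := z ?W + 1 * sqr k (z ?T)))"
  define P6 where "P6 = (\<lambda>z::point. z(?T := \<bar>(1/2) * z ?W + (1/2) * ((1 / F1) * z ?V)\<bar>))"
  define P7 where "P7 = (\<lambda>z::point. z(?T := (tent ^^ k) (z ?T), ?A := z ?A + \<kappa> * sqr k (z ?T)))"
  define P8 where "P8 = (\<lambda>z::point. z(?T := \<bar>(1/2) * z ?W - (1/2) * ((1 / F1) * z ?V)\<bar>))"
  define P9 where "P9 = (\<lambda>z::point. z(?T := (tent ^^ k) (z ?T), ?A := z ?A + (- \<kappa>) * sqr k (z ?T)))"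
  define P10 where "P10 = (\<lambda>z::point. z(?T := dnn_fun \<Phi>g (\<lambda>j. z (d + j))))"
  define P11 where "P11 = (\<lambda>z::point. z(?A := z ?A + z ?T))"
  have r1: "realizes regs (6 * regs * (dnn_size \<Phi>d + 1)) P1" unfolding P1_def by (rule realizes_dnn[OF net(1)]) auto
  have r2: "realizes regs (30 * regs) P2" unfolding P2_def by (intro realizes_relu linform_intros) auto
  have r3: "realizes regs (6 * regs * (dnn_size \<Phi>f + 1)) P3" unfolding P3_def by (rule realizes_dnn[OF net(2)]) auto
  have r4: "realizes regs (30 * regs) P4" unfolding P4_def by (intro realizes_assign linform_intros) auto
  have r5: "realizes regs (60 * regs * (k + 1)) P5" unfolding P5_def by (rule realizes_add_sqr) auto
  have r6: "realizes regs (30 * regs) P6" unfolding P6_def by (intro realizes_abs linform_intros) auto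
  have r7: "realizes regs (60 * regs * (k + 1)) P7" unfolding P7_def by (rule realizes_add_sqr) auto
  have r8: "realizes regs (30 * regs) P8" unfolding P8_def by (intro realizes_abs linform_intros) auto
  have r9: "realizes regs (60 * regs * (k + 1)) P9" unfolding P9_def by (rule realizes_add_sqr) auto
  have r10: "realizes regs (6 * regs * (dnn_size \<Phi>g + 1)) P10" unfolding P10_def by (rule realizes_dnn[OF net(3)]) auto
  have r11: "realizes regs (30 * regs) P11" unfolding P11_def by (intro realizes_assign linform_intros) auto
  define F where "F = (\<lambda>z. P11 (P10 (P9 (P8 (P7 (P6 (P5 (P4 (P3 (P2 (P1 z)))))))))))"
  note rr = realizes_comp[OF realizes_comp[OF realizes_comp[OF realizes_comp[OF realizes_comp[OF
    realizes_comp[OF realizes_comp[OF realizes_comp[OF realizes_comp[OF realizes_comp[OF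
    r1 r2] r3] r4] r5] r6] r7] r8] r9] r10] r11]
  have R: "realizes regs (6 * regs * (dnn_size \<Phi>d + dnn_size \<Phi>f + dnn_size \<Phi>g + 3) + 150 * regs + 180 * regs * (k + 1)) F"
    unfolding F_def by (rule realizes_mono[OF rr]) (simp add: algebra_simps)
  have sem: "xpart d (F z) = xpart d z \<and> F z ?A = z ?A + payoff \<Phi>f \<Phi>g k R1 F1 \<kappa> (ypart d z)" for z
  proof -
    define y where "y = ypart d z"
    define a where "a = rad y / R1"
    define b where "b = dnn_fun \<Phi>f y"
    have a: "a = max 0 ((1 / R1) * (dnn_fun \<Phi>d y - 3 * \<epsilon>))"
      using R1 by (auto simp: a_def rad_net max_def zero_le_divide_iff)
    define z2 where "z2 = P2 (P1 z)"
    have z2: "xpart d z2 = xpart d z" "ypart d z2 = y" "z2 ?T = a" "z2 ?A = z ?A"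
      unfolding z2_def P2_def P1_def
      by (simp_all add: xpart_upd ypart_upd dnn_fun_ypart[OF net(1)] y_def a)
    define z4 where "z4 = P4 (P3 z2)"
    have z4: "xpart d z4 = xpart d z" "ypart d z4 = y" "z4 ?T = a" "z4 ?V = b" "z4 ?W = 0" "z4 ?A = z ?A"
      unfolding z4_def P4_def P3_def dnn_fun_ypart[OF net(2)]
      by (simp_all add: xpart_upd ypart_upd z2 b_def)
    define z7 where "z7 = P7 (P6 (P5 z4))"
    have z7: "xpart d z7 = xpart d z" "ypart d z7 = y" "z7 ?V = b" "z7 ?W = sqr k a"
      "z7 ?A = z ?A + \<kappa> * sqr k \<bar>sqr k a / 2 + b / F1 / 2\<bar>"
      unfolding z7_def P7_def P6_def P5_def by (simp_all add: xpart_upd ypart_upd z4 z4[simplified] mult.commute[of F1 2])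
    define z9 where "z9 = P9 (P8 z7)"
    have z9: "xpart d z9 = xpart d z" "ypart d z9 = y"
      "z9 ?A = z ?A + \<kappa> * sqr k \<bar>sqr k a / 2 + b / F1 / 2\<bar> - \<kappa> * sqr k \<bar>sqr k a / 2 - b / F1 / 2\<bar>"
      unfolding z9_def P9_def P8_def by (simp_all add: xpart_upd ypart_upd z7 z7[simplified] mult.commute[of F1 2])
    have Fz: "F z = P11 (P10 z9)" by (simp add: F_def z9_def z7_def z4_def z2_def)
    show ?thesis unfolding Fz P11_def P10_def
      by (simp add: xpart_upd ypart_upd z9 dnn_fun_ypart[OF net(3)] payoff_def product_net_def
          y_def[symmetric] a_def[symmetric] b_def[symmetric] right_diff_distrib)
  qed
  show ?thesis using R sem by blast
qed

lemma copy_program: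
  "n \<le> d \<Longrightarrow> realizes regs (n * (30 * regs)) (\<lambda>z j. if d \<le> j \<and> j < d + n then z (j - d) else z j)"
proof (induction n)
  case 0
  have "(\<lambda>z j. if d \<le> j \<and> j < d + 0 then z (j - d) else z j) = (\<lambda>z::point. z)" by (auto simp: fun_eq_iff)
  then show ?case using realizes_id by simp
next
  case (Suc n)
  let ?P = "\<lambda>n z j. if d \<le> j \<and> j < d + n then z (j - d) else (z :: point) j"
  have r: "realizes regs (30 * regs) (\<lambda>z. z(d + n := z n))"
    using Suc.prems by (intro realizes_assign linform_intros) auto
  have e: "(?P n z)(d + n := ?P n z n) = ?P (Suc n) z" for z
    using Suc.prems by (auto simp: fun_eq_iff)
  have "realizes regs (n * (30 * regs) + 30 * regs) (\<lambda>z. (?P n z)(d + n := ?P n z n))"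
    by (rule realizes_comp[OF _ r]) (use Suc in simp)
  then show ?case unfolding e by (rule realizes_mono) simp
qed

definition sample_cost :: "relu_dnn \<Rightarrow> relu_dnn \<Rightarrow> relu_dnn \<Rightarrow> nat \<Rightarrow> nat" where
  "sample_cost \<Phi>d \<Phi>f \<Phi>g M = d * (30 * regs) + M * (6 * regs * (dnn_size \<Phi>d + 1) + 60 * regs)
     + (6 * regs * (dnn_size \<Phi>d + dnn_size \<Phi>f + dnn_size \<Phi>g + 3) + 150 * regs + 180 * regs * (M + 1))"

lemma sample_program:
  assumes net: "is_dnn d 1 \<Phi>d" "is_dnn d 1 \<Phi>f" "is_dnn d 1 \<Phi>g"
    and rad_net: "\<And>x. rad x = max 0 (dnn_fun \<Phi>d x - 3 * \<epsilon>)" and R1: "0 < R1"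
    and n: "n < M" and \<sigma>: "\<sigma> \<in> paths n"
  shows "\<exists>F. realizes regs (sample_cost \<Phi>d \<Phi>f \<Phi>g M) F \<and>
    (\<forall>z. xpart d (F z) = xpart d z \<and> F z (2 * d + 3) = z (2 * d + 3) + payoff \<Phi>f \<Phi>g M R1 F1 \<kappa> (\<sigma> (xpart d z)))"
proof -
  let ?C = "\<lambda>z j. if d \<le> j \<and> j < d + d then z (j - d) else (z :: point) j"
  let ?c = "6 * regs * (dnn_size \<Phi>d + 1) + 60 * regs"
  obtain F where F: "realizes regs (n * ?c) F"
    "\<And>z. ypart d (F z) = \<sigma> (ypart d z)" "\<And>z. xpart d (F z) = xpart d z" "\<And>z. F z (2 * d + 3) = z (2 * d + 3)"
    using path_program[OF net(1) rad_net \<sigma>] by blast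
  obtain P where P: "realizes regs (6 * regs * (dnn_size \<Phi>d + dnn_size \<Phi>f + dnn_size \<Phi>g + 3) + 150 * regs + 180 * regs * (M + 1)) P"
    "\<And>z. xpart d (P z) = xpart d z" "\<And>z. P z (2 * d + 3) = z (2 * d + 3) + payoff \<Phi>f \<Phi>g M R1 F1 \<kappa> (ypart d z)"
    using payoff_program[OF net rad_net R1, of M F1 \<kappa>] by blast
  have C: "ypart d (?C z) = xpart d z" "xpart d (?C z) = xpart d z" "?C z (2 * d + 3) = z (2 * d + 3)" for z
    by (auto simp: ypart_def xpart_def fun_eq_iff restrict_def)
  have "n * ?c \<le> M * ?c" using n by (intro mult_right_mono) auto
  then have "realizes regs (sample_cost \<Phi>d \<Phi>f \<Phi>g M) (\<lambda>z. P (F (?C z)))"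
    unfolding sample_cost_def by (intro realizes_comp realizes_mono[OF F(1)] P(1) copy_program) auto
  moreover have "xpart d (P (F (?C z))) = xpart d z \<and>
      P (F (?C z)) (2 * d + 3) = z (2 * d + 3) + payoff \<Phi>f \<Phi>g M R1 F1 \<kappa> (\<sigma> (xpart d z))" for z
    using P(2,3)[of "F (?C z)"] F(2-4)[of "?C z"] C[of z] by simp
  ultimately show ?thesis by blast
qed

text \<open>
  The programs of the trajectories run one after the other and share all registers. Every program copies the starting point
  afresh and adds its payoff to the accumulator.
\<close>

lemma average_network:
  assumes net: "is_dnn d 1 \<Phi>d" "is_dnn d 1 \<Phi>f" "is_dnn d 1 \<Phi>g"
    and rad_net: "\<And>x. rad x = max 0 (dnn_fun \<Phi>d x - 3 * \<epsilon>)" and R1: "0 < R1"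
    and k: "\<And>i. i < N \<Longrightarrow> k i \<in> {\<lambda>x. payoff \<Phi>f \<Phi>g M R1 F1 (\<kappa> n) (\<sigma> x) |n \<sigma>. n < M \<and> \<sigma> \<in> paths n}"
  shows "\<exists>\<Phi>. is_dnn d 1 \<Phi> \<and> dnn_size \<Phi> \<le> N * sample_cost \<Phi>d \<Phi>f \<Phi>g M + 2 * d + 2 \<and>
    (\<forall>x\<in>D. dnn_fun \<Phi> x = (\<Sum>i<N. k i x) / real N)"
proof -
  let ?c = "sample_cost \<Phi>d \<Phi>f \<Phi>g M"
  have "\<exists>F. realizes regs (n * ?c) F \<and> (\<forall>z. xpart d (F z) = xpart d z \<and>
      F z (2 * d + 3) = z (2 * d + 3) + (\<Sum>i<n. k i (xpart d z)))" if "n \<le> N" for n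
    using that
  proof (induction n)
    case 0 show ?case using realizes_id[of regs] by (intro exI[of _ "\<lambda>z. z"]) auto
  next
    case (Suc n)
    then obtain F where F: "realizes regs (n * ?c) F" "\<And>z. xpart d (F z) = xpart d z"
      "\<And>z. F z (2 * d + 3) = z (2 * d + 3) + (\<Sum>i<n. k i (xpart d z))" by auto
    obtain r \<sigma> where r: "r < M" "\<sigma> \<in> paths r" "k n = (\<lambda>x. payoff \<Phi>f \<Phi>g M R1 F1 (\<kappa> r) (\<sigma> x))"
      using k[of n] Suc.prems by auto
    obtain P where P: "realizes regs ?c P" "\<And>z. xpart d (P z) = xpart d z"
      "\<And>z. P z (2 * d + 3) = z (2 * d + 3) + payoff \<Phi>f \<Phi>g M R1 F1 (\<kappa> r) (\<sigma> (xpart d z))"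
      using sample_program[OF net rad_net R1 r(1,2), of F1 "\<kappa> r"] by blast
    have "realizes regs (Suc n * ?c) (\<lambda>z. P (F z))"
      using realizes_comp[OF F(1) P(1)] by (rule realizes_mono) simp
    then show ?case using F(2,3) P(2,3) r(3) by (intro exI[of _ "\<lambda>z. P (F z)"]) (auto simp: add.assoc)
  qed
  from this[of N] obtain F where F: "realizes regs (N * ?c) F"
    "\<And>z. F z (2 * d + 3) = z (2 * d + 3) + (\<Sum>i<N. k i (xpart d z))" by auto
  obtain \<Phi> where \<Phi>: "is_dnn d 1 \<Phi>" "dnn_size \<Phi> \<le> N * ?c + 2 * d + 2"
    "\<And>x. dnn_fun \<Phi> x = 1 / real N * F (\<lambda>j. if j < d then x j else 0) (2 * d + 3)"
    using program_to_dnn[OF F(1) d1, of "2 * d + 3" "1 / real N"] by auto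
  have "dnn_fun \<Phi> x = (\<Sum>i<N. k i x) / real N" if x: "x \<in> D" for x
  proof -
    have "xpart d (\<lambda>j. if j < d then x j else 0) = x"
      using D_space[OF x] by (auto simp: xpart_def topspace_rtop PiE_iff extensional_def fun_eq_iff)
    then show ?thesis by (simp add: \<Phi>(3) F(2))
  qed
  then show ?thesis using \<Phi>(1,2) by blast
qed

text \<open>
  The error of the product is multiplied by the large factor \<open>M\<close>, so it has to be small compared with \<open>1 / M\<close>;
  the error of \<open>f\<close> appears in proportion to the squared step size and is summed by \<open>sum_radii\<close>.
\<close>

lemma payoff_estimates:
  assumes n: "n < M" and y: "y \<in> D"
    and f: "\<bar>f y - dnn_fun \<Phi>f y\<bar> \<le> \<epsilon>" and g: "\<bar>g y - dnn_fun \<Phi>g y\<bar> \<le> \<epsilon>" and e1: "\<epsilon> \<le> 1"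
    and \<kappa>: "\<kappa> = (real M - 1 - real n) / (2 * real d) * \<gamma>\<^sup>2 * (R + 1)\<^sup>2 * (F + 1)"
  shows "\<bar>payoff \<Phi>f \<Phi>g M (R + 1) (F + 1) \<kappa> y - (g y + (real M - 1 - real n) / (2 * real d) * (\<gamma> * rad y)\<^sup>2 * f y)\<bar>
      \<le> (\<epsilon> + 2 * real M * \<gamma>\<^sup>2 * (R + 1)\<^sup>2 * (F + 1) / 4 ^ M) + real M * \<epsilon> * (\<gamma> * rad y)\<^sup>2" (is ?est)
    and "\<bar>payoff \<Phi>f \<Phi>g M (R + 1) (F + 1) \<kappa> y\<bar> \<le> G + 1 + real M * \<gamma>\<^sup>2 * (R + 1)\<^sup>2 * (F + 1)" (is ?bound)
proof -
  let ?R = "R + 1" and ?F = "F + 1" and ?c = "(real M - 1 - real n) / (2 * real d)"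
  let ?a = "rad y / ?R" and ?b = "dnn_fun \<Phi>f y / ?F"
  have a: "0 \<le> ?a" "?a \<le> 1" using rad_nonneg[OF y] rad_le_R[OF y] R0 by auto
  have fb: "\<bar>dnn_fun \<Phi>f y\<bar> \<le> ?F" using f f_bound[OF y] e1 by linarith
  then have b: "\<bar>?b\<bar> \<le> 1" using F0 by (simp add: abs_divide)
  have c: "0 \<le> ?c" "?c \<le> real M / 2"
  proof -
    show "0 \<le> ?c" using n d0 by simp
    have "?c \<le> (real M - 1 - real n) / 2" using n d1 by (intro divide_left_mono) auto
    then show "?c \<le> real M / 2" by simp
  qed
  define Q where "Q = \<gamma>\<^sup>2 * ?R\<^sup>2 * ?F"
  have Q0: "0 \<le> Q" unfolding Q_def using F0 by simp
  have \<kappa>Q: "\<kappa> = ?c * Q" by (simp add: \<kappa> Q_def mult_ac)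
  have \<kappa>b: "0 \<le> \<kappa>" "\<kappa> \<le> real M / 2 * Q"
    unfolding \<kappa>Q by (rule mult_nonneg_nonneg[OF c(1) Q0], rule mult_right_mono[OF c(2) Q0])
  note pa = product_net_approx[OF a b, of M]
  have main: "\<kappa> * (?a\<^sup>2 * ?b) = ?c * (\<gamma> * rad y)\<^sup>2 * dnn_fun \<Phi>f y"
    unfolding \<kappa>Q Q_def using R0 F0 by (simp add: power_divide power_mult_distrib)
  have "\<bar>\<kappa> * product_net M ?a ?b - \<kappa> * (?a\<^sup>2 * ?b)\<bar> \<le> (real M / 2 * Q) * (3 / 4 ^ M)"
    unfolding right_diff_distrib[symmetric] abs_mult using pa(1) \<kappa>b Q0 by (intro mult_mono) auto
  also have "\<dots> \<le> 2 * real M * Q / 4 ^ M" using Q0 by (simp add: field_simps)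
  finally have 1: "\<bar>\<kappa> * product_net M ?a ?b - \<kappa> * (?a\<^sup>2 * ?b)\<bar> \<le> 2 * real M * Q / 4 ^ M" .
  have "\<bar>?c * (\<gamma> * rad y)\<^sup>2 * dnn_fun \<Phi>f y - ?c * (\<gamma> * rad y)\<^sup>2 * f y\<bar> = ?c * (\<gamma> * rad y)\<^sup>2 * \<bar>f y - dnn_fun \<Phi>f y\<bar>"
    unfolding right_diff_distrib[symmetric] abs_mult[of "?c * (\<gamma> * rad y)\<^sup>2"]
    using abs_of_nonneg[OF mult_nonneg_nonneg[OF c(1) zero_le_power2[of "\<gamma> * rad y"]]]
    by (simp only: abs_minus_commute)
  also have "\<dots> \<le> (real M / 2) * (\<gamma> * rad y)\<^sup>2 * \<epsilon>" using c f by (intro mult_mono) auto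
  also have "\<dots> \<le> real M * \<epsilon> * (\<gamma> * rad y)\<^sup>2" using eps by (simp add: mult_ac)
  finally have 2: "\<bar>?c * (\<gamma> * rad y)\<^sup>2 * dnn_fun \<Phi>f y - ?c * (\<gamma> * rad y)\<^sup>2 * f y\<bar> \<le> real M * \<epsilon> * (\<gamma> * rad y)\<^sup>2" .
  have QM: "2 * real M * Q / 4 ^ M = 2 * real M * \<gamma>\<^sup>2 * ?R\<^sup>2 * ?F / 4 ^ M" by (simp add: Q_def mult_ac)
  show ?est using 1 2 g main unfolding payoff_def QM by linarith
  have "\<bar>\<kappa> * product_net M ?a ?b\<bar> \<le> (real M / 2 * Q) * 1"
    unfolding abs_mult using pa(2) \<kappa>b Q0 by (intro mult_mono) auto
  also have "\<dots> \<le> real M * \<gamma>\<^sup>2 * ?R\<^sup>2 * ?F" using Q0 by (simp add: Q_def mult_ac)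
  finally show ?bound unfolding payoff_def using g g_bound[OF y] e1 by linarith
qed

end


section \<open>The error in the mean-square norm\<close>

lemma L2_norm_restrict:
  assumes "openin (rtop d) D"
  shows "L2_norm d D h = sqrt (\<integral>x. (h x)\<^sup>2 \<partial>restrict_space (rleb d) D)"
  using openin_imp_measurable[OF assms]
  by (simp add: L2_norm_def set_lebesgue_integral_def integral_restrict_space openin_Int_PiE[OF assms])

context poisson_problem begin

abbreviation lebesgue_D :: "point measure" where "lebesgue_D \<equiv> restrict_space (rleb d) D"

lemma space_lebesgue_D: "space lebesgue_D = D"
  by (simp only: space_restrict_space openin_Int_space[OF open_D])

lemma volume: "emeasure (rleb d) D \<le> ennreal (exp (4 * pi * R\<^sup>2) * (1/2) ^ d)"
proof -
  obtain x where "x \<in> D" using D_ne by blast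
  then show ?thesis using emeasure_le_gaussian[OF openin_imp_measurable[OF open_D] diam R0] by blast
qed

lemma emeasure_lebesgue_D: "emeasure lebesgue_D (space lebesgue_D) = emeasure (rleb d) D"
  using openin_imp_measurable[OF open_D]
  by (simp add: space_lebesgue_D emeasure_restrict_space openin_Int_PiE[OF open_D])

lemma finite_lebesgue_D: "finite_measure lebesgue_D"
  by (rule finite_measureI) (use volume in \<open>auto simp: emeasure_lebesgue_D top_unique\<close>)

definition vol :: real where "vol = measure (rleb d) D"

lemma measure_lebesgue_D: "measure lebesgue_D (space lebesgue_D) = vol"
  by (simp add: measure_def emeasure_lebesgue_D vol_def)

lemma vol_bounds: "0 \<le> vol" "vol \<le> exp (4 * pi * R\<^sup>2) * (1/2) ^ d"
proof -
  show "0 \<le> vol" by (simp add: vol_def)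
  show "vol \<le> exp (4 * pi * R\<^sup>2) * (1/2) ^ d"
    unfolding vol_def measure_def by (rule enn2real_leI) (use volume in auto)
qed

lemma in_L2_diff:
  assumes n: "is_dnn d 1 \<Phi>" shows "in_L2 d D (\<lambda>x. u x - dnn_fun \<Phi> x)"
    and "integrable lebesgue_D (\<lambda>x. (u x - dnn_fun \<Phi> x)\<^sup>2)"
proof -
  interpret finite_measure lebesgue_D by (rule finite_lebesgue_D)
  have c: "cont_on d (rtop d closure_of D) (\<lambda>x. u x - dnn_fun \<Phi> x)"
    by (intro cont_on_diff u_cont cont_on_dnn_fun n)
  have cD: "cont_on d D (\<lambda>x. u x - dnn_fun \<Phi> x)"
    by (rule cont_on_subset[OF c]) (use D_closure in blast)
  obtain B where B: "B \<ge> 0" "\<And>x. x \<in> D \<Longrightarrow> \<bar>u x - dnn_fun \<Phi> x\<bar> \<le> B"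
    using compact_bounded_fun[OF compactin_closure[OF bdd] c] D_closure by blast
  have "tame B (\<lambda>x. u x - dnn_fun \<Phi> x)"
    unfolding tame_def space_lebesgue_D using B cont_on_measurable_restrict[OF open_D cD] by blast
  from tame_integrable[OF tame_mult[OF this this]]
  show i: "integrable lebesgue_D (\<lambda>x. (u x - dnn_fun \<Phi> x)\<^sup>2)" by (simp add: power2_eq_square)
  then have "set_integrable (rleb d) D (\<lambda>x. (u x - dnn_fun \<Phi> x)\<^sup>2)"
    using openin_imp_measurable[OF open_D]
    by (subst (asm) integrable_restrict_space) (auto simp: set_integrable_def openin_Int_PiE[OF open_D])
  then show "in_L2 d D (\<lambda>x. u x - dnn_fun \<Phi> x)"
    using cont_on_set_measurable[OF open_D cD] by (simp add: in_L2_def)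
qed

text \<open>
  The pointwise error \<open>E\<close> of the mean over all trajectories and the sampling error are combined by
  \<open>(a + b)\<^sup>2 \<le> 2 * a\<^sup>2 + 2 * b\<^sup>2\<close>. Payoffs along a trajectory are measurable as they are realized by networks
  themselves.
\<close>

lemma approximation_exists:
  assumes net: "is_dnn d 1 \<Phi>d" "is_dnn d 1 \<Phi>f" "is_dnn d 1 \<Phi>g"
    and ed: "\<And>x. x \<in> D \<Longrightarrow> \<bar>dist_bdry d D x - dnn_fun \<Phi>d x\<bar> \<le> \<epsilon>"
    and ef: "\<And>x. x \<in> D \<Longrightarrow> \<bar>f x - dnn_fun \<Phi>f x\<bar> \<le> \<epsilon>"
    and eg: "\<And>x. x \<in> D \<Longrightarrow> \<bar>g x - dnn_fun \<Phi>g x\<bar> \<le> \<epsilon>"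
    and \<epsilon>: "0 < \<epsilon>" "\<epsilon> \<le> 1" and \<gamma>: "0 < \<gamma>" "\<gamma> \<le> 1" "\<gamma> * R * real d \<le> \<epsilon>"
    and M: "0 < M" "R\<^sup>2 \<le> \<epsilon>\<^sup>2 * \<gamma>\<^sup>2 * real M" and N: "0 < N"
    and B: "B = G + 1 + real M * \<gamma>\<^sup>2 * (R + 1)\<^sup>2 * (F + 1)"
    and E: "E = (\<epsilon> + 2 * real M * \<gamma>\<^sup>2 * (R + 1)\<^sup>2 * (F + 1) / 4 ^ M) + \<epsilon> * R\<^sup>2
       + (CK * U0 * \<gamma> * R * real d ^ 3 / (2 * \<epsilon> ^ 3) + Lf * \<epsilon> / 2) * R\<^sup>2 + 3 * A * R * \<epsilon> + 2 * \<Lambda> * \<epsilon>"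
  shows "\<exists>\<Phi>. is_dnn d 1 \<Phi> \<and>
     dnn_size \<Phi> \<le> N * (d * (30 * (2 * d + 4)) + M * (6 * (2 * d + 4) * (dnn_size \<Phi>d + 1) + 60 * (2 * d + 4))
       + (6 * (2 * d + 4) * (dnn_size \<Phi>d + dnn_size \<Phi>f + dnn_size \<Phi>g + 3) + 150 * (2 * d + 4) + 180 * (2 * d + 4) * (M + 1))) + 2 * d + 2 \<and>
     (L2_norm d D (\<lambda>x. u x - dnn_fun \<Phi> x))\<^sup>2 \<le> (2 * E\<^sup>2 + 8 * B\<^sup>2 / real N) * vol"
proof -
  define rad where "rad = (\<lambda>x. max 0 (dnn_fun \<Phi>d x - 3 * \<epsilon>))"
  interpret walk d D f g u F LG G Lf Lg R \<epsilon> \<gamma> rad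
  proof unfold_locales
    fix x assume x: "x \<in> D"
    show "0 \<le> rad x" by (simp add: rad_def)
    show "rad x \<le> max 0 (dist_bdry d D x - 2 * \<epsilon>)" "dist_bdry d D x - 4 * \<epsilon> \<le> rad x"
      using ed[OF x] by (auto simp: rad_def max_def abs_le_iff)
  qed (use \<epsilon> \<gamma> in auto)
  interpret finite_measure lebesgue_D by (rule finite_lebesgue_D)
  define \<kappa> where "\<kappa> = (\<lambda>n. (real M - 1 - real n) / (2 * real d) * \<gamma>\<^sup>2 * (R + 1)\<^sup>2 * (F + 1))"
  define pay where "pay = (\<lambda>n. payoff \<Phi>f \<Phi>g M (R + 1) (F + 1) (\<kappa> n))"
  define fam where "fam = {\<lambda>x. pay n (\<sigma> x) |n \<sigma>. n < M \<and> \<sigma> \<in> paths n}"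
  define w where "w = (\<lambda>x. (\<Sum>n<M. (T ^^ n) (pay n) x) / real M)"
  have R1: "0 < R + 1" using R0 by simp
  have net': "\<exists>\<Phi>. is_dnn d 1 \<Phi> \<and> dnn_size \<Phi> \<le> n * sample_cost \<Phi>d \<Phi>f \<Phi>g M + 2 * d + 2 \<and>
      (\<forall>x\<in>D. dnn_fun \<Phi> x = (\<Sum>i<n. k i x) / real n)" if "\<And>i. i < n \<Longrightarrow> k i \<in> fam" for n k
    by (rule average_network[OF net _ R1]) (use that in \<open>auto simp: fam_def pay_def rad_def\<close>)
  have w_av: "w \<in> averages fam" unfolding w_def fam_def by (rule walk_mean_in_averages[OF M(1)])
  have fam_tame: "tame B h" if h: "h \<in> fam" for h
  proof -
    obtain n \<sigma> where n: "n < M" "\<sigma> \<in> paths n" "h = (\<lambda>x. pay n (\<sigma> x))" using h by (auto simp: fam_def)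
    obtain \<Phi> where \<Phi>: "is_dnn d 1 \<Phi>" "\<And>x. x \<in> D \<Longrightarrow> dnn_fun \<Phi> x = h x"
      using net'[of 1 "\<lambda>_. h"] h by auto
    have "cont_on d D h" by (rule cont_on_cong[OF cont_on_dnn_fun[OF \<Phi>(1)] \<Phi>(2)])
    moreover have "\<bar>h x\<bar> \<le> B" if x: "x \<in> D" for x
      unfolding n(3) pay_def B
      using paths_in_D[OF n(2) x] by (intro payoff_estimates(2)[OF n(1)] ef eg \<epsilon>) (auto simp: \<kappa>_def)
    ultimately show ?thesis
      unfolding tame_def space_lebesgue_D using cont_on_measurable_restrict[OF open_D] by blast
  qed
  have w_close: "\<bar>w x - u x\<bar> \<le> E" if x: "x \<in> D" for x
    unfolding w_def E consistency_def[symmetric]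
  proof (rule walk_approximates_solution[OF x M])
    fix n y assume n: "n < M" and y: "y \<in> D"
    show "\<bar>pay n y - (g y + (real M - 1 - real n) / (2 * real d) * (\<gamma> * rad y)\<^sup>2 * f y)\<bar>
      \<le> (\<epsilon> + 2 * real M * \<gamma>\<^sup>2 * (R + 1)\<^sup>2 * (F + 1) / 4 ^ M) + real M * \<epsilon> * (\<gamma> * rad y)\<^sup>2"
      unfolding pay_def by (rule payoff_estimates(1)[OF n y ef[OF y] eg[OF y] \<epsilon>(2)]) (simp add: \<kappa>_def)
  qed (use \<epsilon> in simp)
  obtain k where k: "\<And>i. i < N \<Longrightarrow> k i \<in> fam"
    "(\<integral>x. ((\<Sum>i<N. k i x) - real N * w x)\<^sup>2 \<partial>lebesgue_D) \<le> real N * (4 * B\<^sup>2 * vol)"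
    using sparse_average[OF fam_tame w_av, of N] unfolding measure_lebesgue_D by blast
  obtain \<Phi> where \<Phi>: "is_dnn d 1 \<Phi>" "dnn_size \<Phi> \<le> N * sample_cost \<Phi>d \<Phi>f \<Phi>g M + 2 * d + 2"
    "\<And>x. x \<in> D \<Longrightarrow> dnn_fun \<Phi> x = (\<Sum>i<N. k i x) / real N" using net'[of N k, OF k(1)] by blast
  have wt: "tame B w" by (rule averages_tame[OF fam_tame w_av])
  define q where "q = (\<lambda>x. (\<Sum>i<N. k i x) - real N * w x)"
  have qt: "integrable lebesgue_D (\<lambda>x. (q x)\<^sup>2)"
  proof -
    have "\<exists>C. tame C (\<lambda>x. (\<Sum>i<n. k i x))" if "n \<le> N" for n
      using that
    proof (induction n)
      case 0 show ?case by (rule exI[of _ 0]) (simp add: tame_def)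
    next
      case (Suc n) then show ?case using tame_add[OF _ fam_tame[OF k(1)[of n]]] by auto
    qed
    then obtain C where "tame C (\<lambda>x. (\<Sum>i<N. k i x))" by blast
    moreover have "tame (\<bar>real N\<bar>) (\<lambda>x. real N)" by (simp add: tame_def)
    ultimately have "tame (C + \<bar>real N\<bar> * B) q" unfolding q_def by (intro tame_diff tame_mult wt)
    from tame_integrable[OF tame_mult[OF this this]] show ?thesis by (simp add: power2_eq_square)
  qed
  have "(L2_norm d D (\<lambda>x. u x - dnn_fun \<Phi> x))\<^sup>2 = (\<integral>x. (u x - dnn_fun \<Phi> x)\<^sup>2 \<partial>lebesgue_D)"
    unfolding L2_norm_restrict[OF open_D] by simp
  also have "\<dots> \<le> (\<integral>x. 2 * E\<^sup>2 + 2 / (real N)\<^sup>2 * (q x)\<^sup>2 \<partial>lebesgue_D)"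
  proof (rule integral_mono)
    show "integrable lebesgue_D (\<lambda>x. (u x - dnn_fun \<Phi> x)\<^sup>2)" by (rule in_L2_diff(2)[OF \<Phi>(1)])
    show "integrable lebesgue_D (\<lambda>x. 2 * E\<^sup>2 + 2 / (real N)\<^sup>2 * (q x)\<^sup>2)" using qt by simp
    fix x assume "x \<in> space lebesgue_D"
    then have x: "x \<in> D" by (simp add: space_lebesgue_D)
    have 1: "(u x - w x)\<^sup>2 \<le> E\<^sup>2" using w_close[OF x] by (metis abs_ge_zero abs_minus_commute power2_abs power_mono)
    have "w x - dnn_fun \<Phi> x = - (q x / real N)" using \<Phi>(3)[OF x] N by (simp add: q_def field_simps)
    then have 2: "(w x - dnn_fun \<Phi> x)\<^sup>2 = (q x)\<^sup>2 / (real N)\<^sup>2" by (simp add: power_divide)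
    have "0 \<le> ((u x - w x) - (w x - dnn_fun \<Phi> x))\<^sup>2" by simp
    then have "(u x - dnn_fun \<Phi> x)\<^sup>2 \<le> 2 * (u x - w x)\<^sup>2 + 2 * (w x - dnn_fun \<Phi> x)\<^sup>2"
      by (simp add: power2_eq_square algebra_simps)
    then show "(u x - dnn_fun \<Phi> x)\<^sup>2 \<le> 2 * E\<^sup>2 + 2 / (real N)\<^sup>2 * (q x)\<^sup>2" using 1 2 by simp
  qed
  also have "\<dots> = 2 * E\<^sup>2 * vol + 2 / (real N)\<^sup>2 * (\<integral>x. (q x)\<^sup>2 \<partial>lebesgue_D)"
    using qt measure_lebesgue_D by (simp add: mult.commute)
  also have "\<dots> \<le> 2 * E\<^sup>2 * vol + 2 / (real N)\<^sup>2 * (real N * (4 * B\<^sup>2 * vol))"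
    using k(2) unfolding q_def by (intro add_left_mono mult_left_mono) auto
  also have "\<dots> = (2 * E\<^sup>2 + 8 * B\<^sup>2 / real N) * vol"
    using N by (simp add: power2_eq_square field_simps)
  finally show ?thesis using \<Phi>(1,2) unfolding sample_cost_def by blast
qed

end

section \<open>Counting weights\<close>

text \<open>
  From \<open>y \<le> exp y\<close> at \<open>y = d * ln 2 / 14\<close>.
\<close>

lemma dimension_vs_exponential:
  "real d ^ 7 \<le> (14 / ln 2) ^ 7 * 2 powr (real d / 2)"
proof -
  define y where "y = real d * ln 2 / 14"
  have "real d = 14 / ln 2 * y" by (simp add: y_def)
  also have "\<dots> \<le> 14 / ln 2 * exp y"
    using exp_ge_add_one_self[of y] by (intro mult_left_mono) (linarith, simp)
  finally have "real d ^ 7 \<le> (14 / ln 2 * exp y) ^ 7" by (intro power_mono) auto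
  also have "\<dots> = (14 / ln 2) ^ 7 * exp (7 * y)"
    by (simp only: power_mult_distrib exp_of_nat_mult[of 7 y, symmetric] of_nat_numeral)
  also have "7 * y = real d / 2 * ln 2" by (simp add: y_def)
  also have "exp (real d / 2 * ln 2) = 2 powr (real d / 2)" by (simp add: powr_def)
  finally show ?thesis .
qed

text \<open>
  From \<open>ln t \<le> t\<close> at \<open>t = (1 / \<epsilon>) powr (1 / b)\<close>, so that the power \<open>b\<close> of the logarithm costs no more than \<open>1 / \<epsilon>\<close>.
\<close>

lemma log_cost:
  assumes \<epsilon>: "0 < \<epsilon>" "\<epsilon> < 1" and b: "1 < b"
  shows "real_of_int \<lceil>ln (inverse \<epsilon>)\<rceil> powr b \<le> (b + 1) powr b / \<epsilon>"
proof -
  define y where "y = inverse \<epsilon>"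
  have y: "1 < y" using \<epsilon> by (simp add: y_def one_less_inverse)
  define t where "t = y powr (1 / b)"
  have t1: "1 \<le> t" unfolding t_def using y b by (intro ge_one_powr_ge_zero) auto
  have "ln t \<le> t" using ln_le_minus_one[of t] t1 by simp
  moreover have "ln t = ln y / b" unfolding t_def using y by (simp add: ln_powr)
  ultimately have "ln y \<le> b * t" using b by (simp add: field_simps)
  then have "real_of_int \<lceil>ln y\<rceil> \<le> (b + 1) * t" using t1 by (simp add: distrib_right) linarith
  moreover have "0 < ln y" using y by simp
  then have "0 \<le> real_of_int \<lceil>ln y\<rceil>" by linarith
  ultimately have "real_of_int \<lceil>ln y\<rceil> powr b \<le> ((b + 1) * t) powr b" using b by (intro powr_mono2) auto
  also have "\<dots> = (b + 1) powr b * (t powr b)" using b t1 by (intro powr_mult)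
  also have "t powr b = y" unfolding t_def using y b by (simp add: powr_powr)
  finally show ?thesis by (simp add: y_def divide_inverse)
qed

lemma square_le_four_power: "real M * real M \<le> 4 ^ M"
proof -
  have "real M \<le> 2 ^ M" using less_exp[of M] by (simp add: order_less_imp_le of_nat_less_two_power)
  then have "real M * real M \<le> 2 ^ M * 2 ^ M" by (intro mult_mono) auto
  also have "(2::real) ^ M * 2 ^ M = 4 ^ M" by (simp add: power_mult_distrib[symmetric])
  finally show ?thesis .
qed

text \<open>
  Here \<open>X\<close> is \<open>1 / \<delta>\<close>. All contributions are estimated by multiples of \<open>d ^ 7 * d powr a * X ^ 17 * X powr b\<close>, where
  \<open>X ^ 6\<close> comes from the trajectories, \<open>X ^ 10\<close> from the steps and one factor from the distance network. The
  assumption on \<open>d ^ 7\<close> trades the power of the dimension for one more factor \<open>X\<close>.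
\<close>

lemma weight_count:
  fixes d M N sd sf sg :: nat and X a b n1 m1 s1 s2 q :: real
  assumes d: "1 \<le> d" and X: "1 \<le> X" and ab: "1 < a" "1 < b"
    and c: "0 \<le> n1" "0 \<le> m1" "0 \<le> s1" "0 \<le> s2" "0 \<le> q"
    and N: "1 \<le> N" "real N \<le> n1 * X ^ 6" and M: "1 \<le> M" "real M \<le> m1 * real d ^ 6 * X ^ 10"
    and sd: "real sd \<le> s1 * real d powr a * X"
    and sf: "real sf \<le> s2 * real d powr a * X powr b"
    and sg: "real sg \<le> s2 * real d powr a * X powr b"
    and q: "real d ^ 7 \<le> q * X"
  shows "real (N * (d * (30 * (2 * d + 4)) + M * (6 * (2 * d + 4) * (sd + 1) + 60 * (2 * d + 4))
       + (6 * (2 * d + 4) * (sd + sf + sg + 3) + 150 * (2 * d + 4) + 180 * (2 * d + 4) * (M + 1))) + 2 * d + 2)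
     \<le> n1 * (6 * (624 * m1 + 12 * m1 * s1 + 12 * s2) + 4) * q * real d powr a * X powr (14 + 6 * b)"
proof -
  define x where "x = real d"
  define Y where "Y = x powr a"
  define Z where "Z = X ^ 11 * X powr b"
  have x1: "1 \<le> x" using d by (simp add: x_def)
  have xY: "x \<le> Y" using powr_mono[of 1 a x] ab x1 by (simp add: Y_def)
  have Y1: "1 \<le> Y" using xY x1 by linarith
  have Xb: "1 \<le> X powr b" using X ab by (intro ge_one_powr_ge_zero) auto
  have X10: "1 \<le> X ^ 10" "1 \<le> X ^ 11" using X by (auto intro: one_le_power)
  have Z: "1 \<le> Z" "X ^ 10 \<le> Z" "X ^ 11 \<le> Z" "X powr b \<le> Z"
  proof -
    show "X ^ 11 \<le> Z" using mult_left_mono[OF Xb, of "X ^ 11"] X unfolding Z_def by simp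
    then show "1 \<le> Z" using X10 by linarith
    have "X ^ 10 \<le> X ^ 11" using X by (intro power_increasing) auto
    then show "X ^ 10 \<le> Z" using \<open>X ^ 11 \<le> Z\<close> by linarith
    show "X powr b \<le> Z" using mult_right_mono[OF X10(2), of "X powr b"] Xb by (simp add: Z_def)
  qed
  have x6: "1 \<le> x ^ 6" using x1 by (rule one_le_power)
  have x6Y: "1 \<le> x ^ 6 * Y" "0 \<le> x ^ 6 * Y" using mult_mono[OF x6 Y1] x1 Y1 by auto
  define m where "m = real M"
  have m1': "1 \<le> m" "m \<le> m1 * x ^ 6 * X ^ 10" using M by (auto simp: m_def x_def)
  define W where "W = x ^ 6 * Y * Z"
  have W1: "1 \<le> W" using mult_mono[OF x6Y(1) Z(1)] x6Y by (simp add: W_def)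
  have Md: "m * x \<le> m1 * W"
  proof -
    have "m * x \<le> (m1 * x ^ 6 * X ^ 10) * Y" using m1' xY x1 c X10 by (intro mult_mono) auto
    also have "\<dots> = m1 * (x ^ 6 * Y) * X ^ 10" by (simp add: mult_ac)
    also have "\<dots> \<le> m1 * (x ^ 6 * Y) * Z" using Z c x6Y by (intro mult_left_mono) auto
    finally show ?thesis by (simp add: W_def mult_ac)
  qed
  have Ms: "m * real sd \<le> m1 * s1 * W"
  proof -
    have "m * real sd \<le> (m1 * x ^ 6 * X ^ 10) * (s1 * Y * X)"
      using m1' sd c X10 x1 by (intro mult_mono) (auto simp: Y_def x_def)
    also have "\<dots> = m1 * s1 * (x ^ 6 * Y) * X ^ 11" by (simp add: mult_ac power_Suc[symmetric] eval_nat_numeral)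
    also have "\<dots> \<le> m1 * s1 * (x ^ 6 * Y) * Z" using Z c x6Y by (intro mult_left_mono) auto
    finally show ?thesis by (simp add: W_def mult_ac)
  qed
  have s: "real n \<le> s2 * W" if "real n \<le> s2 * real d powr a * X powr b" for n
  proof -
    have "real n \<le> s2 * (1 * Y) * X powr b" using that by (simp add: Y_def x_def)
    also have "\<dots> \<le> s2 * (x ^ 6 * Y) * Z"
      using c x6 Y1 x6Y Z Xb by (intro mult_mono mult_left_mono mult_right_mono) auto
    finally show ?thesis by (simp add: W_def mult_ac)
  qed
  define K where "K = 624 * m1 + 12 * m1 * s1 + 12 * s2"
  have K0: "0 \<le> K" using c by (simp add: K_def)
  let ?r = "2 * x + 4"
  have inner: "x * (30 * ?r) + m * (6 * ?r * (real sd + 1) + 60 * ?r)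
       + (6 * ?r * (real sd + real sf + real sg + 3) + 150 * ?r + 180 * ?r * (m + 1)) \<le> 6 * x * (K * W)"
  proof -
    have "x * (30 * ?r) + m * (6 * ?r * (real sd + 1) + 60 * ?r)
       + (6 * ?r * (real sd + real sf + real sg + 3) + 150 * ?r + 180 * ?r * (m + 1))
       = ?r * (30 * x + 246 * m + 348 + 6 * m * real sd + 6 * real sd + 6 * (real sf + real sg))"
      by (simp add: algebra_simps)
    also have "\<dots> \<le> (6 * x) * (624 * (m * x) + 12 * (m * real sd) + 6 * (real sf + real sg))"
    proof (intro mult_mono)
      have "1 * x \<le> m * x" "m * 1 \<le> m * x" using m1' x1 by (auto intro: mult_left_mono mult_right_mono)
      moreover have "1 \<le> m * x" using calculation x1 by linarith
      moreover have "1 * real sd \<le> m * real sd" using m1' by (intro mult_right_mono) auto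
      ultimately show "30 * x + 246 * m + 348 + 6 * m * real sd + 6 * real sd + 6 * (real sf + real sg)
        \<le> 624 * (m * x) + 12 * (m * real sd) + 6 * (real sf + real sg)" by simp
    qed (use x1 m1' in auto)
    also have "\<dots> \<le> (6 * x) * (K * W)"
    proof (intro mult_left_mono)
      have "6 * (real sf + real sg) \<le> 12 * (s2 * W)" using s[OF sf] s[OF sg] by simp
      then show "624 * (m * x) + 12 * (m * real sd) + 6 * (real sf + real sg) \<le> K * W"
        using Md Ms unfolding K_def by (simp add: distrib_right)
    qed (use x1 in simp)
    finally show ?thesis by simp
  qed
  have "real (N * (d * (30 * (2 * d + 4)) + M * (6 * (2 * d + 4) * (sd + 1) + 60 * (2 * d + 4))
       + (6 * (2 * d + 4) * (sd + sf + sg + 3) + 150 * (2 * d + 4) + 180 * (2 * d + 4) * (M + 1))) + 2 * d + 2)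
     = real N * (x * (30 * ?r) + m * (6 * ?r * (real sd + 1) + 60 * ?r)
       + (6 * ?r * (real sd + real sf + real sg + 3) + 150 * ?r + 180 * ?r * (m + 1))) + 2 * x + 2"
    by (simp only: x_def m_def of_nat_add of_nat_mult of_nat_numeral of_nat_1)
  also have "\<dots> \<le> real N * (6 * x * (K * W)) + real N * (4 * x * W)"
  proof -
    have "2 * x + 2 \<le> 4 * x * 1" using x1 by simp
    also have "\<dots> \<le> 4 * x * W" using W1 x1 by (intro mult_left_mono) auto
    also have "\<dots> \<le> real N * (4 * x * W)" using N W1 x1 mult_right_mono[of 1 "real N" "4 * x * W"] by simp
    finally show ?thesis using mult_left_mono[OF inner, of "real N"] by simp
  qed
  also have "\<dots> = real N * ((6 * K + 4) * (x * W))" by (simp add: algebra_simps)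
  also have "\<dots> \<le> (n1 * X ^ 6) * ((6 * K + 4) * (x * W))"
    using N K0 x1 W1 by (intro mult_right_mono) auto
  also have "x * W = x ^ 7 * (Y * Z)" by (simp add: W_def eval_nat_numeral mult_ac)
  also have "(n1 * X ^ 6) * ((6 * K + 4) * (x ^ 7 * (Y * Z))) \<le> (n1 * X ^ 6) * ((6 * K + 4) * ((q * X) * (Y * Z)))"
    using q c K0 X Y1 Z by (intro mult_left_mono mult_right_mono) (auto simp: x_def)
  also have "\<dots> = n1 * (6 * K + 4) * q * Y * (X ^ 18 * X powr b)"
    by (simp add: Z_def eval_nat_numeral mult_ac)
  also have "X ^ 18 * X powr b = X powr (18 + b)"
    using X powr_realpow[of X 18] by (simp add: powr_add)
  also have "n1 * (6 * K + 4) * q * Y * X powr (18 + b) \<le> n1 * (6 * K + 4) * q * Y * X powr (14 + 6 * b)"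
    using X ab c K0 Y1 by (intro mult_left_mono powr_mono) auto
  finally show ?thesis by (simp add: K_def Y_def x_def)
qed


section \<open>Choice of the parameters\<close>

context poisson_problem begin

text \<open>
  An upper bound for the square root of the volume of \<open>D\<close>, uniform in the dimension.
\<close>

definition vol_root :: real where "vol_root = exp (2 * pi * R\<^sup>2)"
text \<open>
  The pointwise error of the mean over all trajectories is at most \<open>err_const * \<epsilon>\<close>, and \<open>\<epsilon> = theta * \<delta>\<close> makes it at most
  \<open>\<delta> / 4\<close> after multiplication by \<open>vol_root\<close>.
\<close>

definition err_const :: real where
  "err_const = 1 + 2 * (F + 1) + R\<^sup>2 + (1 + Lf) * R\<^sup>2 + 3 * A * R + 2 * \<Lambda>"
definition theta :: real where "theta = 1 / (4 * err_const * vol_root)"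
text \<open>
  With \<open>\<gamma> = \<epsilon> ^ 4 / (step_const * d ^ 3)\<close> the consistency error that stems from the mollification is at most \<open>\<epsilon> / 2\<close>.
\<close>

definition step_const :: real where "step_const = 1 + R + CK * U0 * R"
text \<open>
  All payoffs are bounded by \<open>sup_const / \<epsilon>\<^sup>2\<close>.
\<close>

definition sup_const :: real where "sup_const = G + 1 + 2 * (R + 1) ^ 4 * (F + 1)"

text \<open>
  The constant of \<open>weight_count\<close> for these parameters.
\<close>

definition size_const :: "real \<Rightarrow> real \<Rightarrow> real" where
  "size_const b C0 = (17 * sup_const\<^sup>2 * vol_root\<^sup>2 / theta ^ 4) *
     (6 * (624 * (2 * (R + 1)\<^sup>2 * step_const\<^sup>2 / theta ^ 10)
         + 12 * (2 * (R + 1)\<^sup>2 * step_const\<^sup>2 / theta ^ 10) * (C0 * (b + 1) powr b / theta)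
         + 12 * (C0 * theta powr (- b))) + 4) * ((14 / ln 2) ^ 7 * (U0 * vol_root))"

lemma small_solution_case:
  assumes \<delta>: "0 < \<delta>" and small: "U0 * sqrt vol \<le> \<delta>"
  shows "L2_norm d D (\<lambda>x. u x - dnn_fun (const_dnn d 0) x) \<le> \<delta>"
proof -
  interpret finite_measure lebesgue_D by (rule finite_lebesgue_D)
  have d0: "0 < d" using d1 by simp
  have "(\<integral>x. (u x - dnn_fun (const_dnn d 0) x)\<^sup>2 \<partial>lebesgue_D) \<le> (\<integral>x. U0\<^sup>2 \<partial>lebesgue_D)"
  proof (rule integral_mono[OF in_L2_diff(2)[OF const_dnn(1)[OF d0]]])
    fix x assume "x \<in> space lebesgue_D"
    then have "\<bar>u x\<bar> \<le> U0" using u_bound by (simp add: space_lebesgue_D)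
    then show "(u x - dnn_fun (const_dnn d 0) x)\<^sup>2 \<le> U0\<^sup>2"
      using const_dnn(2)[OF d0, of 0 x] by (simp add: abs_le_square_iff[symmetric] U0_nonneg)
  qed simp
  then have "L2_norm d D (\<lambda>x. u x - dnn_fun (const_dnn d 0) x) \<le> sqrt (vol * U0\<^sup>2)"
    unfolding L2_norm_restrict[OF open_D] using measure_lebesgue_D by (intro real_sqrt_le_mono) simp
  also have "\<dots> = U0 * sqrt vol" using U0_nonneg by (simp add: real_sqrt_mult)
  finally show ?thesis using small by simp
qed

text \<open>
  If \<open>U0 * sqrt \<bar>D\<bar> \<le> \<delta>\<close>, then the zero network suffices. Otherwise the exponential decay of the volume bounds
  \<open>2 powr (d / 2)\<close>, and hence \<open>d ^ 7\<close>, by a multiple of \<open>1 / \<delta>\<close>, and the walk is used with all network errors equal to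
  \<open>\<epsilon>\<close>.
\<close>

lemma network_exists:
  assumes ab: "1 < a" "1 < b" and C0: "0 < C0" and \<delta>: "0 < \<delta>" "\<delta> < 1"
    and nets: "\<And>\<epsilon>. 0 < \<epsilon> \<Longrightarrow> \<epsilon> < 1 \<Longrightarrow> \<exists>\<Phi>d \<Phi>f \<Phi>g. is_dnn d 1 \<Phi>d \<and> is_dnn d 1 \<Phi>f \<and> is_dnn d 1 \<Phi>g \<and>
      (\<forall>x\<in>D. \<bar>dist_bdry d D x - dnn_fun \<Phi>d x\<bar> \<le> \<epsilon>) \<and>
      (\<forall>x\<in>D. \<bar>f x - dnn_fun \<Phi>f x\<bar> \<le> \<epsilon>) \<and> (\<forall>x\<in>D. \<bar>g x - dnn_fun \<Phi>g x\<bar> \<le> \<epsilon>) \<and>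
      real (dnn_size \<Phi>d) \<le> C0 * real d powr a * real_of_int \<lceil>ln (inverse \<epsilon>)\<rceil> powr b \<and>
      real (dnn_size \<Phi>f) \<le> C0 * real d powr a * \<epsilon> powr (- b) \<and>
      real (dnn_size \<Phi>g) \<le> C0 * real d powr a * \<epsilon> powr (- b)"
  shows "\<exists>\<Phi>. is_dnn d 1 \<Phi> \<and> L2_norm d D (\<lambda>x. u x - dnn_fun \<Phi> x) \<le> \<delta> \<and>
     real (dnn_size \<Phi>) \<le> max 1 (size_const b C0) * real d powr a * \<delta> powr (- 14 - 6 * b)"
proof (cases "U0 * sqrt vol \<le> \<delta>")
  case True
  have d0: "0 < d" using d1 by simp
  show ?thesis
  proof (intro exI[of _ "const_dnn d 0"] conjI)
    show "is_dnn d 1 (const_dnn d 0)" by (rule const_dnn(1)[OF d0])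
    show "L2_norm d D (\<lambda>x. u x - dnn_fun (const_dnn d 0) x) \<le> \<delta>" by (rule small_solution_case[OF \<delta>(1) True])
    show "real (dnn_size (const_dnn d 0)) \<le> max 1 (size_const b C0) * real d powr a * \<delta> powr (- 14 - 6 * b)"
      by (simp add: const_dnn(4)[OF d0])
  qed
next
  case False
  have dr: "1 \<le> real d" using d1 by simp
  have V1: "1 \<le> vol_root" unfolding vol_root_def by simp
  have volV: "sqrt vol \<le> vol_root * 2 powr (- (real d / 2))"
  proof -
    have "vol \<le> (vol_root * 2 powr (- (real d / 2)))\<^sup>2"
    proof -
      have "(2 powr (- (real d / 2)))\<^sup>2 = 2 powr (- real d)"
        by (simp add: power2_eq_square powr_add[symmetric])
      also have "\<dots> = (1/2) ^ d" by (simp add: powr_minus powr_realpow power_one_over inverse_eq_divide)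
      finally have "(2 powr (- (real d / 2)))\<^sup>2 = (1/2 :: real) ^ d" .
      moreover have "vol_root\<^sup>2 = exp (4 * pi * R\<^sup>2)"
        unfolding vol_root_def by (simp add: power2_eq_square exp_add[symmetric])
      ultimately show ?thesis using vol_bounds by (simp add: power_mult_distrib)
    qed
    then have "sqrt vol \<le> sqrt ((vol_root * 2 powr (- (real d / 2)))\<^sup>2)" by (rule real_sqrt_le_mono)
    then show ?thesis using V1 by simp
  qed
  have vol_le: "vol \<le> vol_root\<^sup>2"
  proof -
    have "2 powr (- (real d / 2)) \<le> 2 powr (0::real)" by (intro powr_mono) auto
    then have "2 powr (- (real d / 2)) \<le> (1::real)" by simp
    then have "vol_root * 2 powr (- (real d / 2)) \<le> vol_root * 1" using V1 by (intro mult_left_mono) auto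
    then have "sqrt vol \<le> vol_root" using volV by simp
    then have "(sqrt vol)\<^sup>2 \<le> vol_root\<^sup>2" using vol_bounds by (intro power_mono) auto
    then show ?thesis using vol_bounds by simp
  qed
  define X where "X = 1 / \<delta>"
  have X1: "1 \<le> X" using \<delta> by (simp add: X_def)
  have q: "real d ^ 7 \<le> (14 / ln 2) ^ 7 * (U0 * vol_root) * X"
  proof -
    have "\<delta> < U0 * (vol_root * 2 powr (- (real d / 2)))"
      using False volV U0_nonneg mult_left_mono[OF volV U0_nonneg] by linarith
    then have "\<delta> * 2 powr (real d / 2) \<le> U0 * vol_root"
      by (simp add: powr_minus field_simps)
    then have "2 powr (real d / 2) \<le> U0 * vol_root * X" using \<delta> by (simp add: X_def field_simps)
    then have "(14 / ln 2) ^ 7 * 2 powr (real d / 2) \<le> (14 / ln 2) ^ 7 * (U0 * vol_root * X)"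
      by (intro mult_left_mono) auto
    from order_trans[OF dimension_vs_exponential this] show ?thesis by (simp only: mult.assoc)
  qed
  have F1: "1 \<le> F + 1" and R1: "1 \<le> R + 1" using F0 R0 by auto
  have E1: "1 \<le> err_const" unfolding err_const_def using F0 R0 Lf0 A0 \<Lambda>0 by simp
  have EV: "1 \<le> err_const * vol_root" using mult_mono[OF E1 V1] E1 by simp
  have th: "0 < theta" "theta \<le> 1" unfolding theta_def using EV by (auto simp: mult.assoc)
  have k1: "1 \<le> step_const" unfolding step_const_def using R0 CK0 U0_nonneg by simp
  define \<epsilon> where "\<epsilon> = theta * \<delta>"
  have \<epsilon>: "0 < \<epsilon>" "\<epsilon> < 1" "\<epsilon> \<le> 1"
  proof -
    show "0 < \<epsilon>" using th \<delta> by (simp add: \<epsilon>_def)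
    have "theta * \<delta> \<le> 1 * \<delta>" using th \<delta> by (intro mult_right_mono) auto
    then show "\<epsilon> < 1" "\<epsilon> \<le> 1" using \<delta> unfolding \<epsilon>_def by linarith+
  qed
  obtain \<Phi>d \<Phi>f \<Phi>g where net: "is_dnn d 1 \<Phi>d" "is_dnn d 1 \<Phi>f" "is_dnn d 1 \<Phi>g"
    and ed: "\<And>x. x \<in> D \<Longrightarrow> \<bar>dist_bdry d D x - dnn_fun \<Phi>d x\<bar> \<le> \<epsilon>"
    and ef: "\<And>x. x \<in> D \<Longrightarrow> \<bar>f x - dnn_fun \<Phi>f x\<bar> \<le> \<epsilon>" and eg: "\<And>x. x \<in> D \<Longrightarrow> \<bar>g x - dnn_fun \<Phi>g x\<bar> \<le> \<epsilon>"
    and sd: "real (dnn_size \<Phi>d) \<le> C0 * real d powr a * real_of_int \<lceil>ln (inverse \<epsilon>)\<rceil> powr b"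
    and sf: "real (dnn_size \<Phi>f) \<le> C0 * real d powr a * \<epsilon> powr (- b)"
    and sg: "real (dnn_size \<Phi>g) \<le> C0 * real d powr a * \<epsilon> powr (- b)"
    using nets[OF \<epsilon>(1,2)] by blast
  \<comment> \<open>\<open>\<epsilon> ^ 3 / d ^ 3\<close> cancels the cubed scale of the kernel; one more factor \<open>\<epsilon>\<close> is the error allowed\<close>
  define \<gamma> where "\<gamma> = \<epsilon> ^ 4 / (step_const * real d ^ 3)"
  have d3: "1 \<le> real d ^ 3" using dr by (rule one_le_power)
  have den: "1 \<le> step_const * real d ^ 3" using mult_mono[OF k1 d3] k1 by simp
  have \<gamma>0: "0 < \<gamma>" using \<epsilon> den by (simp add: \<gamma>_def)
  have \<epsilon>4: "\<epsilon> ^ 4 \<le> \<epsilon>" using power_decreasing[of 1 4 \<epsilon>] \<epsilon> by simp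
  have \<gamma>1: "\<gamma> \<le> \<epsilon>"
  proof -
    have "\<gamma> \<le> \<epsilon> ^ 4 / 1" unfolding \<gamma>_def using \<epsilon> den by (intro divide_left_mono) auto
    then show ?thesis using \<epsilon>4 by simp
  qed
  have \<gamma>R: "\<gamma> * R * real d \<le> \<epsilon>"
  proof -
    have "R * real d \<le> step_const * real d ^ 3"
      using R0 CK0 U0_nonneg d3 dr power_increasing[of 1 3 "real d"]
      by (intro mult_mono) (auto simp: step_const_def)
    then have "\<gamma> * (R * real d) \<le> \<gamma> * (step_const * real d ^ 3)" using \<gamma>0 by (intro mult_left_mono) auto
    also have "\<dots> = \<epsilon> ^ 4" unfolding \<gamma>_def by (rule nonzero_eq_divide_eq[THEN iffD1, OF _ refl]) (use den in linarith)
    finally show ?thesis using \<epsilon>4 by (simp add: mult.assoc)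
  qed
  define \<mu> where "\<mu> = (R + 1)\<^sup>2 / (\<epsilon>\<^sup>2 * \<gamma>\<^sup>2)"
  have eg1: "\<epsilon>\<^sup>2 * \<gamma>\<^sup>2 \<le> 1" using \<epsilon> \<gamma>0 \<gamma>1 by (intro mult_le_one power_le_one) auto
  have eg0: "0 < \<epsilon>\<^sup>2 * \<gamma>\<^sup>2" using \<epsilon> \<gamma>0 by simp
  have \<mu>1: "1 \<le> \<mu>"
  proof -
    have "1 \<le> (R + 1)\<^sup>2" using R1 by (rule one_le_power)
    then have "\<epsilon>\<^sup>2 * \<gamma>\<^sup>2 \<le> (R + 1)\<^sup>2" using eg1 by linarith
    then show ?thesis unfolding \<mu>_def using eg0 by (simp add: pos_le_divide_eq)
  qed
  \<comment> \<open>also the number of iterations for the squares, since \<open>M * M \<le> 4 ^ M\<close>\<close>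
  define M where "M = nat \<lceil>\<mu>\<rceil>"
  have Mb: "\<mu> \<le> real M" "real M \<le> 2 * \<mu>" using \<mu>1 unfolding M_def by linarith+
  have M0: "0 < M" "1 \<le> M" using Mb \<mu>1 by (auto simp: Suc_le_eq)
  have MR: "(R + 1)\<^sup>2 \<le> \<epsilon>\<^sup>2 * \<gamma>\<^sup>2 * real M"
    using Mb(1) eg0 unfolding \<mu>_def by (simp add: pos_divide_le_eq mult.commute)
  have MR': "R\<^sup>2 \<le> \<epsilon>\<^sup>2 * \<gamma>\<^sup>2 * real M"
  proof -
    have "R\<^sup>2 \<le> (R + 1)\<^sup>2" using R0 by (intro power_mono) auto
    then show ?thesis using MR by linarith
  qed
  have M\<gamma>: "real M * \<gamma>\<^sup>2 \<le> 2 * (R + 1)\<^sup>2 / \<epsilon>\<^sup>2"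
  proof -
    have "real M * \<gamma>\<^sup>2 \<le> 2 * \<mu> * \<gamma>\<^sup>2" using Mb by (intro mult_right_mono) auto
    also have "\<dots> = 2 * (R + 1)\<^sup>2 / \<epsilon>\<^sup>2" using \<gamma>0 by (simp add: \<mu>_def)
    finally show ?thesis .
  qed
  define B where "B = G + 1 + real M * \<gamma>\<^sup>2 * (R + 1)\<^sup>2 * (F + 1)"
  have B1: "1 \<le> B" unfolding B_def using G0 F0 by simp
  have Bs: "B \<le> sup_const / \<epsilon>\<^sup>2"
  proof -
    have "real M * \<gamma>\<^sup>2 * ((R + 1)\<^sup>2 * (F + 1)) \<le> 2 * (R + 1)\<^sup>2 / \<epsilon>\<^sup>2 * ((R + 1)\<^sup>2 * (F + 1))"
      using M\<gamma> F0 by (intro mult_right_mono) auto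
    also have "\<dots> = 2 * (R + 1) ^ 4 * (F + 1) / \<epsilon>\<^sup>2" by (simp add: eval_nat_numeral mult_ac)
    finally have 1: "real M * \<gamma>\<^sup>2 * (R + 1)\<^sup>2 * (F + 1) \<le> 2 * (R + 1) ^ 4 * (F + 1) / \<epsilon>\<^sup>2" by (simp only: mult.assoc)
    have "(G + 1) / 1 \<le> (G + 1) / \<epsilon>\<^sup>2" using \<epsilon> G0 by (intro divide_left_mono power_le_one) auto
    then show ?thesis using 1 unfolding B_def sup_const_def by (simp add: add_divide_distrib)
  qed
  define E where "E = (\<epsilon> + 2 * real M * \<gamma>\<^sup>2 * (R + 1)\<^sup>2 * (F + 1) / 4 ^ M) + \<epsilon> * R\<^sup>2
       + (CK * U0 * \<gamma> * R * real d ^ 3 / (2 * \<epsilon> ^ 3) + Lf * \<epsilon> / 2) * R\<^sup>2 + 3 * A * R * \<epsilon> + 2 * \<Lambda> * \<epsilon>"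
  have Eb: "E \<le> err_const * \<epsilon>"
  proof -
    have t1: "2 * real M * \<gamma>\<^sup>2 * (R + 1)\<^sup>2 * (F + 1) / 4 ^ M \<le> 2 * (F + 1) * \<epsilon>"
    proof -
      have "(R + 1)\<^sup>2 * real M \<le> \<epsilon>\<^sup>2 * \<gamma>\<^sup>2 * real M * real M" using MR by (intro mult_right_mono) auto
      also have "\<dots> \<le> 1 * (real M * real M)" unfolding mult.assoc[of "\<epsilon>\<^sup>2 * \<gamma>\<^sup>2"]
        using eg1 by (intro mult_right_mono) auto
      also have "\<dots> \<le> 4 ^ M" using square_le_four_power[of M] by simp
      finally have 1: "(R + 1)\<^sup>2 * real M / 4 ^ M \<le> 1" by (simp add: pos_divide_le_eq)
      have 2: "\<gamma>\<^sup>2 \<le> \<epsilon>"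
      proof -
        have "\<gamma> * \<gamma> \<le> \<epsilon> * 1" using \<gamma>0 \<gamma>1 \<epsilon> by (intro mult_mono) auto
        then show ?thesis by (simp add: power2_eq_square)
      qed
      have "2 * real M * \<gamma>\<^sup>2 * (R + 1)\<^sup>2 * (F + 1) / 4 ^ M = 2 * (F + 1) * (\<gamma>\<^sup>2 * ((R + 1)\<^sup>2 * real M / 4 ^ M))"
        by (simp add: mult_ac)
      also have "\<dots> \<le> 2 * (F + 1) * (\<epsilon> * 1)" using 1 2 \<epsilon> F0 by (intro mult_left_mono mult_mono) auto
      finally show ?thesis by simp
    qed
    have t2: "(CK * U0 * \<gamma> * R * real d ^ 3 / (2 * \<epsilon> ^ 3) + Lf * \<epsilon> / 2) * R\<^sup>2 \<le> (1 + Lf) * R\<^sup>2 * \<epsilon>"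
    proof -
      have g3: "\<gamma> * real d ^ 3 = \<epsilon> ^ 4 / step_const" using d1 by (simp add: \<gamma>_def)
      have "CK * U0 * \<gamma> * R * real d ^ 3 / (2 * \<epsilon> ^ 3) = (CK * U0 * R) * (\<gamma> * real d ^ 3) / (2 * \<epsilon> ^ 3)"
        by (simp only: mult_ac)
      also have "\<dots> = (CK * U0 * R) * (\<epsilon> ^ 4 / step_const) / (2 * \<epsilon> ^ 3)" by (simp only: g3)
      also have "\<dots> = (CK * U0 * R / step_const) * (\<epsilon> / 2)" using \<epsilon> by (simp add: eval_nat_numeral)
      also have "\<dots> \<le> 1 * (\<epsilon> / 2)"
        using k1 R0 \<epsilon> by (intro mult_right_mono) (auto simp: step_const_def)
      finally have "CK * U0 * \<gamma> * R * real d ^ 3 / (2 * \<epsilon> ^ 3) \<le> \<epsilon> / 2" by simp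
      moreover have "0 \<le> Lf * \<epsilon>" using \<epsilon> Lf0 by simp
      moreover have "(1 + Lf) * \<epsilon> = \<epsilon> + Lf * \<epsilon>" by (simp add: distrib_right)
      ultimately have "CK * U0 * \<gamma> * R * real d ^ 3 / (2 * \<epsilon> ^ 3) + Lf * \<epsilon> / 2 \<le> (1 + Lf) * \<epsilon>"
        using \<epsilon> by linarith
      from mult_right_mono[OF this, of "R\<^sup>2"] show ?thesis by (simp add: mult_ac)
    qed
    show ?thesis using t1 t2 unfolding E_def err_const_def by (simp add: distrib_right mult.commute[of \<epsilon>])
  qed
  have E0: "0 \<le> E" unfolding E_def using \<epsilon> F0 CK0 U0_nonneg \<gamma>0 R0 Lf0 A0 \<Lambda>0
    by (intro add_nonneg_nonneg mult_nonneg_nonneg divide_nonneg_nonneg) auto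
  have EVd: "E * vol_root \<le> \<delta> / 4"
  proof -
    have "E * vol_root \<le> err_const * \<epsilon> * vol_root" using Eb V1 by (intro mult_right_mono) auto
    also have "\<dots> = \<delta> / 4" using E1 V1 by (simp add: \<epsilon>_def theta_def)
    finally show ?thesis .
  qed
  define \<nu> where "\<nu> = 16 * B\<^sup>2 * vol_root\<^sup>2 / \<delta>\<^sup>2"
  have BV: "1 \<le> B\<^sup>2 * vol_root\<^sup>2"
    using mult_mono[OF one_le_power[OF B1, of 2] one_le_power[OF V1, of 2]] by simp
  have BVd: "1 \<le> B\<^sup>2 * vol_root\<^sup>2 / \<delta>\<^sup>2"
  proof -
    have "\<delta>\<^sup>2 \<le> 1" using \<delta> by (intro power_le_one) auto
    then show ?thesis using BV \<delta> by (simp add: pos_le_divide_eq)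
  qed
  \<comment> \<open>the sampling error of this many trajectories has square at most \<open>\<delta>\<^sup>2 / 2\<close>\<close>
  define N where "N = nat \<lceil>\<nu>\<rceil>"
  have Nb: "\<nu> \<le> real N" "real N \<le> 17 * (B\<^sup>2 * vol_root\<^sup>2 / \<delta>\<^sup>2)" "0 < \<nu>"
    using BVd unfolding N_def \<nu>_def by (simp_all add: mult.assoc) linarith+
  have N0: "0 < N" "1 \<le> N" using Nb by (auto simp: Suc_le_eq)
  obtain \<Phi> where \<Phi>: "is_dnn d 1 \<Phi>"
    "dnn_size \<Phi> \<le> N * (d * (30 * (2 * d + 4)) + M * (6 * (2 * d + 4) * (dnn_size \<Phi>d + 1) + 60 * (2 * d + 4))
       + (6 * (2 * d + 4) * (dnn_size \<Phi>d + dnn_size \<Phi>f + dnn_size \<Phi>g + 3) + 150 * (2 * d + 4) + 180 * (2 * d + 4) * (M + 1))) + 2 * d + 2"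
    "(L2_norm d D (\<lambda>x. u x - dnn_fun \<Phi> x))\<^sup>2 \<le> (2 * E\<^sup>2 + 8 * B\<^sup>2 / real N) * vol"
    using approximation_exists[OF net ed ef eg \<epsilon>(1,3) \<gamma>0 _ \<gamma>R M0(1) MR' N0(1) B_def E_def] \<gamma>1 \<epsilon> by auto
  have "(2 * E\<^sup>2 + 8 * B\<^sup>2 / real N) * vol \<le> (2 * E\<^sup>2 + 8 * B\<^sup>2 / real N) * vol_root\<^sup>2"
    using vol_le by (intro mult_left_mono) auto
  also have "\<dots> = 2 * (E * vol_root)\<^sup>2 + 8 * (B\<^sup>2 * vol_root\<^sup>2) / real N"
    by (simp add: power_mult_distrib distrib_right)
  also have "\<dots> \<le> 2 * (\<delta> / 4)\<^sup>2 + \<delta>\<^sup>2 / 2"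
  proof (intro add_mono mult_left_mono power_mono)
    have "8 * (B\<^sup>2 * vol_root\<^sup>2) / real N \<le> 8 * (B\<^sup>2 * vol_root\<^sup>2) / \<nu>"
      using Nb N0 by (intro divide_left_mono) auto
    also have "\<dots> = \<delta>\<^sup>2 / 2" using B1 V1 \<delta> by (simp add: \<nu>_def)
    finally show "8 * (B\<^sup>2 * vol_root\<^sup>2) / real N \<le> \<delta>\<^sup>2 / 2" .
  qed (use EVd E0 V1 in auto)
  also have "\<dots> \<le> \<delta>\<^sup>2" by (simp add: power2_eq_square)
  finally have "(L2_norm d D (\<lambda>x. u x - dnn_fun \<Phi> x))\<^sup>2 \<le> \<delta>\<^sup>2" using \<Phi>(3) by linarith
  then have err: "L2_norm d D (\<lambda>x. u x - dnn_fun \<Phi> x) \<le> \<delta>" by (rule power2_le_imp_le) (use \<delta> in simp)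
  have eX: "1 / \<epsilon> = X / theta" by (simp add: \<epsilon>_def X_def)
  have cN: "real N \<le> (17 * sup_const\<^sup>2 * vol_root\<^sup>2 / theta ^ 4) * X ^ 6"
  proof -
    have "B\<^sup>2 \<le> (sup_const / \<epsilon>\<^sup>2)\<^sup>2" using Bs B1 by (intro power_mono) auto
    then have "17 * (B\<^sup>2 * vol_root\<^sup>2 / \<delta>\<^sup>2) \<le> 17 * ((sup_const / \<epsilon>\<^sup>2)\<^sup>2 * vol_root\<^sup>2 / \<delta>\<^sup>2)"
      by (intro mult_left_mono divide_right_mono mult_right_mono) auto
    also have "\<dots> = (17 * sup_const\<^sup>2 * vol_root\<^sup>2 / theta ^ 4) * X ^ 6"
      by (simp add: \<epsilon>_def X_def power_divide power_mult_distrib eval_nat_numeral mult_ac)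
    finally show ?thesis using Nb(2) by linarith
  qed
  have cM: "real M \<le> (2 * (R + 1)\<^sup>2 * step_const\<^sup>2 / theta ^ 10) * real d ^ 6 * X ^ 10"
  proof -
    have p: "theta\<^sup>2 * \<delta>\<^sup>2 * (theta ^ 8 * \<delta> ^ 8) = theta ^ 10 * \<delta> ^ 10"
      using power_add[of theta 2 8] power_add[of \<delta> 2 8] by (simp add: mult_ac)
    have "2 * \<mu> = (2 * (R + 1)\<^sup>2 * step_const\<^sup>2 / theta ^ 10) * real d ^ 6 * X ^ 10"
      by (simp add: \<mu>_def \<gamma>_def \<epsilon>_def X_def power_divide power_mult_distrib power_mult[symmetric] p[unfolded mult.assoc] mult.assoc)
    then show ?thesis using Mb(2) by simp
  qed
  have csd: "real (dnn_size \<Phi>d) \<le> (C0 * (b + 1) powr b / theta) * real d powr a * X"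
  proof -
    have "C0 * real d powr a * real_of_int \<lceil>ln (inverse \<epsilon>)\<rceil> powr b \<le> C0 * real d powr a * ((b + 1) powr b / \<epsilon>)"
      using log_cost[OF \<epsilon>(1,2) ab(2)] C0 by (intro mult_left_mono) auto
    also have "\<dots> = (C0 * (b + 1) powr b / theta) * real d powr a * X"
      by (simp add: \<epsilon>_def X_def)
    finally show ?thesis using sd by linarith
  qed
  have e: "\<epsilon> powr (- b) = theta powr (- b) * X powr b"
    using th \<delta> by (simp add: \<epsilon>_def X_def powr_mult powr_minus inverse_powr divide_inverse)
  have csf: "real (dnn_size \<Phi>f) \<le> (C0 * theta powr (- b)) * real d powr a * X powr b"
    and csg: "real (dnn_size \<Phi>g) \<le> (C0 * theta powr (- b)) * real d powr a * X powr b"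
    using sf sg unfolding e by (simp_all add: mult_ac)
  have "real (dnn_size \<Phi>) \<le> size_const b C0 * real d powr a * X powr (14 + 6 * b)"
    unfolding size_const_def
    by (rule order_trans[OF _ weight_count[OF d1 X1 ab _ _ _ _ _ N0(2) cN M0(2) cM csd csf csg]])
      (use \<Phi>(2) q th C0 U0_nonneg V1 ab in \<open>auto simp del: of_nat_add of_nat_mult\<close>)
  also have "\<dots> \<le> max 1 (size_const b C0) * real d powr a * X powr (14 + 6 * b)"
    by (intro mult_right_mono) auto
  also have "X powr (14 + 6 * b) = \<delta> powr (- 14 - 6 * b)"
    using \<delta> by (simp add: X_def powr_divide powr_minus_divide[symmetric])
  finally show ?thesis using \<Phi>(1) err by blast
qed

end

text \<open>
  The infimum in the definition of the least Lipschitz constant is attained.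
\<close>

lemma lip_const_bound:
  assumes l: "lipschitz_cont_on d S h" and xy: "x \<in> S" "y \<in> S"
  shows "\<bar>h x - h y\<bar> \<le> lip_const d S h * edist d x y"
proof -
  have ne: "lip_bounds d S h \<noteq> {}" using l by (simp add: lipschitz_cont_on_def)
  have K: "\<bar>h x - h y\<bar> \<le> K * edist d x y" if "K \<in> lip_bounds d S h" for K
    using that xy by (auto simp: lip_bounds_def)
  show ?thesis
  proof (cases "edist d x y = 0")
    case True then show ?thesis using ne K by force
  next
    case False
    then have p: "0 < edist d x y" using edist_nonneg[of d x y] by linarith
    have "\<bar>h x - h y\<bar> / edist d x y \<le> lip_const d S h" unfolding lip_const_def
      by (rule cInf_greatest[OF ne]) (use K p in \<open>auto simp: pos_divide_le_eq\<close>)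
    then show ?thesis using p by (simp add: pos_divide_le_eq)
  qed
qed

lemma lip_const_nonneg: "lipschitz_cont_on d S h \<Longrightarrow> 0 \<le> lip_const d S h"
  unfolding lipschitz_cont_on_def lip_const_def by (rule cInf_greatest) (auto simp: lip_bounds_def)

text \<open>
  The essential suprema bound the functions pointwise because \<open>f\<close>, \<open>g\<close> and the Laplacian of \<open>g\<close> are continuous and, as
  restrictions of functions continuous on a compact set, bounded.
\<close>

lemma poisson_problem_of_data:
  assumes d: "1 \<le> d" and D: "bounded_convex_domain d D"
    and f: "lipschitz_cont_on d (rtop d closure_of D) f"
    and g: "C2_on_closure d D g" "lipschitz_cont_on d (rtop d closure_of D) g"
    and u: "poisson_solution d D f g u"
  shows "poisson_problem d D f g u (real_of_ereal (Linf_norm d D f)) (real_of_ereal (Linf_norm d D (laplacian d g)))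
     (real_of_ereal (Linf_norm d D g)) (lip_const d (rtop d closure_of D) f) (lip_const d (rtop d closure_of D) g) (ediam d D)"
proof
  let ?K = "rtop d closure_of D"
  have op: "openin (rtop d) D" using D by (simp add: bounded_convex_domain_def)
  obtain R where R: "\<And>x y. x \<in> D \<Longrightarrow> y \<in> D \<Longrightarrow> edist d x y \<le> R"
    using D unfolding bounded_convex_domain_def by blast
  have bd: "ebounded d D" unfolding ebounded_def using R by blast
  have sub: "D \<subseteq> ?K" by (rule open_subset_closure[OF op])
  have cf: "cont_on d ?K f" by (rule lipschitz_imp_cont_on[OF closure_of_subset_topspace lip_const_bound[OF f]])
  have gc: "cont_on d ?K g" "C2_on d D g" using g(1) unfolding C2_on_closure_def by auto
  show "1 \<le> d" by (rule d)
  show "openin (rtop d) D" by (rule op)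
  show "D \<noteq> {}" using D by (simp add: bounded_convex_domain_def)
  show "seg d x y t \<in> D" if "x \<in> D" "y \<in> D" "0 \<le> t" "t \<le> 1" for x y t
    using D that unfolding bounded_convex_domain_def seg_def by force
  show "edist d x y \<le> ediam d D" if "x \<in> D" "y \<in> D" for x y
  proof -
    have "bdd_above ((\<lambda>(x, y). edist d x y) ` (D \<times> D))" by (rule bdd_aboveI[of _ R]) (use R in auto)
    then show ?thesis unfolding ediam_def using that cSUP_upper[of "(x, y)" "D \<times> D" "\<lambda>(x, y). edist d x y"] by auto
  qed
  have bound: "\<bar>h x\<bar> \<le> real_of_ereal (Linf_norm d D h)"
    if c: "cont_on d ?K H" "\<And>x. x \<in> D \<Longrightarrow> H x = h x" and x: "x \<in> D" for h H x
  proof -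
    obtain B where B: "\<And>x. x \<in> ?K \<Longrightarrow> \<bar>H x\<bar> \<le> B"
      using compact_bounded_fun[OF compactin_closure[OF bd] c(1)] by blast
    show ?thesis
      by (rule Linf_norm_bounds_fun[OF op cont_on_cong[OF cont_on_subset[OF c(1) sub] c(2)] x, where B = B])
         (use B c(2) sub in force)+
  qed
  show "\<bar>f x\<bar> \<le> real_of_ereal (Linf_norm d D f)" if "x \<in> D" for x by (rule bound[OF cf _ that]) simp
  show "\<bar>g x\<bar> \<le> real_of_ereal (Linf_norm d D g)" if "x \<in> D" for x by (rule bound[OF gc(1) _ that]) simp
  show "\<bar>laplacian d g x\<bar> \<le> real_of_ereal (Linf_norm d D (laplacian d g))" if "x \<in> D" for x
  proof -
    have "\<forall>i<d. \<exists>H. cont_on d ?K H \<and> (\<forall>x\<in>D. H x = partial i (partial i g) x)"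
      using g(1) unfolding C2_on_closure_def extends_cont_def by blast
    then obtain H where H: "\<And>i. i < d \<Longrightarrow> cont_on d ?K (H i)" "\<And>i x. i < d \<Longrightarrow> x \<in> D \<Longrightarrow> H i x = partial i (partial i g) x"
      by metis
    have "cont_on d ?K (\<lambda>x. \<Sum>i<d. H i x)" using H by (intro cont_on_sum) auto
    then show ?thesis by (rule bound[OF _ _ that]) (use H in \<open>auto simp: laplacian_def\<close>)
  qed
  show "\<bar>f x - f y\<bar> \<le> lip_const d ?K f * edist d x y" if "x \<in> D" "y \<in> D" for x y
    using lip_const_bound[OF f] sub that by blast
  show "C2_on d D g" "cont_on d ?K g" by (rule gc)+
  show "\<bar>g x - g y\<bar> \<le> lip_const d ?K g * edist d x y" if "x \<in> ?K" "y \<in> ?K" for x y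
    using lip_const_bound[OF g(2) that] .
  show "0 \<le> lip_const d ?K f" "0 \<le> lip_const d ?K g" using lip_const_nonneg f g(2) by auto
  show "poisson_solution d D f g u" by (rule u)
qed

theorem theorem4p1:
  fixes a b C0 :: real
  assumes "1 < a" and "1 < b" and "0 < C0"
  shows "\<exists>C :: real \<Rightarrow> real \<Rightarrow> real \<Rightarrow> real \<Rightarrow> real \<Rightarrow> real \<Rightarrow> real.
    (\<forall>F LapG G Lf Lg diam. 0 < C F LapG G Lf Lg diam) \<and>
    (\<forall>(d::nat) D f g u.
       1 \<le> d \<longrightarrow>
       bounded_convex_domain d D \<longrightarrow>
       holder_cont_on d (rtop d closure_of D) f \<longrightarrow>
       lipschitz_cont_on d (rtop d closure_of D) f \<longrightarrow>
       C2_on_closure d D g \<longrightarrow>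
       lipschitz_cont_on d (rtop d closure_of D) g \<longrightarrow>
       poisson_solution d D f g u \<longrightarrow>
       (\<forall>\<delta>\<in>{0<..<1}. \<forall>\<delta>f\<in>{0<..<1}. \<forall>\<delta>g\<in>{0<..<1}. \<exists>\<Phi>dist \<Phi>f \<Phi>g.
          is_dnn d 1 \<Phi>dist \<and> is_dnn d 1 \<Phi>f \<and> is_dnn d 1 \<Phi>g \<and>
          (\<forall>x\<in>D. \<bar>dist_bdry d D x - dnn_fun \<Phi>dist x\<bar> \<le> \<delta>) \<and>
          Linf_norm d D (\<lambda>x. f x - dnn_fun \<Phi>f x) \<le> ereal \<delta>f \<and>
          Linf_norm d D (\<lambda>x. g x - dnn_fun \<Phi>g x) \<le> ereal \<delta>g \<and>
          real (dnn_size \<Phi>dist) \<le> C0 * real d powr a * real_of_int \<lceil>ln (inverse \<delta>)\<rceil> powr b \<and>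
          real (dnn_size \<Phi>f) \<le> C0 * real d powr a * \<delta>f powr (- b) \<and>
          real (dnn_size \<Phi>g) \<le> C0 * real d powr a * \<delta>g powr (- b)) \<longrightarrow>
       (\<forall>\<delta>\<in>{0<..<1}. \<exists>\<Phi>u.
          is_dnn d 1 \<Phi>u \<and>
          in_L2 d D (\<lambda>x. u x - dnn_fun \<Phi>u x) \<and>
          L2_norm d D (\<lambda>x. u x - dnn_fun \<Phi>u x) \<le> \<delta> \<and>
          real (dnn_size \<Phi>u) \<le>
            C (real_of_ereal (Linf_norm d D f))
              (real_of_ereal (Linf_norm d D (laplacian d g)))
              (real_of_ereal (Linf_norm d D g))
              (lip_const d (rtop d closure_of D) f)
              (lip_const d (rtop d closure_of D) g)
              (ediam d D)
            * real d powr a * \<delta> powr (- 14 - 6 * b) *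
            (1 + measure (rleb d) D powr (14 + 6 * b))))"
proof (intro exI[of _ "\<lambda>F LapG G Lf Lg diam. max 1 (poisson_problem.size_const F LapG G Lf Lg diam b C0)"] conjI allI impI ballI)
  show "0 < max 1 (poisson_problem.size_const F LapG G Lf Lg diam b C0)" for F LapG G Lf Lg diam
    by simp
next
  fix d D f g u and \<delta> :: real
  assume d: "1 \<le> d" and D: "bounded_convex_domain d D"
    and f: "lipschitz_cont_on d (rtop d closure_of D) f"
    and g: "C2_on_closure d D g" "lipschitz_cont_on d (rtop d closure_of D) g"
    and u: "poisson_solution d D f g u"
    and H: "\<forall>\<delta>\<in>{0<..<1}. \<forall>\<delta>f\<in>{0<..<1}. \<forall>\<delta>g\<in>{0<..<1}. \<exists>\<Phi>dist \<Phi>f \<Phi>g.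
          is_dnn d 1 \<Phi>dist \<and> is_dnn d 1 \<Phi>f \<and> is_dnn d 1 \<Phi>g \<and>
          (\<forall>x\<in>D. \<bar>dist_bdry d D x - dnn_fun \<Phi>dist x\<bar> \<le> \<delta>) \<and>
          Linf_norm d D (\<lambda>x. f x - dnn_fun \<Phi>f x) \<le> ereal \<delta>f \<and>
          Linf_norm d D (\<lambda>x. g x - dnn_fun \<Phi>g x) \<le> ereal \<delta>g \<and>
          real (dnn_size \<Phi>dist) \<le> C0 * real d powr a * real_of_int \<lceil>ln (inverse \<delta>)\<rceil> powr b \<and>
          real (dnn_size \<Phi>f) \<le> C0 * real d powr a * \<delta>f powr (- b) \<and>
          real (dnn_size \<Phi>g) \<le> C0 * real d powr a * \<delta>g powr (- b)"
    and \<delta>: "\<delta> \<in> {0<..<1}"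
  interpret poisson_problem d D f g u "real_of_ereal (Linf_norm d D f)"
    "real_of_ereal (Linf_norm d D (laplacian d g))" "real_of_ereal (Linf_norm d D g)"
    "lip_const d (rtop d closure_of D) f" "lip_const d (rtop d closure_of D) g" "ediam d D"
    by (rule poisson_problem_of_data[OF d D f g u])
  let ?C = "max 1 (size_const b C0)"
  have cf: "cont_on d D f" by (rule lipschitz_imp_cont_on[OF _ f_lip]) (use D_space in auto)
  have cg: "cont_on d D g" using g_cont by (rule cont_on_subset) (use D_closure in blast)
  have "\<exists>\<Phi>. is_dnn d 1 \<Phi> \<and> L2_norm d D (\<lambda>x. u x - dnn_fun \<Phi> x) \<le> \<delta> \<and>
     real (dnn_size \<Phi>) \<le> ?C * real d powr a * \<delta> powr (- 14 - 6 * b)"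
  proof (rule network_exists[OF assms])
    fix \<epsilon> :: real assume \<epsilon>: "0 < \<epsilon>" "\<epsilon> < 1"
    then have "\<epsilon> \<in> {0<..<1}" by simp
    with H obtain \<Phi>d \<Phi>f \<Phi>g where n: "is_dnn d 1 \<Phi>d" "is_dnn d 1 \<Phi>f" "is_dnn d 1 \<Phi>g"
      and e: "\<forall>x\<in>D. \<bar>dist_bdry d D x - dnn_fun \<Phi>d x\<bar> \<le> \<epsilon>"
          "Linf_norm d D (\<lambda>x. f x - dnn_fun \<Phi>f x) \<le> ereal \<epsilon>"
          "Linf_norm d D (\<lambda>x. g x - dnn_fun \<Phi>g x) \<le> ereal \<epsilon>"
      and s: "real (dnn_size \<Phi>d) \<le> C0 * real d powr a * real_of_int \<lceil>ln (inverse \<epsilon>)\<rceil> powr b"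
          "real (dnn_size \<Phi>f) \<le> C0 * real d powr a * \<epsilon> powr (- b)"
          "real (dnn_size \<Phi>g) \<le> C0 * real d powr a * \<epsilon> powr (- b)" by blast
    have "\<forall>x\<in>D. \<bar>f x - dnn_fun \<Phi>f x\<bar> \<le> \<epsilon>" "\<forall>x\<in>D. \<bar>g x - dnn_fun \<Phi>g x\<bar> \<le> \<epsilon>"
      using Linf_norm_pointwise[OF open_D cont_on_diff[OF cf cont_on_dnn_fun[OF n(2)]] _ e(2)]
        Linf_norm_pointwise[OF open_D cont_on_diff[OF cg cont_on_dnn_fun[OF n(3)]] _ e(3)] by auto
    then show "\<exists>\<Phi>d \<Phi>f \<Phi>g. is_dnn d 1 \<Phi>d \<and> is_dnn d 1 \<Phi>f \<and> is_dnn d 1 \<Phi>g \<and>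
      (\<forall>x\<in>D. \<bar>dist_bdry d D x - dnn_fun \<Phi>d x\<bar> \<le> \<epsilon>) \<and>
      (\<forall>x\<in>D. \<bar>f x - dnn_fun \<Phi>f x\<bar> \<le> \<epsilon>) \<and> (\<forall>x\<in>D. \<bar>g x - dnn_fun \<Phi>g x\<bar> \<le> \<epsilon>) \<and>
      real (dnn_size \<Phi>d) \<le> C0 * real d powr a * real_of_int \<lceil>ln (inverse \<epsilon>)\<rceil> powr b \<and>
      real (dnn_size \<Phi>f) \<le> C0 * real d powr a * \<epsilon> powr (- b) \<and>
      real (dnn_size \<Phi>g) \<le> C0 * real d powr a * \<epsilon> powr (- b)" using n e(1) s by blast
  qed (use \<delta> in auto)
  then obtain \<Phi> where \<Phi>: "is_dnn d 1 \<Phi>" "L2_norm d D (\<lambda>x. u x - dnn_fun \<Phi> x) \<le> \<delta>"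
     "real (dnn_size \<Phi>) \<le> ?C * real d powr a * \<delta> powr (- 14 - 6 * b)" by blast
  have "?C * real d powr a * \<delta> powr (- 14 - 6 * b) * 1 \<le>
      ?C * real d powr a * \<delta> powr (- 14 - 6 * b) * (1 + measure (rleb d) D powr (14 + 6 * b))"
    by (intro mult_left_mono) auto
  then have "real (dnn_size \<Phi>) \<le>
      ?C * real d powr a * \<delta> powr (- 14 - 6 * b) * (1 + measure (rleb d) D powr (14 + 6 * b))"
    using \<Phi>(3) by linarith
  then show "\<exists>\<Phi>u. is_dnn d 1 \<Phi>u \<and> in_L2 d D (\<lambda>x. u x - dnn_fun \<Phi>u x) \<and>
      L2_norm d D (\<lambda>x. u x - dnn_fun \<Phi>u x) \<le> \<delta> \<and>
      real (dnn_size \<Phi>u) \<le>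
      ?C * real d powr a * \<delta> powr (- 14 - 6 * b) * (1 + measure (rleb d) D powr (14 + 6 * b))"
    using \<Phi>(1,2) in_L2_diff(1)[OF \<Phi>(1)] by blast
qed

end
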